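(* Let $\widehat\mu$ be a probability measure on the Hofbauer tower $\widehat M$ which is the weak star limit of a subsequence of $\{\widehat m_n\}_{n\ge1}$ and satisfies $\pi_*\widehat\mu=\mu$. Then $\widehat\mu$ has Pesin-Sinai decomposition.
   Context: **Setting.** $M=[0,1]$ with Lebesgue measure $m$. For a sub-interval $W\subset M$ (of positive length) write $|W|=m(W)$. $T:M\to M$ is a map with a countable partition $\xi_1$ of $M$ into sub-intervals such that $T$ is strictly monotonic and $C^1$ on the interior of each element of $\xi_1$. Put $\xi_n=\bigvee_{k=0}^{n-1}T^{-k}\xi_1$, let $\mathcal S_n$ be the set of endpoints of intervals in $\xi_n$, and $\mathcal S_\infty=\bigcup_{n\ge1}\mathcal S_n$. For an interval $W$, $\{W_\alpha\}_{\alpha\in W/\xi_n}$ is the partition of $W$ into sub-intervals induced by $\xi_n$; the intervals $T^nW_\alpha$ are called the components of $T^nW$. For $x,y\in M\setminus\mathcal S_\infty$, the separation time $\mathbf s(x,y)$ is the smallest integer $n\ge1$ such that $x,y$ lie in distinct elements of $\xi_n$. For an interval $W$ and $\gamma\in(0,1)$, $\mathcal H_{W,\gamma}$ is the space of $f:M\to\mathbb R$ vanishing outside $W$ with $|f|_{W,\gamma}:=\sup\{|f(x)-f(y)|/\gamma^{\mathbf s(x,y)}: x\ne y\in W\setminus\mathcal S_\infty\}<\infty$. **Standing assumptions.** (H1) There is $q\in(0,1]$ with $\liminf_{\delta\to0}\sup_{W:|W|<\delta}\sum_{\alpha\in W/\xi_1}\left(\frac{|W|}{|TW_\alpha|}\right)^{q}\frac{|W_\alpha|}{|W|}<1$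 (sup over sub-intervals $W\subset M$). (H2) There are $C_{\mathbf J}>0$, $\gamma_{\mathbf J}\in(0,1)$ such that for every $W\in\xi_1$, $\mathbf 1_W\log|T'|\in\mathcal H_{W,\gamma_{\mathbf J}}$ with $|\mathbf 1_W\log|T'||_{W,\gamma_{\mathbf J}}\le C_{\mathbf J}$. (H3) There is an interval $U$, called a magnet, such that for any interval $W\subset M$ there is $n_W\ge1$ such that for all $n\ge n_W$ at least one component of $T^nW$ contains $U$. **Standard pairs.** Fix $\boldsymbol\gamma\in[\gamma_{\mathbf J},1)$ and $C_{\mathbf r}\ge\max\{1,2C_{\mathbf J}/(\boldsymbol\gamma^{-1}-1)\}$. A standard pair $(W,\nu)$ is an interval $W\subset M$ with an absolutely continuous probability measure $\nu$ supported on $W$ whose density $\rho=d\nu/dm$ satisfies $\log\rho\in\mathcal H_{W,\boldsymbol\gamma}$ (on $W$) with $|\log\rho|_{W,\boldsymbol\gamma}\le C_{\mathbf r}$. **Invariant measure.** $\mu$ is the absolutely continuous $T$-invariant probability measure to which $T^n_*m$ converges in total variation as $n\to\infty$ (such a measure is known to exist for every map $T$ satisfying (H1), (H2) and (H3)). **Hofbauer tower.** $\mathcal D_0=\{M\}$, $\mathcal D_n=\{T(W\cap V): W\in\xi_1,\ V\in\mathcal D_{n-1}\}$ (over intersections that are intervals) and $\mathcal D=\bigcup_{n\ge0}\mathcal D_n$, a countable collection of intervals. The tower is $\widehat M=\{(x,D)\in M\times\mathcal D: x\in\overline D\}$ with projection $\pi(x,D)=x$; for $D\in\mathcal D$, $\widehat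 D=\{(x,D):x\in\overline D\}$ is an identical copy of $\overline D$, and $\widehat M$, as the disjoint union of the $\widehat D$, carries the natural extension of the Euclidean metric. The map $\widehat T:\widehat M\setminus\pi^{-1}(\mathcal S_1)\to\widehat M$ is $\widehat T(x,D)=(T(x),T(D\cap W(x)))$, where $W(x)$ is the element of $\xi_1$ containing $x$. The base is $\widehat M_0=\{(x,M):x\in M\}$. Let $\overline m(A)=\sum_{D\in\mathcal D}m(\pi(A\cap\widehat D))$ for Borel $A\subset\widehat M$, $\overline m_n(A)=\overline m(\widehat T^{-n}A\cap\widehat M_0)$ for $n\ge0$ (probability measures with $\pi_*\overline m_n=T^n_*m$), and $\widehat m_n=\frac1n\sum_{k=0}^{n-1}\overline m_k$ for $n\ge1$. **Pesin-Sinai decomposition.** A probability measure $\widehat\nu$ on $\widehat M$ has Pesin-Sinai decomposition if its conditional decomposition with respect to the countable partition $\{\widehat D\}_{D\in\mathcal D}$ has the form $\widehat\nu(A)=\sum_{D\in\mathcal D}\lambda(D)\,\widehat\nu_D(A)$ for every Borel $A\subset\widehat M$, where (1) $0\le\lambda(D)\le1$ and $\sum_{D\in\mathcal D}\lambda(D)=1$; (2) $\widehat\nu_D$ is a probability measure on $\widehat D$ such that $(D,\pi_*\widehat\nu_D)$ is a standard pair. *)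

theory Defs
  imports "HOL-Probability.Probability"
begin

text \<open>
  Throughout, \<open>T :: real \<Rightarrow> real\<close> is used only on \<open>M = [0,1]\<close>, and \<open>\<xi>\<close> is the partition \<open>\<xi>\<^sub>1\<close>.
\<close>

abbreviation unit_M :: "real set" where
  "unit_M \<equiv> {0..1}"

definition leb_M :: "real measure" where
  "leb_M = restrict_space lborel unit_M"

abbreviation len :: "real set \<Rightarrow> real" where
  "len W \<equiv> measure lborel W"

definition subinterval :: "real set \<Rightarrow> bool" where
  "subinterval W \<longleftrightarrow> W \<subseteq> unit_M \<and> is_interval W \<and> 0 < len W"

text \<open>
  \<open>\<xi>\<close> partitions the whole of \<open>M\<close>. One-point elements are admitted, so that partitions
  such as \<open>{0}, (1/2,1], (1/3,1/2], \<dots>\<close> are covered; they carry no condition and no mass, and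
  their points belong to the set of endpoints.
\<close>
definition piecewise_monotone_map :: "(real \<Rightarrow> real) \<Rightarrow> real set set \<Rightarrow> bool" where
  "piecewise_monotone_map T \<xi> \<longleftrightarrow>
     T \<in> unit_M \<rightarrow> unit_M \<and>
     countable \<xi> \<and> partition_on unit_M \<xi> \<and> (\<forall>W\<in>\<xi>. is_interval W) \<and>
     (\<forall>W\<in>\<xi>. (strict_mono_on (interior W) T \<or> strict_antimono_on (interior W) T) \<and>
             T C1_differentiable_on (interior W))"

definition join_partition :: "(real \<Rightarrow> real) \<Rightarrow> real set set \<Rightarrow> nat \<Rightarrow> real set set" where
  "join_partition T \<xi> n =
     {{x \<in> unit_M. \<forall>k<n. (T ^^ k) x \<in> V k} | V. \<forall>k<n. V k \<in> \<xi>} - {{}}"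

text \<open>For an interval the frontier is the set of its endpoints.\<close>
definition endpoints :: "(real \<Rightarrow> real) \<Rightarrow> real set set \<Rightarrow> nat \<Rightarrow> real set" where
  "endpoints T \<xi> n = (\<Union>A\<in>join_partition T \<xi> n. frontier A)"

definition endpoints_inf :: "(real \<Rightarrow> real) \<Rightarrow> real set set \<Rightarrow> real set" where
  "endpoints_inf T \<xi> = (\<Union>n\<in>{1..}. endpoints T \<xi> n)"

definition induced_partition ::
    "(real \<Rightarrow> real) \<Rightarrow> real set set \<Rightarrow> nat \<Rightarrow> real set \<Rightarrow> real set set" where
  "induced_partition T \<xi> n W = {W \<inter> A | A. A \<in> join_partition T \<xi> n} - {{}}"

definition components ::
    "(real \<Rightarrow> real) \<Rightarrow> real set set \<Rightarrow> nat \<Rightarrow> real set \<Rightarrow> real set set" where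
  "components T \<xi> n W = (\<lambda>Wa. (T ^^ n) ` Wa) ` induced_partition T \<xi> n W"

text \<open>
  Under the expansion hypothesis \<open>H1\<close> below, distinct points outside \<open>endpoints_inf T \<xi>\<close> are
  always separated eventually, so that the minimum is attained where it is used.
\<close>
definition sep_time :: "(real \<Rightarrow> real) \<Rightarrow> real set set \<Rightarrow> real \<Rightarrow> real \<Rightarrow> nat" where
  "sep_time T \<xi> x y = (LEAST n. 1 \<le> n \<and>
     (\<exists>A\<in>join_partition T \<xi> n. \<exists>B\<in>join_partition T \<xi> n. A \<noteq> B \<and> x \<in> A \<and> y \<in> B))"

definition dyn_seminorm ::
    "(real \<Rightarrow> real) \<Rightarrow> real set set \<Rightarrow> real set \<Rightarrow> real \<Rightarrow> (real \<Rightarrow> real) \<Rightarrow> ennreal" where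
  "dyn_seminorm T \<xi> W \<gamma> f =
     (SUP (x, y) \<in> {(x, y). x \<in> W - endpoints_inf T \<xi> \<and> y \<in> W - endpoints_inf T \<xi> \<and> x \<noteq> y}.
        ennreal (\<bar>f x - f y\<bar> / \<gamma> ^ sep_time T \<xi> x y))"

definition dyn_space ::
    "(real \<Rightarrow> real) \<Rightarrow> real set set \<Rightarrow> real set \<Rightarrow> real \<Rightarrow> (real \<Rightarrow> real) set" where
  "dyn_space T \<xi> W \<gamma> = {f. (\<forall>x. x \<notin> W \<longrightarrow> f x = 0) \<and> dyn_seminorm T \<xi> W \<gamma> f < \<infinity>}"

text \<open>One-point pieces have \<open>len Wa = 0\<close> and contribute nothing to the sum.\<close>
definition H1 :: "(real \<Rightarrow> real) \<Rightarrow> real set set \<Rightarrow> bool" where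
  "H1 T \<xi> \<longleftrightarrow> (\<exists>q. 0 < q \<and> q \<le> 1 \<and>
     Liminf (at_right 0) (\<lambda>\<delta>::real. SUP W \<in> {W. subinterval W \<and> len W < \<delta>}.
       (\<Sum>\<^sub>\<infinity>Wa\<in>induced_partition T \<xi> 1 W.
          ennreal ((len W / len (T ` Wa)) powr q * (len Wa / len W)))) < 1)"

text \<open>
  As \<open>ln 0 = 0\<close> in HOL, finiteness of \<open>log |T'|\<close> has to be required separately.
\<close>
definition H2 :: "(real \<Rightarrow> real) \<Rightarrow> real set set \<Rightarrow> real \<Rightarrow> real \<Rightarrow> bool" where
  "H2 T \<xi> CJ \<gamma>J \<longleftrightarrow> 0 < CJ \<and> 0 < \<gamma>J \<and> \<gamma>J < 1 \<and>
     (\<forall>W\<in>\<xi>. (\<forall>x\<in>interior W. deriv T x \<noteq> 0) \<and>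
        (\<lambda>x. indicator W x * ln \<bar>deriv T x\<bar>) \<in> dyn_space T \<xi> W \<gamma>J \<and>
        dyn_seminorm T \<xi> W \<gamma>J (\<lambda>x. indicator W x * ln \<bar>deriv T x\<bar>) \<le> ennreal CJ)"

definition H3 :: "(real \<Rightarrow> real) \<Rightarrow> real set set \<Rightarrow> bool" where
  "H3 T \<xi> \<longleftrightarrow> (\<exists>U. subinterval U \<and>
     (\<forall>W. subinterval W \<longrightarrow>
        (\<exists>nW\<ge>1. \<forall>n\<ge>nW. \<exists>C\<in>components T \<xi> n W. U \<subseteq> C)))"

text \<open>
  The density is a class modulo null sets; \<open>\<rho>\<close> is a representative that is positive on \<open>W\<close>,
  so that \<open>log \<rho>\<close> is real-valued there.
\<close>
definition standard_pair ::
    "(real \<Rightarrow> real) \<Rightarrow> real set set \<Rightarrow> real \<Rightarrow> real \<Rightarrow> real set \<Rightarrow> real measure \<Rightarrow> bool" where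
  "standard_pair T \<xi> \<gamma> Cr W \<nu> \<longleftrightarrow>
     subinterval W \<and> sets \<nu> = sets leb_M \<and> prob_space \<nu> \<and> measure \<nu> W = 1 \<and>
     absolutely_continuous leb_M \<nu> \<and>
     (\<exists>\<rho>. \<rho> \<in> borel_measurable leb_M \<and> (\<forall>x\<in>unit_M. 0 \<le> \<rho> x) \<and> (\<forall>x\<in>W. 0 < \<rho> x) \<and>
        \<nu> = density leb_M (\<lambda>x. ennreal (\<rho> x)) \<and>
        (\<lambda>x. indicator W x * ln (\<rho> x)) \<in> dyn_space T \<xi> W \<gamma> \<and>
        dyn_seminorm T \<xi> W \<gamma> (\<lambda>x. indicator W x * ln (\<rho> x)) \<le> ennreal Cr)"

definition tv_dist :: "real measure \<Rightarrow> real measure \<Rightarrow> real" where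
  "tv_dist \<mu> \<nu> = (SUP A\<in>sets leb_M. \<bar>measure \<mu> A - measure \<nu> A\<bar>)"

definition limit_acip :: "(real \<Rightarrow> real) \<Rightarrow> real measure \<Rightarrow> bool" where
  "limit_acip T \<mu> \<longleftrightarrow>
     sets \<mu> = sets leb_M \<and> prob_space \<mu> \<and> absolutely_continuous leb_M \<mu> \<and>
     distr \<mu> leb_M T = \<mu> \<and>
     (\<lambda>n. tv_dist (distr leb_M leb_M (T ^^ n)) \<mu>) \<longlonglongrightarrow> 0"

text \<open>
  Only \<open>T\<close> on the interiors of the elements of \<open>\<xi>\<close> is constrained, so \<open>T ` (W \<inter> V)\<close> is a priori an
  interval only up to the images of at most two endpoints. The convention that all \<open>D\<close> are intervals
  is therefore a separate hypothesis wherever it is needed.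
\<close>
fun tower_level :: "(real \<Rightarrow> real) \<Rightarrow> real set set \<Rightarrow> nat \<Rightarrow> real set set" where
  "tower_level T \<xi> 0 = {unit_M}"
| "tower_level T \<xi> (Suc n) =
     {T ` (W \<inter> V) | W V. W \<in> \<xi> \<and> V \<in> tower_level T \<xi> n \<and> subinterval (W \<inter> V)}"

definition tower_sets :: "(real \<Rightarrow> real) \<Rightarrow> real set set \<Rightarrow> real set set" where
  "tower_sets T \<xi> = (\<Union>n. tower_level T \<xi> n)"

text \<open>
  The point written \<open>(x, D)\<close> on paper is the pair \<open>(D, x)\<close> here, following the convention of
  \<^const>\<open>sum_topology\<close>, whose carrier is the disjoint union of the closures of the \<open>D\<close>. The projection
  \<open>\<pi>\<close> is \<^const>\<open>snd\<close>.
\<close>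
definition tower_topology :: "(real \<Rightarrow> real) \<Rightarrow> real set set \<Rightarrow> (real set \<times> real) topology" where
  "tower_topology T \<xi> = sum_topology (\<lambda>D. top_of_set (closure D)) (tower_sets T \<xi>)"

definition tower :: "(real \<Rightarrow> real) \<Rightarrow> real set set \<Rightarrow> (real set \<times> real) set" where
  "tower T \<xi> = Sigma (tower_sets T \<xi>) closure"

definition tower_copy :: "real set \<Rightarrow> (real set \<times> real) set" where
  "tower_copy D = {D} \<times> closure D"

definition tower_borel :: "(real \<Rightarrow> real) \<Rightarrow> real set set \<Rightarrow> (real set \<times> real) measure" where
  "tower_borel T \<xi> = sigma (tower T \<xi>) {U. openin (tower_topology T \<xi>) U}"

definition elem_of :: "real set set \<Rightarrow> real \<Rightarrow> real set" where
  "elem_of \<xi> x = (THE W. W \<in> \<xi> \<and> x \<in> W)"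

definition tower_map ::
    "(real \<Rightarrow> real) \<Rightarrow> real set set \<Rightarrow> real set \<times> real \<Rightarrow> real set \<times> real" where
  "tower_map T \<xi> = (\<lambda>(D, x). (T ` (D \<inter> elem_of \<xi> x), T x))"

text \<open>Preimage under the partial map, whose domain omits the fibres over the endpoints of \<open>\<xi>\<close>.\<close>
definition tower_vimage ::
    "(real \<Rightarrow> real) \<Rightarrow> real set set \<Rightarrow> (real set \<times> real) set \<Rightarrow> (real set \<times> real) set" where
  "tower_vimage T \<xi> A = {p \<in> tower T \<xi>. snd p \<notin> endpoints T \<xi> 1 \<and> tower_map T \<xi> p \<in> A}"

definition mbar :: "(real \<Rightarrow> real) \<Rightarrow> real set set \<Rightarrow> (real set \<times> real) set \<Rightarrow> ennreal" where
  "mbar T \<xi> A = (\<Sum>\<^sub>\<infinity>D\<in>tower_sets T \<xi>. emeasure lborel (snd ` (A \<inter> tower_copy D)))"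

definition mbar_n ::
    "(real \<Rightarrow> real) \<Rightarrow> real set set \<Rightarrow> nat \<Rightarrow> (real set \<times> real) set \<Rightarrow> ennreal" where
  "mbar_n T \<xi> n A = mbar T \<xi> ((tower_vimage T \<xi> ^^ n) A \<inter> tower_copy unit_M)"

text \<open>The set function below is countably additive on Borel sets, so it is the measure defined.\<close>
definition mhat :: "(real \<Rightarrow> real) \<Rightarrow> real set set \<Rightarrow> nat \<Rightarrow> (real set \<times> real) measure" where
  "mhat T \<xi> n = measure_of (tower T \<xi>) (sets (tower_borel T \<xi>))
     (\<lambda>A. (\<Sum>k<n. mbar_n T \<xi> k A) / of_nat n)"

definition weak_star_conv ::
    "'a topology \<Rightarrow> (nat \<Rightarrow> 'a measure) \<Rightarrow> 'a measure \<Rightarrow> bool" where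
  "weak_star_conv X N \<nu> \<longleftrightarrow>
     (\<forall>f. continuous_map X euclideanreal f \<and> bounded (f ` topspace X) \<longrightarrow>
        (\<lambda>n. integral\<^sup>L (N n) f) \<longlonglongrightarrow> integral\<^sup>L \<nu> f)"

definition pesin_sinai ::
    "(real \<Rightarrow> real) \<Rightarrow> real set set \<Rightarrow> real \<Rightarrow> real \<Rightarrow> (real set \<times> real) measure \<Rightarrow> bool" where
  "pesin_sinai T \<xi> \<gamma> Cr \<nu> \<longleftrightarrow>
     (\<exists>wt N.
        (\<forall>D\<in>tower_sets T \<xi>. 0 \<le> wt D \<and> wt D \<le> (1::real)) \<and>
        (wt has_sum 1) (tower_sets T \<xi>) \<and>
        (\<forall>D\<in>tower_sets T \<xi>.
           sets (N D) = sets (tower_borel T \<xi>) \<and> prob_space (N D) \<and>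
           measure (N D) (tower_copy D) = 1 \<and>
           standard_pair T \<xi> \<gamma> Cr D (distr (N D) leb_M snd)) \<and>
        (\<forall>A\<in>sets (tower_borel T \<xi>).
           ((\<lambda>D. wt D * measure (N D) A) has_sum measure \<nu> A) (tower_sets T \<xi>)))"

end

theory Submission
  imports Defs "HOL-Complex_Analysis.Great_Picard"
begin

text \<open>
  Write \<open>s\<close> for the separation time and \<open>d x y = \<gamma> ^ s x y\<close> (and \<open>d x x = 0\<close>). By the expansion
  hypothesis \<open>\<bar>T'\<bar>\<close> is bounded below by a constant \<open>\<kappa> > 1\<close>, so two distinct points that are not
  endpoints of cylinders are separated eventually; hence \<open>d\<close> is an ultrametric on the set of those
  points, and \<open>T\<close> expands it by \<open>1 / \<gamma>\<close> inside each element of \<open>\<xi>\<close>. Call a function \<open>h \<ge> 0\<close>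
  regular with constant \<open>L\<close> if \<open>h x \<le> exp (L * d x y) * h y\<close>. This class is closed under countable
  sums, and with \<open>L = CJ / (1 / \<gamma> - 1)\<close> it is preserved by every branch of the transfer
  operator: passing from \<open>h\<close> to \<open>(h / \<bar>T'\<bar>) \<circ> (T restricted to W)\<^sup>-\<^sup>1\<close> changes the constant to
  \<open>(L + CJ) * \<gamma> = L\<close>.

  The measure \<open>mbar_n (k + 1)\<close> is the image of \<open>mbar_n k\<close> under the tower map, and the tower map
  sends the part of the level \<open>D\<close> over \<open>W \<in> \<xi>\<close> into the level \<open>T ` (D \<inter> W)\<close>. So by induction
  \<open>mbar_n k\<close> has on every level a regular density (\<open>mbar_n_density\<close>), and the same holds for
  the averages (\<open>mhat_density\<close>).

  Each level is open and closed in the tower, so weak star convergence gives weak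
  convergence on each level separately. Where the limit has positive mass, the densities are
  eventually bounded above and below and are equicontinuous with respect to \<open>d\<close>; as \<open>d\<close> is separable, a subsequence
  converges pointwise, and by dominated convergence its limit is the density of the limit measure
  (\<open>weak_limit_log_regular_density\<close>). On a level of mass zero the uniform distribution serves.

  The image \<open>T ` (D \<inter> W)\<close> may contain endpoints that are not images of interior
  points, so regularity is carried along only in the interiors of the levels. At the end the logarithm
  of the density is extended to the level with the same Lipschitz constant
  (\<open>Lipschitz_extension\<close>), which changes it on a null set only.
\<close>

section \<open>Intervals, change of variables and Lipschitz extension\<close>

lemma finite_frontier_real_interval:
  fixes W :: "real set"
  assumes "is_interval W" "bounded W"
  shows "finite (frontier W)"
proof (cases "W = {}")
  case False
  have bdd: "bdd_below W" "bdd_above W"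
    using assms(2) bounded_imp_bdd_below bounded_imp_bdd_above by auto
  have "frontier W \<subseteq> {Inf W, Sup W}"
  proof
    fix x assume x: "x \<in> frontier W"
    have cl: "x \<in> closure W" using x by (simp add: frontier_def)
    have "W \<subseteq> {Inf W..Sup W}" using bdd by (auto intro: cInf_lower cSup_upper)
    then have "closure W \<subseteq> {Inf W..Sup W}" by (meson closure_minimal closed_atLeastAtMost)
    with cl have "Inf W \<le> x" "x \<le> Sup W" by auto
    moreover have False if lt: "Inf W < x" "x < Sup W"
    proof -
      obtain a where a: "a \<in> W" "a < x" using lt(1) cInf_lessD[OF False] by blast
      obtain b where b: "b \<in> W" "x < b" using lt(2) less_cSupD[OF False] by blast
      have "{a<..<b} \<subseteq> W" 
        using mem_is_interval_1_I[OF assms(1) a(1) b(1)] by auto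
      then have "x \<in> interior W" using a b by (intro interiorI[of "{a<..<b}"]) auto
      then show False using x by (simp add: frontier_def)
    qed
    ultimately show "x \<in> {Inf W, Sup W}" by force
  qed
  then show ?thesis by (rule finite_subset) simp
qed auto

text \<open>
  An interval that arises from an open interval by adding finitely many points has gained at most its own
  endpoints.
\<close>

lemma interior_eq_of_finite_Diff:
  fixes I J :: "real set"
  assumes "open I" "is_interval I" "I \<subseteq> J" "finite (J - I)"
  shows "interior J = I"
proof
  show "I \<subseteq> interior J" using assms by (simp add: interior_maximal)
  show "interior J \<subseteq> I"
  proof
    fix p assume "p \<in> interior J"
    then obtain e where e: "e > 0" "ball p e \<subseteq> J" using mem_interior by blast
    have "infinite {p-e<..<p}" "infinite {p<..<p+e}" using e by auto
    then have "\<not> {p-e<..<p} \<subseteq> J - I" "\<not> {p<..<p+e} \<subseteq> J - I" using assms(4) finite_subset by blast+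
    moreover have "{p-e<..<p} \<subseteq> J" "{p<..<p+e} \<subseteq> J" using e by (auto simp: subset_iff dist_real_def)
    ultimately obtain a b where "a \<in> I" "b \<in> I" "a < p" "p < b"
      by (auto simp: subset_iff)
    then show "p \<in> I" using mem_is_interval_1_I[OF assms(2), of a b p] by simp
  qed
qed

text \<open>
  Both sides are integrals of \<open>f\<close> with respect to finite measures on the line. These agree on
  Borel sets by the change of variables formula for the Lebesgue integral, so no integrability of \<open>f\<close> is
  needed.
\<close>

lemma nn_integral_change_of_variables_1:
  fixes g g' :: "real \<Rightarrow> real" and f :: "real \<Rightarrow> ennreal"
  assumes "open S" and der: "\<And>x. x \<in> S \<Longrightarrow> (g has_real_derivative g' x) (at x)"
    and cont: "continuous_on S g'" and inj: "inj_on g S" and bdd: "bounded (g ` S)"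
    and f[measurable]: "f \<in> borel_measurable borel"
  shows "(\<integral>\<^sup>+y. f y * indicator (g ` S) y \<partial>lborel)
       = (\<integral>\<^sup>+x. f (g x) * ennreal \<bar>g' x\<bar> * indicator S x \<partial>lborel)"
proof -
  have [measurable]: "S \<in> sets borel" using \<open>open S\<close> by auto
  have cg: "continuous_on S g" using der by (meson DERIV_isCont continuous_at_imp_continuous_on)
  have oS: "open (g ` S)" using invariance_of_domain[OF cg \<open>open S\<close> inj] .
  then have [measurable]: "g ` S \<in> sets borel" by auto
  define G where "G x = (if x \<in> S then g x else 0)" for x
  define G' where "G' x = (if x \<in> S then g' x else 0)" for x
  have G[measurable]: "G \<in> borel_measurable borel"
    unfolding G_def by (rule borel_measurable_continuous_on_if) (use cg in auto)
  have G'[measurable]: "G' \<in> borel_measurable borel"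
    unfolding G'_def by (rule borel_measurable_continuous_on_if) (use cont in auto)
  define M1 where "M1 = distr (density lborel (\<lambda>x. ennreal \<bar>G' x\<bar> * indicator S x)) borel G"
  define M2 where "M2 = density lborel (indicator (g ` S))"
  have "M1 = M2"
  proof (rule measure_eqI)
    show "sets M1 = sets M2" by (simp add: M1_def M2_def)
    fix B assume "B \<in> sets M1"
    then have [measurable]: "B \<in> sets borel" by (simp add: M1_def)
    define P where "P = S \<inter> (G -` B)"
    have [measurable]: "P \<in> sets borel" unfolding P_def using measurable_sets[OF G, of B] by auto
    have gP: "g ` P = g ` S \<inter> B" by (auto simp: P_def G_def)
    have fin: "emeasure lborel (g ` P) < \<infinity>"
      using bounded_subset[OF bdd, of "g ` P"] gP by (intro emeasure_bounded_finite) auto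
    have gPm: "g ` P \<in> lmeasurable"
    proof -
      have "g ` P \<in> sets borel" unfolding gP by measurable
      then have "emeasure lebesgue (g ` P) < \<infinity>" "g ` P \<in> sets lebesgue"
        using fin sets_completionI_sets[of "g ` P" lborel] by (auto simp: emeasure_completion)
      then show ?thesis by (rule fmeasurableI[rotated])
    qed
    have 1: "(\<lambda>_. 1::real) absolutely_integrable_on (g ` P)"
      using gPm absolutely_integrable_on_const by blast
    have 2: "integral (g ` P) (\<lambda>_. 1::real) = measure lebesgue (g ` P)"
      using gPm by (simp only: lmeasure_integral)
    have *: "(\<lambda>x. \<bar>g' x\<bar>) absolutely_integrable_on P" "integral P (\<lambda>x. \<bar>g' x\<bar>) = measure lebesgue (g ` P)"
    proof -
      have "P \<in> sets lebesgue" by (simp add: sets_completionI_sets)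
      moreover have "(g has_field_derivative g' x) (at x within P)" if "x \<in> P" for x
        using der that by (auto simp: P_def intro: has_field_derivative_at_within)
      moreover have "inj_on g P" using inj by (rule inj_on_subset) (auto simp: P_def)
      ultimately show "(\<lambda>x. \<bar>g' x\<bar>) absolutely_integrable_on P" "integral P (\<lambda>x. \<bar>g' x\<bar>) = measure lebesgue (g ` P)"
        using has_absolute_integral_change_of_variables_1'[of P g g' "\<lambda>_. 1" "measure lebesgue (g ` P)"] 1 2
        by simp_all
    qed
    have hi: "((\<lambda>x. \<bar>G' x\<bar> * indicator P x) has_integral measure lebesgue (g ` P)) UNIV"
    proof -
      have "((\<lambda>x. \<bar>g' x\<bar>) has_integral measure lebesgue (g ` P)) P"
        using * by (metis integrable_integral set_lebesgue_integral_eq_integral(1))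
      then have "((\<lambda>x. if x \<in> P then \<bar>g' x\<bar> else 0) has_integral measure lebesgue (g ` P)) UNIV"
        by (simp add: has_integral_restrict_UNIV)
      moreover have "(\<lambda>x. if x \<in> P then \<bar>g' x\<bar> else 0) = (\<lambda>x. \<bar>G' x\<bar> * indicator P x)"
        by (auto simp: G'_def P_def)
      ultimately show ?thesis by simp
    qed
    have "emeasure M1 B = (\<integral>\<^sup>+x. ennreal \<bar>G' x\<bar> * indicator S x * indicator (G -` B) x \<partial>lborel)"
      unfolding M1_def by (use measurable_sets[OF G, of B] in \<open>simp add: emeasure_distr emeasure_density\<close>)
    also have "\<dots> = (\<integral>\<^sup>+x. ennreal (\<bar>G' x\<bar> * indicator P x) \<partial>lborel)"
      by (intro nn_integral_cong) (auto simp: P_def split: split_indicator)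
    also have "\<dots> = ennreal (measure lebesgue (g ` P))"
      by (rule nn_integral_has_integral_lborel[OF _ _ hi]) auto
    also have "\<dots> = emeasure lborel (g ` P)"
    proof -
      have "g ` P \<in> sets lborel" unfolding gP by measurable
      then have "measure lebesgue (g ` P) = measure lborel (g ` P)" by (simp add: measure_completion)
      then show ?thesis using fin by (metis emeasure_eq_ennreal_measure infinity_ennreal_def order_less_irrefl)
    qed
    also have "\<dots> = emeasure M2 B"
      unfolding M2_def gP by (simp add: emeasure_density indicator_inter_arith[symmetric])
    finally show "emeasure M1 B = emeasure M2 B" .
  qed
  have "(\<integral>\<^sup>+y. f y * indicator (g ` S) y \<partial>lborel) = (\<integral>\<^sup>+y. f y \<partial>M2)"
    unfolding M2_def by (subst nn_integral_density) (auto simp: mult.commute)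
  also have "\<dots> = (\<integral>\<^sup>+y. f y \<partial>M1)" using \<open>M1 = M2\<close> by simp
  also have "\<dots> = (\<integral>\<^sup>+x. ennreal \<bar>G' x\<bar> * indicator S x * f (G x) \<partial>lborel)"
    unfolding M1_def by (subst nn_integral_distr, simp, simp, subst nn_integral_density) auto
  also have "\<dots> = (\<integral>\<^sup>+x. f (g x) * ennreal \<bar>g' x\<bar> * indicator S x \<partial>lborel)"
    by (intro nn_integral_cong) (auto simp: G_def G'_def mult.commute split: split_indicator)
  finally show ?thesis .
qed

text \<open>
  McShane's extension: the infimum of the functions \<open>\<lambda>x. f z + L * d x z\<close> extends \<open>f\<close> and keeps the constant.
  Neither symmetry nor definiteness of \<open>d\<close> is needed.
\<close>

lemma Lipschitz_extension:
  fixes f :: "'a \<Rightarrow> real" and d :: "'a \<Rightarrow> 'a \<Rightarrow> real"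
  assumes "E \<noteq> {}" "E \<subseteq> F" "0 \<le> L"
    and d0: "\<And>x y. x \<in> F \<Longrightarrow> y \<in> F \<Longrightarrow> 0 \<le> d x y" and dx: "\<And>x. x \<in> F \<Longrightarrow> d x x = 0"
    and tri: "\<And>x y z. x \<in> F \<Longrightarrow> y \<in> F \<Longrightarrow> z \<in> F \<Longrightarrow> d x z \<le> d x y + d y z"
    and f: "\<And>x y. x \<in> E \<Longrightarrow> y \<in> E \<Longrightarrow> f x \<le> f y + L * d x y"
  obtains g where "\<And>x. x \<in> E \<Longrightarrow> g x = f x"
    "\<And>x y. x \<in> F \<Longrightarrow> y \<in> F \<Longrightarrow> g x \<le> g y + L * d x y"
proof
  define g where "g x = (INF z\<in>E. f z + L * d x z)" for x
  have bdd: "bdd_below ((\<lambda>z. f z + L * d x z) ` E)" if x: "x \<in> F" for x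
  proof -
    obtain e where e: "e \<in> E" using \<open>E \<noteq> {}\<close> by blast
    have "f e - L * d e x \<le> f z + L * d x z" if "z \<in> E" for z
    proof -
      have "f e \<le> f z + L * d e z" using f e that by auto
      also have "L * d e z \<le> L * (d e x + d x z)"
        using tri[of e x z] e that x \<open>E \<subseteq> F\<close> \<open>0 \<le> L\<close> by (intro mult_left_mono) auto
      finally show ?thesis by (simp add: algebra_simps)
    qed
    then show ?thesis by (intro bdd_belowI2) auto
  qed
  show "g x = f x" if x: "x \<in> E" for x
  proof (rule antisym)
    show "g x \<le> f x" unfolding g_def
      using cINF_lower[OF bdd x, of x] x dx[of x] \<open>E \<subseteq> F\<close> by auto
    show "f x \<le> g x" unfolding g_def
      using f x \<open>E \<noteq> {}\<close> by (intro cINF_greatest) auto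
  qed
  show "g x \<le> g y + L * d x y" if x: "x \<in> F" and y: "y \<in> F" for x y
  proof -
    have "g x - L * d x y \<le> f z + L * d y z" if z: "z \<in> E" for z
    proof -
      have "g x \<le> f z + L * d x z" unfolding g_def using cINF_lower[OF bdd[OF x] z] by simp
      also have "L * d x z \<le> L * (d x y + d y z)"
        using tri[of x y z] z x y \<open>E \<subseteq> F\<close> \<open>0 \<le> L\<close> by (intro mult_left_mono) auto
      finally show ?thesis by (simp add: algebra_simps)
    qed
    then have "g x - L * d x y \<le> g y" unfolding g_def[of y]
      using \<open>E \<noteq> {}\<close> by (intro cINF_greatest) auto
    then show ?thesis by simp
  qed
qed

section \<open>Weak limits of densities with controlled oscillation\<close>

lemma finite_borel_measure_eqI_continuous:
  fixes M N :: "real measure"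
  assumes "finite_measure M" "finite_measure N" and sets: "sets M = sets borel" "sets N = sets borel"
    and eq: "\<And>g :: real \<Rightarrow> real. \<lbrakk>continuous_on UNIV g; \<And>x. \<bar>g x\<bar> \<le> 1\<rbrakk> \<Longrightarrow> integral\<^sup>L M g = integral\<^sup>L N g"
  shows "M = N"
proof (rule measure_eqI_lessThan[OF sets])
  interpret M: finite_measure M by fact
  interpret N: finite_measure N by fact
  fix x :: real
  \<comment> \<open>The functions \<open>g n\<close> increase to the indicator function of \<open>{x<..}\<close>.\<close>
  define g where "g n t = max 0 (min 1 (real n * (t - x)))" for n :: nat and t
  have g: "continuous_on UNIV (g n)" "\<And>t. \<bar>g n t\<bar> \<le> 1" for n
    unfolding g_def by (auto intro!: continuous_intros)
  have lim: "(\<lambda>n. g n t) \<longlonglongrightarrow> indicator {x<..} t" for t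
  proof (cases "x < t")
    case True
    obtain n0 :: nat where n0: "1 / (t - x) < real n0" using reals_Archimedean2 by blast
    have "g n t = 1" if "n \<ge> n0" for n
    proof -
      have "1 / (t - x) < real n" using n0 that by (meson less_le_trans of_nat_mono)
      then show ?thesis using True by (simp add: g_def field_simps)
    qed
    then have "eventually (\<lambda>n. g n t = 1) sequentially" by (auto simp: eventually_sequentially)
    then show ?thesis using True by (simp add: tendsto_eventually)
  next
    case False
    then have le: "real n * (t - x) \<le> 0" for n by (intro mult_nonneg_nonpos) auto
    have "g n t = 0" for n unfolding g_def using le[of n] by linarith
    then show ?thesis using False by simp
  qed
  have conv: "(\<lambda>n. integral\<^sup>L K (g n)) \<longlonglongrightarrow> measure K {x<..}"
    if "finite_measure K" and [simp]: "sets K = sets borel" for K :: "real measure"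
  proof -
    interpret K: finite_measure K by fact
    have sp: "space K = UNIV" using sets_eq_imp_space_eq[OF that(2)] by simp
    have meas: "g n \<in> borel_measurable K" for n
      using borel_measurable_continuous_onI[OF g(1)[of n]] measurable_cong_sets[OF that(2) refl] by blast
    have "(\<lambda>n. integral\<^sup>L K (g n)) \<longlonglongrightarrow> (\<integral>t. indicator {x<..} t \<partial>K)"
      by (rule integral_dominated_convergence[where w="\<lambda>_. 1"])
        (use meas lim g(2) that(2) in \<open>auto intro!: borel_measurable_indicator\<close>)
    then show ?thesis by (simp add: sp)
  qed
  have "measure M {x<..} = measure N {x<..}"
    using conv[OF assms(1) sets(1)] conv[OF assms(2) sets(2)] eq[OF g] by (simp add: LIMSEQ_unique)
  then show "emeasure M {x<..} = emeasure N {x<..}"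
    by (simp add: M.emeasure_eq_measure N.emeasure_eq_measure)
  show "emeasure M {x<..} < \<infinity>" by (simp add: M.emeasure_eq_measure)
qed

text \<open>
  The logarithm of \<open>h\<close> is Lipschitz on \<open>E\<close> with constant \<open>L\<close>. The multiplicative form admits the values
  \<open>0\<close> and \<open>\<infinity>\<close>, and is therefore stable under arbitrary countable sums.
\<close>

definition log_regular :: "('a \<Rightarrow> 'a \<Rightarrow> real) \<Rightarrow> real \<Rightarrow> 'a set \<Rightarrow> ('a \<Rightarrow> ennreal) \<Rightarrow> bool" where
  "log_regular d L E h \<longleftrightarrow> (\<forall>x\<in>E. \<forall>y\<in>E. h x \<le> ennreal (exp (L * d x y)) * h y)"

text \<open>
  As \<open>d \<le> 1\<close>, the values of a regular density are comparable, up to the factor \<open>exp L\<close>, with its mean.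
\<close>

lemma log_regular_bounds:
  fixes h :: "real \<Rightarrow> ennreal"
  assumes reg: "log_regular d L E h" and [measurable]: "E \<in> sets borel" "h \<in> borel_measurable borel"
    and d: "\<And>x y. x \<in> E \<Longrightarrow> y \<in> E \<Longrightarrow> d x y \<le> 1" and "0 \<le> L" and x: "x \<in> E"
  shows "(\<integral>\<^sup>+y. h y * indicator E y \<partial>lborel) \<le> ennreal (exp L) * h x * emeasure lborel E"
    and "h x * emeasure lborel E \<le> ennreal (exp L) * (\<integral>\<^sup>+y. h y * indicator E y \<partial>lborel)"
proof -
  have b: "h p \<le> ennreal (exp L) * h q" if "p \<in> E" "q \<in> E" for p q
  proof -
    have "h p \<le> ennreal (exp (L * d p q)) * h q" using reg that unfolding log_regular_def by blast
    also have "L * d p q \<le> L * 1" using d[OF that] \<open>0 \<le> L\<close> by (intro mult_left_mono) auto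
    then have "ennreal (exp (L * d p q)) * h q \<le> ennreal (exp L) * h q"
      by (intro mult_right_mono) auto
    finally show ?thesis .
  qed
  have "(\<integral>\<^sup>+y. h y * indicator E y \<partial>lborel) \<le> (\<integral>\<^sup>+y. (ennreal (exp L) * h x) * indicator E y \<partial>lborel)"
    using b[OF _ x] by (intro nn_integral_mono) (auto split: split_indicator)
  then show "(\<integral>\<^sup>+y. h y * indicator E y \<partial>lborel) \<le> ennreal (exp L) * h x * emeasure lborel E"
    by (simp add: nn_integral_cmult_indicator)
  have "h x * emeasure lborel E = (\<integral>\<^sup>+y. h x * indicator E y \<partial>lborel)"
    by (simp add: nn_integral_cmult_indicator)
  also have "\<dots> \<le> (\<integral>\<^sup>+y. ennreal (exp L) * (h y * indicator E y) \<partial>lborel)"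
    using b[OF x] by (intro nn_integral_mono) (auto split: split_indicator)
  also have "\<dots> = ennreal (exp L) * (\<integral>\<^sup>+y. h y * indicator E y \<partial>lborel)"
    by (simp add: nn_integral_cmult)
  finally show "h x * emeasure lborel E \<le> ennreal (exp L) * (\<integral>\<^sup>+y. h y * indicator E y \<partial>lborel)" .
qed

text \<open>
  The Arzela-Ascoli argument with separability in place of compactness: a diagonal
  subsequence converges on a countable dense set, and by equicontinuity it is then a Cauchy sequence at
  every point. The convergence need not be uniform.
\<close>

lemma equicontinuous_pointwise_subsequence:
  fixes u :: "nat \<Rightarrow> 'a \<Rightarrow> real" and d :: "'a \<Rightarrow> 'a \<Rightarrow> real"
  assumes Y: "countable Y" "Y \<subseteq> E" "\<And>x e. x \<in> E \<Longrightarrow> 0 < e \<Longrightarrow> \<exists>y\<in>Y. d x y < e"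
    and bdd: "\<And>n x. x \<in> E \<Longrightarrow> \<bar>u n x\<bar> \<le> B"
    and lip: "\<And>n x y. x \<in> E \<Longrightarrow> y \<in> E \<Longrightarrow> \<bar>u n x - u n y\<bar> \<le> L * d x y" and "0 \<le> L"
  obtains k l where "strict_mono k" "\<And>x. x \<in> E \<Longrightarrow> (\<lambda>n. u (k n) x) \<longlonglongrightarrow> l x"
proof -
  obtain k :: "nat \<Rightarrow> nat" where k: "strict_mono k" "\<And>x. x \<in> Y \<Longrightarrow> \<exists>l. (\<lambda>n. u (k n) x) \<longlonglongrightarrow> l"
  proof (rule function_convergent_subsequence[OF Y(1), of u B])
    show "norm (u n x) \<le> B" if "x \<in> Y" for n x using bdd Y(2) that by auto
  qed blast
  have "\<exists>l. (\<lambda>n. u (k n) x) \<longlonglongrightarrow> l" if x: "x \<in> E" for x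
  proof -
    have "Cauchy (\<lambda>n. u (k n) x)"
    proof (rule metric_CauchyI)
      fix e :: real assume e: "0 < e"
      then have "0 < e / 3 / (L + 1)" using \<open>0 \<le> L\<close> by simp
      then obtain y where y: "y \<in> Y" "d x y < e / 3 / (L + 1)" using Y(3)[OF x] by blast
      have "y \<in> E" using y Y(2) by blast
      have "L * d x y \<le> L * (e / 3 / (L + 1))" using y(2) \<open>0 \<le> L\<close> by (intro mult_left_mono) auto
      also have "\<dots> < e / 3" using e \<open>0 \<le> L\<close> by (simp add: field_simps)
      finally have close: "\<bar>u n x - u n y\<bar> < e / 3" for n
        using lip[OF x \<open>y \<in> E\<close>, of n] by linarith
      have "Cauchy (\<lambda>n. u (k n) y)" using k(2)[OF y(1)] LIMSEQ_imp_Cauchy by blast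
      moreover have "0 < e / 3" using e by simp
      ultimately obtain M where M: "\<And>m n. m \<ge> M \<Longrightarrow> n \<ge> M \<Longrightarrow> dist (u (k m) y) (u (k n) y) < e / 3"
        unfolding Cauchy_def by blast
      have "dist (u (k m) x) (u (k n) x) < e" if "m \<ge> M" "n \<ge> M" for m n
        using M[OF that] close[of "k m"] close[of "k n"] unfolding dist_real_def by linarith
      then show "\<exists>M. \<forall>m\<ge>M. \<forall>n\<ge>M. dist (u (k m) x) (u (k n) x) < e" by blast
    qed
    then show ?thesis using Cauchy_convergent_iff convergent_def by blast
  qed
  then obtain l where "\<And>x. x \<in> E \<Longrightarrow> (\<lambda>n. u (k n) x) \<longlonglongrightarrow> l x" by metis
  then show ?thesis using that k(1) by blast
qed

text \<open>
  Regular densities whose measures converge weakly to a nonzero measure have a subsequence that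
  converges pointwise; the pointwise limit is a density of the weak limit and inherits the regularity.
\<close>

lemma weak_limit_log_regular_density:
  fixes h :: "nat \<Rightarrow> real \<Rightarrow> ennreal" and \<nu> :: "real measure" and d :: "real \<Rightarrow> real \<Rightarrow> real"
  assumes E[measurable]: "E \<in> sets borel" and Epos: "0 < emeasure lborel E" and Efin: "emeasure lborel E < \<infinity>"
    and d: "\<And>x y. x \<in> E \<Longrightarrow> y \<in> E \<Longrightarrow> d x y \<le> 1" "\<And>x y. d x y = d y x"
    and Y: "countable Y" "Y \<subseteq> E" "\<And>x e. x \<in> E \<Longrightarrow> 0 < e \<Longrightarrow> \<exists>y\<in>Y. d x y < e"
    and "0 \<le> L" and reg: "\<And>n. log_regular d L E (h n)"
    and h[measurable]: "\<And>n. h n \<in> borel_measurable borel"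
    and fin: "\<And>n. (\<integral>\<^sup>+x. h n x * indicator E x \<partial>lborel) < \<infinity>"
    and \<nu>: "finite_measure \<nu>" "sets \<nu> = sets borel" "0 < measure \<nu> UNIV"
    and conv: "\<And>g :: real \<Rightarrow> real. \<lbrakk>continuous_on UNIV g; \<And>x. \<bar>g x\<bar> \<le> 1\<rbrakk> \<Longrightarrow>
        (\<lambda>n. integral\<^sup>L (density lborel (\<lambda>x. h n x * indicator E x)) g) \<longlonglongrightarrow> integral\<^sup>L \<nu> g"
  obtains \<rho> :: "real \<Rightarrow> real" where "\<rho> \<in> borel_measurable borel" "\<And>x. x \<in> E \<Longrightarrow> 0 < \<rho> x" "\<And>x. x \<notin> E \<Longrightarrow> \<rho> x = 0"
    "\<And>x y. x \<in> E \<Longrightarrow> y \<in> E \<Longrightarrow> \<bar>ln (\<rho> x) - ln (\<rho> y)\<bar> \<le> L * d x y"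
    "\<nu> = density lborel (\<lambda>x. ennreal (\<rho> x))"
proof -
  interpret \<nu>: finite_measure \<nu> by fact
  have sp\<nu>: "space \<nu> = UNIV" using sets_eq_imp_space_eq[OF \<nu>(2)] by simp
  define a where "a = measure \<nu> UNIV"
  define I where "I n = (\<integral>\<^sup>+x. h n x * indicator E x \<partial>lborel)" for n
  define A where "A n = enn2real (I n)" for n
  have IA: "I n = ennreal (A n)" for n using fin[of n] unfolding A_def I_def by simp
  have "(\<lambda>n. integral\<^sup>L (density lborel (\<lambda>x. h n x * indicator E x)) (\<lambda>_. 1::real)) \<longlonglongrightarrow> integral\<^sup>L \<nu> (\<lambda>_. 1)"
    by (rule conv) auto
  moreover have "integral\<^sup>L (density lborel (\<lambda>x. h n x * indicator E x)) (\<lambda>_. 1::real) = A n" for n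
    by (simp add: measure_def emeasure_density A_def I_def)
  ultimately have Aa: "A \<longlonglongrightarrow> a" by (simp add: sp\<nu> a_def)
  have "0 < a" using \<nu> by (simp add: a_def)
  then have "eventually (\<lambda>n. a / 2 < A n \<and> A n < 2 * a) sequentially"
    by (intro eventually_conj order_tendstoD[OF Aa]) auto
  then obtain N where N: "\<And>n. n \<ge> N \<Longrightarrow> a / 2 < A n \<and> A n < 2 * a" unfolding eventually_sequentially by blast
  define m where "m = measure lborel E"
  have Em: "emeasure lborel E = ennreal m" unfolding m_def using Efin by (simp add: emeasure_eq_ennreal_measure less_top)
  have "0 < m" using Epos Em by simp
  \<comment> \<open>Bounds for the densities with index at least \<open>N\<close>, where the masses lie between \<open>a / 2\<close> and \<open>2 * a\<close>.\<close>
  define c where "c = exp (- L) * (a / 2) / m"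
  define b where "b = exp L * (2 * a) / m"
  have "0 < c" using \<open>0 < a\<close> \<open>0 < m\<close> by (simp add: c_def)
  define K where "K n x = enn2real (h (N + n) x)" for n x
  have K: "h (N + n) x = ennreal (K n x)" "c \<le> K n x" "K n x \<le> b" if x: "x \<in> E" for n x
  proof -
    have up: "h (N + n) x * ennreal m \<le> ennreal (exp L) * ennreal (A (N + n))"
      using log_regular_bounds(2)[OF reg E h d(1) \<open>0 \<le> L\<close> x] by (simp add: IA[symmetric] I_def Em)
    have lo: "ennreal (A (N + n)) \<le> ennreal (exp L) * h (N + n) x * ennreal m"
      using log_regular_bounds(1)[OF reg E h d(1) \<open>0 \<le> L\<close> x] by (simp add: IA[symmetric] I_def Em)
    have "h (N + n) x * ennreal m < top" using up by (simp add: ennreal_mult[symmetric] order_le_less_trans A_def)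
    then have "h (N + n) x < top" using \<open>0 < m\<close> by (auto simp: ennreal_mult_less_top)
    then show e: "h (N + n) x = ennreal (K n x)" unfolding K_def by simp
    have K0: "0 \<le> K n x" by (simp add: K_def)
    have A0: "0 \<le> A (N + n)" by (simp add: A_def)
    have "K n x * m \<le> exp L * A (N + n)"
      using up K0 A0 \<open>0 < m\<close> by (simp add: e ennreal_mult[symmetric])
    also have "\<dots> \<le> exp L * (2 * a)" using N[of "N + n"] by simp
    finally show "K n x \<le> b" using \<open>0 < m\<close> by (simp add: b_def field_simps)
    have "A (N + n) \<le> exp L * K n x * m"
      using lo K0 A0 \<open>0 < m\<close> by (simp add: e ennreal_mult[symmetric])
    then have "a / 2 \<le> exp L * K n x * m" using N[of "N + n"] by simp
    then have "exp (- L) * (a / 2) \<le> exp (- L) * (exp L * K n x * m)" by (intro mult_left_mono) auto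
    also have "\<dots> = K n x * m" by (simp add: exp_minus)
    finally show "c \<le> K n x" using \<open>0 < m\<close> by (simp add: c_def field_simps)
  qed
  have Kpos: "0 < K n x" if "x \<in> E" for n x using K(2)[OF that, of n] \<open>0 < c\<close> by linarith
  define u where "u n x = ln (K n x)" for n x
  have ubd: "\<bar>u n x\<bar> \<le> \<bar>ln c\<bar> + \<bar>ln b\<bar>" if "x \<in> E" for n x
  proof -
    have "ln c \<le> u n x" "u n x \<le> ln b"
      unfolding u_def using K(2,3)[OF that, of n] Kpos[OF that, of n] \<open>0 < c\<close> by simp_all
    then show ?thesis by linarith
  qed
  have ule: "u n x - u n y \<le> L * d x y" if xy: "x \<in> E" "y \<in> E" for n x y
  proof -
    have "h (N + n) x \<le> ennreal (exp (L * d x y)) * h (N + n) y"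
      using reg xy unfolding log_regular_def by blast
    then have "K n x \<le> exp (L * d x y) * K n y"
      using Kpos xy by (simp add: K(1) ennreal_mult[symmetric] less_imp_le)
    then have "ln (K n x) \<le> ln (exp (L * d x y) * K n y)" using Kpos xy by simp
    then show ?thesis using Kpos[OF xy(2), of n] by (simp add: u_def ln_mult)
  qed
  have ulip: "\<bar>u n x - u n y\<bar> \<le> L * d x y" if "x \<in> E" "y \<in> E" for n x y
    using ule[OF that] ule[OF that(2,1)] d(2)[of x y] by (simp add: abs_le_iff)
  obtain k l where k: "strict_mono k" and l: "\<And>x. x \<in> E \<Longrightarrow> (\<lambda>n. u (k n) x) \<longlonglongrightarrow> l x"
    by (rule equicontinuous_pointwise_subsequence[OF Y ubd ulip \<open>0 \<le> L\<close>]) iprover+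
  define \<rho> where "\<rho> x = (if x \<in> E then exp (l x) else 0)" for x
  define R where "R n x = indicator E x * K (k n) x" for n x
  have R[measurable]: "R n \<in> borel_measurable borel" for n unfolding R_def K_def by measurable
  have R0: "0 \<le> R n x" for n x by (simp add: R_def K_def)
  have R\<rho>: "(\<lambda>n. R n x) \<longlonglongrightarrow> \<rho> x" for x
  proof (cases "x \<in> E")
    case True
    have "(\<lambda>n. exp (u (k n) x)) \<longlonglongrightarrow> exp (l x)" by (intro tendsto_exp l True)
    moreover have "exp (u (k n) x) = R n x" for n using True Kpos[OF True] by (simp add: u_def R_def)
    ultimately show ?thesis using True by (simp add: \<rho>_def)
  qed (simp add: R_def \<rho>_def)
  have \<rho>[measurable]: "\<rho> \<in> borel_measurable borel" using borel_measurable_LIMSEQ_real[OF R\<rho> R] .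
  have \<rho>0: "0 \<le> \<rho> x" for x by (simp add: \<rho>_def)
  have \<rho>b: "\<rho> x \<le> b * indicator E x" for x
  proof (cases "x \<in> E")
    case True
    have "R n x \<le> b * indicator E x" for n using True K(3)[OF True] by (simp add: R_def)
    then show ?thesis using LIMSEQ_le_const2[OF R\<rho>[of x]] by blast
  qed (simp add: \<rho>_def)
  have intE: "integrable lborel (\<lambda>x. b * indicator E x :: real)"
    using Efin by (intro integrable_mult_right integrable_real_indicator) auto
  have int\<rho>: "integrable lborel \<rho>"
  proof (rule Bochner_Integration.integrable_bound[OF intE])
    show "AE x in lborel. norm (\<rho> x) \<le> norm (b * indicator E x)"
    proof (intro AE_I2)
      show "norm (\<rho> x) \<le> norm (b * indicator E x)" for x
        using \<rho>b[of x] \<rho>0[of x] unfolding real_norm_def by linarith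
    qed
  qed simp
  define D where "D = density lborel (\<lambda>x. ennreal (\<rho> x))"
  have finD: "finite_measure D"
  proof
    have "emeasure D (space D) = (\<integral>\<^sup>+x. ennreal (\<rho> x) \<partial>lborel)" by (simp add: D_def emeasure_density)
    also have "\<dots> = ennreal (\<integral>x. \<rho> x \<partial>lborel)" by (rule nn_integral_eq_integral[OF int\<rho>]) (simp add: \<rho>0)
    finally show "emeasure D (space D) \<noteq> \<infinity>" by simp
  qed
  have "\<nu> = D"
  proof (rule finite_borel_measure_eqI_continuous[OF \<nu>(1) finD \<nu>(2)])
    show "sets D = sets borel" by (simp add: D_def)
    fix g :: "real \<Rightarrow> real" assume g: "continuous_on UNIV g" "\<And>x. \<bar>g x\<bar> \<le> 1"
    have [measurable]: "g \<in> borel_measurable borel" using g(1) by (rule borel_measurable_continuous_onI)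
    have eqd: "density lborel (\<lambda>x. h (N + k n) x * indicator E x) = density lborel (\<lambda>x. ennreal (R n x))" for n
    proof (rule density_cong)
      show "AE x in lborel. h (N + k n) x * indicator E x = ennreal (R n x)"
        by (intro AE_I2) (simp add: R_def K(1) split: split_indicator)
    qed measurable
    have "(\<lambda>n. \<integral>x. R n x * g x \<partial>lborel) \<longlonglongrightarrow> (\<integral>x. \<rho> x * g x \<partial>lborel)"
    proof (rule integral_dominated_convergence[OF _ _ intE])
      show "AE x in lborel. (\<lambda>n. R n x * g x) \<longlonglongrightarrow> \<rho> x * g x" by (auto intro!: tendsto_intros R\<rho>)
      show "AE x in lborel. norm (R n x * g x) \<le> b * indicator E x" for n
      proof (intro AE_I2)
        fix x
        have "\<bar>R n x\<bar> * \<bar>g x\<bar> \<le> \<bar>R n x\<bar> * 1" by (intro mult_left_mono g(2)) auto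
        moreover have "\<bar>R n x\<bar> \<le> b * indicator E x" using K(3) R0 by (auto simp: R_def K_def split: split_indicator)
        ultimately show "norm (R n x * g x) \<le> b * indicator E x" by (simp add: abs_mult)
      qed
    qed auto
    moreover have "integral\<^sup>L (density lborel (\<lambda>x. h (N + k n) x * indicator E x)) g = (\<integral>x. R n x * g x \<partial>lborel)" for n
      unfolding eqd by (subst integral_real_density) (auto simp: R0)
    moreover have "integral\<^sup>L D g = (\<integral>x. \<rho> x * g x \<partial>lborel)"
      unfolding D_def by (subst integral_real_density) (auto simp: \<rho>0)
    ultimately have *: "(\<lambda>n. integral\<^sup>L (density lborel (\<lambda>x. h (N + k n) x * indicator E x)) g) \<longlonglongrightarrow> integral\<^sup>L D g"
      by simp
    have "strict_mono (\<lambda>n. N + k n)" using k by (simp add: strict_mono_def)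
    from LIMSEQ_subseq_LIMSEQ[OF conv[OF g] this] * show "integral\<^sup>L \<nu> g = integral\<^sup>L D g"
      using LIMSEQ_unique by (auto simp: comp_def)
  qed
  show ?thesis
  proof (rule that[OF \<rho>])
    show "\<nu> = density lborel (\<lambda>x. ennreal (\<rho> x))" using \<open>\<nu> = D\<close> by (simp add: D_def)
    show "0 < \<rho> x" if "x \<in> E" for x using that by (simp add: \<rho>_def)
    show "\<rho> x = 0" if "x \<notin> E" for x using that by (simp add: \<rho>_def)
    show "\<bar>ln (\<rho> x) - ln (\<rho> y)\<bar> \<le> L * d x y" if "x \<in> E" "y \<in> E" for x y
    proof -
      have "(\<lambda>n. \<bar>u (k n) x - u (k n) y\<bar>) \<longlonglongrightarrow> \<bar>l x - l y\<bar>" by (intro tendsto_intros l that)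
      then have "\<bar>l x - l y\<bar> \<le> L * d x y" using ulip[OF that] by (intro LIMSEQ_le_const2) auto
      then show ?thesis using that by (simp add: \<rho>_def)
    qed
  qed
qed

section \<open>Cylinders and their endpoints\<close>

text \<open>
  A piecewise monotone map together with its partition.
\<close>

locale interval_map =
  fixes T :: "real \<Rightarrow> real" and \<xi> :: "real set set"
  assumes map: "piecewise_monotone_map T \<xi>"
begin

lemma T_in: "x \<in> unit_M \<Longrightarrow> T x \<in> unit_M"
  using map unfolding piecewise_monotone_map_def by (elim conjE) (rule funcset_mem)

lemma funpow_T_in: "x \<in> unit_M \<Longrightarrow> (T ^^ n) x \<in> unit_M"
proof (induction n)
  case (Suc n)
  then show ?case using T_in[of "(T ^^ n) x"] by simp
qed simp

lemma countable_pieces: "countable \<xi>"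
  using map unfolding piecewise_monotone_map_def by blast

lemma partition_pieces: "partition_on unit_M \<xi>"
  using map unfolding piecewise_monotone_map_def by blast

lemma is_interval_piece: "W \<in> \<xi> \<Longrightarrow> is_interval W"
  using map unfolding piecewise_monotone_map_def by blast

lemma piece_subset: "W \<in> \<xi> \<Longrightarrow> W \<subseteq> unit_M"
  using partition_onD1[OF partition_pieces] by blast

lemma piece_nonempty: "W \<in> \<xi> \<Longrightarrow> W \<noteq> {}"
  using partition_onD3[OF partition_pieces] by blast

lemma ex_piece: "x \<in> unit_M \<Longrightarrow> \<exists>W\<in>\<xi>. x \<in> W"
  using partition_onD1[OF partition_pieces] by blast

lemma piece_unique: "\<lbrakk>W \<in> \<xi>; V \<in> \<xi>; x \<in> W; x \<in> V\<rbrakk> \<Longrightarrow> W = V"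
  using partition_onD2[OF partition_pieces] unfolding disjoint_def by blast

lemma elem_of_eq: "\<lbrakk>W \<in> \<xi>; x \<in> W\<rbrakk> \<Longrightarrow> elem_of \<xi> x = W"
  unfolding elem_of_def by (rule the_equality) (auto dest: piece_unique)

lemma inj_on_piece:
  assumes "W \<in> \<xi>" shows "inj_on T (interior W)"
proof -
  have "strict_mono_on (interior W) T \<or> strict_antimono_on (interior W) T"
    using map assms unfolding piecewise_monotone_map_def by blast
  then show ?thesis
  proof
    assume "strict_antimono_on (interior W) T"
    then show ?thesis
      unfolding monotone_on_def by (intro linorder_inj_onI) force+
  qed (rule strict_mono_on_imp_inj_on)
qed

lemma T_C1:
  assumes "W \<in> \<xi>"
  shows "\<And>x. x \<in> interior W \<Longrightarrow> (T has_real_derivative deriv T x) (at x)"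
    and "continuous_on (interior W) (deriv T)"
    and "continuous_on (interior W) T"
proof -
  have "T C1_differentiable_on (interior W)"
    using map assms unfolding piecewise_monotone_map_def by blast
  then obtain D where D: "\<And>x. x \<in> interior W \<Longrightarrow> (T has_vector_derivative D x) (at x)"
    "continuous_on (interior W) D" unfolding C1_differentiable_on_def by blast
  have eq: "deriv T x = D x" if "x \<in> interior W" for x
    using D(1)[OF that] by (simp add: DERIV_imp_deriv has_real_derivative_iff_has_vector_derivative)
  show "(T has_real_derivative deriv T x) (at x)" if "x \<in> interior W" for x
    using D(1)[OF that] eq[OF that] by (simp add: has_real_derivative_iff_has_vector_derivative)
  then show "continuous_on (interior W) T"
    by (auto intro: DERIV_isCont continuous_at_imp_continuous_on)
  show "continuous_on (interior W) (deriv T)"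
    using D(2) eq by (simp cong: continuous_on_cong)
qed

lemma open_image_piece:
  assumes "W \<in> \<xi>" "open U" "U \<subseteq> interior W" shows "open (T ` U)"
  by (rule invariance_of_domain[OF continuous_on_subset[OF T_C1(3)] assms(2) inj_on_subset[OF inj_on_piece]])
    (use assms in auto)

lemma join_partition_iff:
  "A \<in> join_partition T \<xi> n \<longleftrightarrow>
     A \<noteq> {} \<and> (\<exists>V. (\<forall>k<n. V k \<in> \<xi>) \<and> A = {x \<in> unit_M. \<forall>k<n. (T ^^ k) x \<in> V k})"
  unfolding join_partition_def by auto

lemma join_partition_Suc_iff:
  "A \<in> join_partition T \<xi> (Suc n) \<longleftrightarrow>
     A \<noteq> {} \<and> (\<exists>W\<in>\<xi>. \<exists>B\<in>join_partition T \<xi> n. A = {x \<in> unit_M. x \<in> W \<and> T x \<in> B})"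
proof
  assume "A \<in> join_partition T \<xi> (Suc n)"
  then obtain V where V: "\<forall>k<Suc n. V k \<in> \<xi>" "A = {x \<in> unit_M. \<forall>k<Suc n. (T ^^ k) x \<in> V k}" "A \<noteq> {}"
    unfolding join_partition_iff by auto
  define B where "B = {x \<in> unit_M. \<forall>k<n. (T ^^ k) x \<in> V (Suc k)}"
  have "x \<in> A \<longleftrightarrow> x \<in> unit_M \<and> x \<in> V 0 \<and> T x \<in> B" for x
    unfolding V(2) B_def mem_Collect_eq All_less_Suc2 funpow_Suc_right using T_in[of x] by auto
  then have AB: "A = {x \<in> unit_M. x \<in> V 0 \<and> T x \<in> B}" by auto
  have "B \<noteq> {}" using V(3) unfolding AB by auto
  moreover have "\<forall>k<n. V (Suc k) \<in> \<xi>" using V(1) by simp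
  ultimately have "B \<in> join_partition T \<xi> n"
    unfolding join_partition_iff B_def by (intro conjI exI[of _ "\<lambda>k. V (Suc k)"] refl)
  moreover have "V 0 \<in> \<xi>" using V(1) by simp
  ultimately show "A \<noteq> {} \<and> (\<exists>W\<in>\<xi>. \<exists>B\<in>join_partition T \<xi> n. A = {x \<in> unit_M. x \<in> W \<and> T x \<in> B})"
    using V(3) AB by (intro conjI bexI[of _ "V 0"] bexI[of _ B])
next
  assume "A \<noteq> {} \<and> (\<exists>W\<in>\<xi>. \<exists>B\<in>join_partition T \<xi> n. A = {x \<in> unit_M. x \<in> W \<and> T x \<in> B})"
  then obtain W B where W: "W \<in> \<xi>" "A \<noteq> {}" "A = {x \<in> unit_M. x \<in> W \<and> T x \<in> B}"
    and B: "B \<in> join_partition T \<xi> n" by blast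
  from B obtain V where V: "\<forall>k<n. V k \<in> \<xi>" "B = {x \<in> unit_M. \<forall>k<n. (T ^^ k) x \<in> V k}"
    unfolding join_partition_iff by auto
  define V' where "V' = case_nat W V"
  have "x \<in> A \<longleftrightarrow> x \<in> unit_M \<and> (\<forall>k<Suc n. (T ^^ k) x \<in> V' k)" for x
    unfolding W(3) V(2) mem_Collect_eq All_less_Suc2 funpow_Suc_right V'_def using T_in[of x] by auto
  then have "A = {x \<in> unit_M. \<forall>k<Suc n. (T ^^ k) x \<in> V' k}" by auto
  moreover have "\<forall>k<Suc n. V' k \<in> \<xi>" using V(1) W(1) by (simp add: All_less_Suc2 V'_def)
  ultimately show "A \<in> join_partition T \<xi> (Suc n)"
    unfolding join_partition_iff using W(2) by (intro conjI exI[of _ V'])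
qed

lemma join_partition_0: "join_partition T \<xi> 0 = {unit_M}"
  unfolding join_partition_def by auto

lemma join_partition_1: "join_partition T \<xi> (Suc 0) = \<xi>"
proof -
  have "{x \<in> unit_M. x \<in> W \<and> T x \<in> unit_M} = W" if "W \<in> \<xi>" for W
    using piece_subset[OF that] T_in by blast
  then have "A \<in> join_partition T \<xi> (Suc 0) \<longleftrightarrow> A \<noteq> {} \<and> A \<in> \<xi>" for A
    unfolding join_partition_Suc_iff join_partition_0 by auto
  then show ?thesis using piece_nonempty by blast
qed

lemma countable_join_partition: "countable (join_partition T \<xi> n)"
proof (induction n)
  case (Suc n)
  have "join_partition T \<xi> (Suc n)
      \<subseteq> (\<lambda>(W, B). {x \<in> unit_M. x \<in> W \<and> T x \<in> B}) ` (\<xi> \<times> join_partition T \<xi> n)"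
    unfolding join_partition_Suc_iff subset_iff by auto
  then show ?case using Suc countable_pieces by (meson countable_SIGMA countable_image countable_subset)
qed (simp add: join_partition_0)

lemma join_partition_subset: "A \<in> join_partition T \<xi> n \<Longrightarrow> A \<subseteq> unit_M"
  unfolding join_partition_def by blast

text \<open>
  The itineraries of \<open>x\<close> and \<open>y\<close> agree up to time \<open>n\<close>, that is, \<open>x\<close> and \<open>y\<close> lie in the same
  element of the partition of order \<open>n\<close>.
\<close>

definition same_cylinder :: "nat \<Rightarrow> real \<Rightarrow> real \<Rightarrow> bool" where
  "same_cylinder n x y \<longleftrightarrow> (\<forall>k<n. \<exists>W\<in>\<xi>. (T ^^ k) x \<in> W \<and> (T ^^ k) y \<in> W)"

lemma same_cylinder_sym: "same_cylinder n x y \<Longrightarrow> same_cylinder n y x"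
  unfolding same_cylinder_def by blast

lemma same_cylinder_trans: "same_cylinder n x y \<Longrightarrow> same_cylinder n y z \<Longrightarrow> same_cylinder n x z"
  unfolding same_cylinder_def
proof (intro allI impI)
  fix k assume xy: "\<forall>k<n. \<exists>W\<in>\<xi>. (T ^^ k) x \<in> W \<and> (T ^^ k) y \<in> W"
    and yz: "\<forall>k<n. \<exists>W\<in>\<xi>. (T ^^ k) y \<in> W \<and> (T ^^ k) z \<in> W" and "k < n"
  obtain W V where "W \<in> \<xi>" "(T ^^ k) x \<in> W" "(T ^^ k) y \<in> W" "V \<in> \<xi>" "(T ^^ k) y \<in> V" "(T ^^ k) z \<in> V"
    using xy yz \<open>k < n\<close> by blast
  moreover from this have "W = V" using piece_unique by blast
  ultimately show "\<exists>W\<in>\<xi>. (T ^^ k) x \<in> W \<and> (T ^^ k) z \<in> W" by blast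
qed

lemma same_cylinder_mono: "same_cylinder n x y \<Longrightarrow> m \<le> n \<Longrightarrow> same_cylinder m x y"
  unfolding same_cylinder_def by auto

lemma same_cylinder_Suc:
  "same_cylinder (Suc n) x y \<longleftrightarrow> (\<exists>W\<in>\<xi>. x \<in> W \<and> y \<in> W) \<and> same_cylinder n (T x) (T y)"
  unfolding same_cylinder_def
  by (simp add: All_less_Suc2 funpow_Suc_right del: funpow.simps(2))

lemma same_cylinder_iff:
  assumes "A \<in> join_partition T \<xi> n" "x \<in> A" "y \<in> unit_M"
  shows "same_cylinder n x y \<longleftrightarrow> y \<in> A"
proof -
  obtain V where V: "\<forall>k<n. V k \<in> \<xi>" "A = {x \<in> unit_M. \<forall>k<n. (T ^^ k) x \<in> V k}"
    using assms(1) unfolding join_partition_iff by auto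
  have x: "\<And>k. k < n \<Longrightarrow> (T ^^ k) x \<in> V k" using assms(2) unfolding V(2) by simp
  show ?thesis
  proof
    assume xy: "same_cylinder n x y"
    have "(T ^^ k) y \<in> V k" if k: "k < n" for k
    proof -
      obtain W where W: "W \<in> \<xi>" "(T ^^ k) x \<in> W" "(T ^^ k) y \<in> W"
        using xy k unfolding same_cylinder_def by blast
      moreover have "V k \<in> \<xi>" using V(1) k by simp
      ultimately have "W = V k" using piece_unique[of W "V k"] x[OF k] by blast
      then show ?thesis using W by simp
    qed
    then show "y \<in> A" unfolding V(2) using assms(3) by simp
  next
    assume "y \<in> A"
    then have "\<And>k. k < n \<Longrightarrow> (T ^^ k) y \<in> V k" unfolding V(2) by simp
    then have "\<exists>W\<in>\<xi>. (T ^^ k) x \<in> W \<and> (T ^^ k) y \<in> W" if "k < n" for k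
      using that x V(1) by (intro bexI[of _ "V k"]) auto
    then show "same_cylinder n x y" unfolding same_cylinder_def by iprover
  qed
qed

lemma ex_cylinder:
  assumes "x \<in> unit_M" shows "\<exists>A\<in>join_partition T \<xi> n. x \<in> A"
proof -
  have "\<forall>k. \<exists>W. W \<in> \<xi> \<and> (T ^^ k) x \<in> W" using ex_piece[OF funpow_T_in[OF assms]] by blast
  then obtain V where V: "\<And>k. V k \<in> \<xi> \<and> (T ^^ k) x \<in> V k" by metis
  define A where "A = {y \<in> unit_M. \<forall>k<n. (T ^^ k) y \<in> V k}"
  have "x \<in> A" using V assms unfolding A_def by simp
  moreover from this have "A \<in> join_partition T \<xi> n"
    unfolding join_partition_iff using V A_def by (intro conjI exI[of _ V]) auto
  ultimately show ?thesis by (intro bexI)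
qed

lemma separated_iff:
  assumes "x \<in> unit_M" "y \<in> unit_M"
  shows "(\<exists>A\<in>join_partition T \<xi> n. \<exists>B\<in>join_partition T \<xi> n. A \<noteq> B \<and> x \<in> A \<and> y \<in> B)
    \<longleftrightarrow> \<not> same_cylinder n x y" (is "?L = ?R")
proof
  assume ?L
  then obtain A B where AB: "A \<in> join_partition T \<xi> n" "B \<in> join_partition T \<xi> n" "A \<noteq> B" "x \<in> A" "y \<in> B" by blast
  show ?R
  proof
    assume s: "same_cylinder n x y"
    have "z \<in> A \<longleftrightarrow> z \<in> B" if z: "z \<in> unit_M" for z
    proof -
      have "same_cylinder n x z \<longleftrightarrow> same_cylinder n y z"
        using same_cylinder_trans[OF s, of z] same_cylinder_trans[OF same_cylinder_sym[OF s], of z] by iprover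
      then show ?thesis
        using same_cylinder_iff[OF AB(1,4) z] same_cylinder_iff[OF AB(2,5) z] by simp
    qed
    then have "A = B" using join_partition_subset[OF AB(1)] join_partition_subset[OF AB(2)] by blast
    then show False using AB(3) by simp
  qed
next
  assume R: ?R
  obtain A where A: "A \<in> join_partition T \<xi> n" "x \<in> A" using ex_cylinder assms by blast
  obtain B where B: "B \<in> join_partition T \<xi> n" "y \<in> B" using ex_cylinder assms by blast
  have "y \<notin> A" using same_cylinder_iff[OF A assms(2)] R by blast
  then show ?L using A B by blast
qed

lemma sep_time_eq:
  assumes "x \<in> unit_M" "y \<in> unit_M"
  shows "sep_time T \<xi> x y = (LEAST n. 1 \<le> n \<and> \<not> same_cylinder n x y)"
  unfolding sep_time_def separated_iff[OF assms] ..

lemma endpoints_1: "endpoints T \<xi> 1 = (\<Union>W\<in>\<xi>. frontier W)"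
  unfolding endpoints_def One_nat_def join_partition_1 ..

lemma interior_not_endpoint:
  assumes "W \<in> \<xi>" "x \<in> interior W" shows "x \<notin> endpoints T \<xi> 1"
proof
  assume "x \<in> endpoints T \<xi> 1"
  then obtain V where V: "V \<in> \<xi>" "x \<in> frontier V" unfolding endpoints_1 by blast
  show False
  proof (cases "V = W")
    case True then show False using V assms by (simp add: frontier_def)
  next
    case False
    then have "interior W \<inter> V = {}" using piece_unique V(1) assms(1) interior_subset by blast
    then have "x \<notin> closure V" using assms(2) open_Int_closure_eq_empty[OF open_interior] by blast
    then show False using V(2) by (simp add: frontier_def)
  qed
qed

lemma interior_if_not_endpoint:
  assumes "W \<in> \<xi>" "x \<in> W" "x \<notin> endpoints T \<xi> 1" shows "x \<in> interior W"
  using assms closure_subset unfolding endpoints_1 frontier_def by blast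

text \<open>
  Inside a piece \<open>T\<close> is a homeomorphism onto an open set, so it matches boundary points of
  cylinders of order \<open>n + 1\<close> with boundary points of cylinders of order \<open>n\<close>.
\<close>

lemma frontier_cylinder_iff:
  assumes "W \<in> \<xi>" "x \<in> interior W"
  shows "x \<in> frontier {z \<in> unit_M. z \<in> W \<and> T z \<in> B} \<longleftrightarrow> T x \<in> frontier B"
    (is "x \<in> frontier ?A \<longleftrightarrow> _")
proof
  assume x: "x \<in> frontier ?A"
  show "T x \<in> frontier B"
    unfolding frontier_straddle
  proof (intro allI impI)
    fix e :: real assume "0 < e"
    have "isCont T x" using T_C1(1)[OF assms] DERIV_isCont by blast
    then obtain d where d: "0 < d" "\<And>z. dist z x < d \<Longrightarrow> dist (T z) (T x) < e"
      unfolding continuous_at_eps_delta using \<open>0 < e\<close> by blast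
    obtain r where r: "0 < r" "ball x r \<subseteq> interior W"
      using open_contains_ball[of "interior W"] assms(2) by auto
    have "0 < min d r" using d r by simp
    then obtain p q where pq: "p \<in> ?A" "dist x p < min d r" "q \<notin> ?A" "dist x q < min d r"
      using x unfolding frontier_straddle by blast
    have "q \<in> interior W" using pq r by auto
    then have "q \<in> W" "q \<in> unit_M" using interior_subset piece_subset[OF assms(1)] by blast+
    then have "T q \<notin> B" "T p \<in> B" using pq by auto
    moreover have "dist (T x) (T p) < e" "dist (T x) (T q) < e"
      using d(2)[of p] d(2)[of q] pq by (auto simp: dist_commute)
    ultimately show "(\<exists>y\<in>B. dist (T x) y < e) \<and> (\<exists>y. y \<notin> B \<and> dist (T x) y < e)" by blast
  qed
next
  assume x: "T x \<in> frontier B"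
  show "x \<in> frontier ?A"
    unfolding frontier_straddle
  proof (intro allI impI)
    fix e :: real assume "0 < e"
    define U where "U = ball x e \<inter> interior W"
    have "open (T ` U)" using open_image_piece[OF assms(1), of U] by (auto simp: U_def)
    moreover have "T x \<in> T ` U" using assms(2) \<open>0 < e\<close> by (auto simp: U_def)
    ultimately obtain r where r: "0 < r" "ball (T x) r \<subseteq> T ` U"
      using open_contains_ball[of "T ` U"] by blast
    obtain p q where "p \<in> B" "dist (T x) p < r" "q \<notin> B" "dist (T x) q < r"
      using x r(1) unfolding frontier_straddle by blast
    then obtain p' q' where "p' \<in> U" "q' \<in> U" "T p' \<in> B" "T q' \<notin> B"
      using r(2) by (metis image_iff mem_ball subsetD)
    moreover have "U \<subseteq> W" "U \<subseteq> unit_M" using interior_subset piece_subset[OF assms(1)] by (auto simp: U_def)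
    moreover have "dist x z < e" if "z \<in> U" for z using that by (simp add: U_def)
    ultimately show "(\<exists>y\<in>?A. dist x y < e) \<and> (\<exists>y. y \<notin> ?A \<and> dist x y < e)" by blast
  qed
qed

lemma endpoints_Suc_iff:
  assumes "W \<in> \<xi>" "x \<in> interior W" "1 \<le> n"
  shows "x \<in> endpoints T \<xi> (Suc n) \<longleftrightarrow> T x \<in> endpoints T \<xi> n"
proof
  assume "x \<in> endpoints T \<xi> (Suc n)"
  then obtain A where A: "A \<in> join_partition T \<xi> (Suc n)" "x \<in> frontier A" unfolding endpoints_def by blast
  then obtain V B where VB: "V \<in> \<xi>" "B \<in> join_partition T \<xi> n" "A = {x \<in> unit_M. x \<in> V \<and> T x \<in> B}"
    unfolding join_partition_Suc_iff by auto
  have "V = W"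
  proof (rule ccontr)
    assume "V \<noteq> W"
    then have "interior W \<inter> A = {}" using piece_unique VB assms(1) interior_subset by blast
    then have "x \<notin> closure A" using assms(2) open_Int_closure_eq_empty[OF open_interior] by blast
    then show False using A(2) by (simp add: frontier_def)
  qed
  then have "T x \<in> frontier B" using frontier_cylinder_iff[OF assms(1,2), of B] A VB by blast
  then show "T x \<in> endpoints T \<xi> n" using VB unfolding endpoints_def by blast
next
  assume "T x \<in> endpoints T \<xi> n"
  then obtain B where B: "B \<in> join_partition T \<xi> n" "T x \<in> frontier B" unfolding endpoints_def by blast
  define A where "A = {x \<in> unit_M. x \<in> W \<and> T x \<in> B}"
  have x: "x \<in> frontier A" using frontier_cylinder_iff[OF assms(1,2), of B] B unfolding A_def by blast
  then have "A \<noteq> {}" by auto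
  then have "A \<in> join_partition T \<xi> (Suc n)"
    unfolding join_partition_Suc_iff using B(1) assms(1) A_def by auto
  then show "x \<in> endpoints T \<xi> (Suc n)" using x unfolding endpoints_def by blast
qed

lemma endpoints_subset: "endpoints T \<xi> n \<subseteq> unit_M"
proof -
  have "frontier A \<subseteq> unit_M" if "A \<in> join_partition T \<xi> n" for A
  proof -
    have "closure A \<subseteq> unit_M" using join_partition_subset[OF that] by (simp add: closure_minimal)
    then show ?thesis by (auto simp: frontier_def)
  qed
  then show ?thesis unfolding endpoints_def by blast
qed

lemma countable_endpoints: "countable (endpoints T \<xi> (Suc n))"
proof (induction n)
  case 0
  have "countable (frontier W)" if "W \<in> \<xi>" for W
    using that is_interval_piece piece_subset countable_finite[OF finite_frontier_real_interval] bounded_subset[of unit_M W] by simp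
  then show ?case using endpoints_1 countable_pieces by simp
next
  case (Suc n)
  define P where "P W = {x \<in> interior W. T x \<in> endpoints T \<xi> (Suc n)}" for W
  have "countable (P W)" if "W \<in> \<xi>" for W
  proof -
    have "inj_on T (P W)" using inj_on_piece[OF that] by (rule inj_on_subset) (auto simp: P_def)
    moreover have "countable (T ` P W)" by (rule countable_subset[OF _ Suc]) (auto simp: P_def)
    ultimately show ?thesis by (rule countable_image_inj_on[rotated])
  qed
  moreover have "endpoints T \<xi> (Suc (Suc n)) \<subseteq> endpoints T \<xi> 1 \<union> (\<Union>W\<in>\<xi>. P W)"
  proof
    fix x assume x: "x \<in> endpoints T \<xi> (Suc (Suc n))"
    then obtain W where W: "W \<in> \<xi>" "x \<in> W" using endpoints_subset ex_piece by blast
    show "x \<in> endpoints T \<xi> 1 \<union> (\<Union>W\<in>\<xi>. P W)"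
    proof (cases "x \<in> endpoints T \<xi> 1")
      case False
      then have "x \<in> interior W" using interior_if_not_endpoint W by blast
      then have "x \<in> P W" using endpoints_Suc_iff[of W x "Suc n"] W x by (auto simp: P_def)
      then show ?thesis using W by blast
    qed simp
  qed
  moreover have "countable (endpoints T \<xi> 1)"
  proof -
    have "countable (frontier W)" if "W \<in> \<xi>" for W
      using that is_interval_piece piece_subset countable_finite[OF finite_frontier_real_interval] bounded_subset[of unit_M W] by simp
    then show ?thesis using endpoints_1 countable_pieces by simp
  qed
  ultimately show ?case using countable_pieces
    by (intro countable_subset[of "endpoints T \<xi> (Suc (Suc n))" "endpoints T \<xi> 1 \<union> (\<Union>W\<in>\<xi>. P W)"]) auto
qed

lemma countable_endpoints_inf: "countable (endpoints_inf T \<xi>)"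
proof -
  have "countable (endpoints T \<xi> n)" if "n \<in> {1..}" for n
    using countable_endpoints[of "n - 1"] that by simp
  then show ?thesis unfolding endpoints_inf_def by (intro countable_UN) auto
qed

text \<open>
  The points that are not an endpoint of any cylinder. Their complement in the unit interval is countable, and they are
  recognised, inside an element of the partition, from their image: see \<open>generic_T_iff\<close>.
\<close>

definition generic :: "real set" where "generic = unit_M - endpoints_inf T \<xi>"

lemma generic_subset: "generic \<subseteq> unit_M" unfolding generic_def by blast

lemma generic_interior: "\<lbrakk>x \<in> generic; W \<in> \<xi>; x \<in> W\<rbrakk> \<Longrightarrow> x \<in> interior W"
  by (rule interior_if_not_endpoint) (auto simp: generic_def endpoints_inf_def)

lemma generic_T_iff:
  assumes "W \<in> \<xi>" "x \<in> interior W"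
  shows "T x \<in> generic \<longleftrightarrow> x \<in> generic"
proof -
  have x: "x \<in> unit_M" using assms interior_subset piece_subset by blast
  have "x \<in> endpoints_inf T \<xi> \<longleftrightarrow> T x \<in> endpoints_inf T \<xi>"
  proof
    assume "x \<in> endpoints_inf T \<xi>"
    then obtain n where n: "1 \<le> n" "x \<in> endpoints T \<xi> n" unfolding endpoints_inf_def by auto
    have "n \<noteq> 1" using n(2) interior_not_endpoint[OF assms] by metis
    then obtain m where m: "n = Suc m" "1 \<le> m" using n(1) by (cases n) auto
    then have "T x \<in> endpoints T \<xi> m" using endpoints_Suc_iff[OF assms] n by blast
    then show "T x \<in> endpoints_inf T \<xi>" using m(2) unfolding endpoints_inf_def by auto
  next
    assume "T x \<in> endpoints_inf T \<xi>"
    then obtain n where n: "1 \<le> n" "T x \<in> endpoints T \<xi> n" unfolding endpoints_inf_def by auto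
    then have "x \<in> endpoints T \<xi> (Suc n)" using endpoints_Suc_iff[OF assms] by blast
    then show "x \<in> endpoints_inf T \<xi>" unfolding endpoints_inf_def by (intro UN_I[of "Suc n"]) auto
  qed
  then show ?thesis using x T_in unfolding generic_def by blast
qed

end

section \<open>Expansion and the separation metric\<close>

context interval_map
begin

lemma monotone_image_interval:
  assumes W: "W \<in> \<xi>" and sub: "{x..y} \<subseteq> interior W" and xy: "x < y"
  shows "T ` {x..y} = {min (T x) (T y)..max (T x) (T y)}" and "T x \<noteq> T y"
proof -
  have conn: "connected (T ` {x..y})"
    by (intro connected_continuous_image continuous_on_subset[OF T_C1(3)[OF W] sub]) auto
  have in_W: "x \<in> interior W" "y \<in> interior W" using sub xy by auto
  have "strict_mono_on (interior W) T \<or> strict_antimono_on (interior W) T"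
    using map W unfolding piecewise_monotone_map_def by blast
  then have bet: "T z \<in> {min (T x) (T y)..max (T x) (T y)}" if z: "z \<in> {x..y}" for z
  proof
    assume "strict_mono_on (interior W) T"
    then have "mono_on (interior W) T" by (rule strict_mono_on_imp_mono_on)
    then have "T x \<le> T z" "T z \<le> T y"
      using z in_W sub xy by (auto simp: subset_iff elim!: mono_onD)
    then show ?thesis by auto
  next
    assume a: "strict_antimono_on (interior W) T"
    have anti: "T q \<le> T p" if "p \<in> interior W" "q \<in> interior W" "p \<le> q" for p q
      using a that unfolding monotone_on_def by (cases "p = q") (auto intro: less_imp_le)
    have "T z \<le> T x" "T y \<le> T z"
      using z in_W sub xy anti[of x z] anti[of z y] by auto
    then show ?thesis by auto
  qed
  have "{T x..T y} \<subseteq> T ` {x..y}" "{T y..T x} \<subseteq> T ` {x..y}"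
    using xy by (intro connected_contains_Icc[OF conn]; simp)+
  then have "{min (T x) (T y)..max (T x) (T y)} \<subseteq> T ` {x..y}" by (simp add: min_def max_def)
  with bet show "T ` {x..y} = {min (T x) (T y)..max (T x) (T y)}" by blast
  show "T x \<noteq> T y" using inj_on_piece[OF W] in_W xy by (auto dest: inj_onD)
qed

text \<open>
  Applied to a short interval \<open>[x, y]\<close> inside one element of the partition, the expansion hypothesis has
  a single summand, and says that the length of the image exceeds \<open>y - x\<close> by a fixed factor.
\<close>

lemma H1_expanding:
  assumes "H1 T \<xi>"
  obtains \<kappa> where "1 < \<kappa>" "\<And>W x. \<lbrakk>W \<in> \<xi>; x \<in> interior W\<rbrakk> \<Longrightarrow> \<kappa> \<le> \<bar>deriv T x\<bar>"
proof -
  obtain q where q: "0 < q" "q \<le> 1" and L: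
    "Liminf (at_right 0) (\<lambda>\<delta>::real. SUP W \<in> {W. subinterval W \<and> len W < \<delta>}.
       (\<Sum>\<^sub>\<infinity>Wa\<in>induced_partition T \<xi> 1 W.
          ennreal ((len W / len (T ` Wa)) powr q * (len Wa / len W)))) < 1"
    using assms unfolding H1_def by blast
  define S where "S W = (\<Sum>\<^sub>\<infinity>Wa\<in>induced_partition T \<xi> 1 W.
          ennreal ((len W / len (T ` Wa)) powr q * (len Wa / len W)))" for W
  define F where "F \<delta> = (SUP W \<in> {W. subinterval W \<and> len W < \<delta>}. S W)" for \<delta> :: real
  have "Liminf (at_right 0) F < 1" using L unfolding F_def S_def .
  have "\<exists>\<delta>>0. F \<delta> < 1"
  proof (rule ccontr)
    assume "\<not> ?thesis"
    then have *: "1 \<le> F \<delta>" if "0 < \<delta>" for \<delta> using that not_less by blast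
    have "eventually (\<lambda>\<delta>. 1 \<le> F \<delta>) (at_right 0)"
      using eventually_at_right_less by (rule eventually_mono) (rule *)
    then have "1 \<le> Liminf (at_right 0) F" by (rule Liminf_bounded)
    then show False using \<open>Liminf (at_right 0) F < 1\<close> by (simp add: not_less[symmetric])
  qed
  then obtain \<delta> where \<delta>: "0 < \<delta>" "F \<delta> < 1" by blast
  \<comment> \<open>The maximum with \<open>1/2\<close> keeps \<open>\<theta>\<close> positive, so that its powers can be inverted.\<close>
  define \<theta> where "\<theta> = max (1/2) (enn2real (F \<delta>))"
  have "F \<delta> < top" using \<delta>(2) by (rule order_less_trans) simp
  then have Ffin: "ennreal (enn2real (F \<delta>)) = F \<delta>" by (rule ennreal_enn2real)
  have "ennreal (enn2real (F \<delta>)) < ennreal 1" using \<delta>(2) Ffin by simp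
  then have "enn2real (F \<delta>) < 1" by (subst (asm) ennreal_less_iff) auto
  then have \<theta>: "0 < \<theta>" "\<theta> < 1" by (auto simp: \<theta>_def)
  define \<kappa> where "\<kappa> = 1 / \<theta> powr (1 / q)"
  have "\<theta> powr (1 / q) < 1 powr (1 / q)" using \<theta> q by (intro powr_less_mono2) auto
  then have "1 < \<kappa>" unfolding \<kappa>_def using \<theta> by simp
  have step: "\<kappa> * (y - x) \<le> \<bar>T y - T x\<bar>"
    if W: "W \<in> \<xi>" and sub: "{x..y} \<subseteq> interior W" and xy: "x < y" "y - x < \<delta>" for W x y
  proof -
    define V where "V = {x..y}"
    have lenV: "len V = y - x" using xy by (simp add: V_def)
    have "V \<subseteq> W" unfolding V_def using sub interior_subset by (rule order_trans)
    moreover from this have "V \<subseteq> unit_M" using piece_subset[OF W] by (rule order_trans)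
    moreover have "V \<noteq> {}" using xy by (simp add: V_def)
    ultimately have V: "V \<subseteq> W" "V \<noteq> {}" "V \<subseteq> unit_M" by auto
    have "subinterval V" unfolding subinterval_def using V lenV xy by (auto simp: V_def is_interval_cc)
    have "V \<inter> A = {}" if "A \<in> \<xi>" "A \<noteq> W" for A using piece_unique[OF W that(1)] that(2) V(1) by blast
    then have "induced_partition T \<xi> 1 V = {V}"
      unfolding induced_partition_def One_nat_def join_partition_1 using V W by (auto simp: Int_absorb2)
    then have S: "S V = ennreal ((len V / len (T ` V)) powr q * (len V / len V))"
      unfolding S_def by simp
    have lenTV: "len (T ` V) = \<bar>T y - T x\<bar>"
      using monotone_image_interval(1)[OF W sub xy(1)] by (simp add: V_def min_def max_def)
    have pos: "0 < \<bar>T y - T x\<bar>" using monotone_image_interval(2)[OF W sub xy(1)] by simp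
    have "S V \<le> F \<delta>" unfolding F_def using \<open>subinterval V\<close> lenV xy by (intro SUP_upper) auto
    then have "ennreal (((y - x) / \<bar>T y - T x\<bar>) powr q) \<le> ennreal (enn2real (F \<delta>))"
      using xy by (simp add: S lenV lenTV Ffin)
    then have "((y - x) / \<bar>T y - T x\<bar>) powr q \<le> \<theta>" unfolding \<theta>_def by (auto simp: max_def)
    then have "(((y - x) / \<bar>T y - T x\<bar>) powr q) powr (1 / q) \<le> \<theta> powr (1 / q)"
      using q by (intro powr_mono2) auto
    then have "(y - x) / \<bar>T y - T x\<bar> \<le> \<theta> powr (1 / q)"
      using q pos xy by (simp add: powr_powr)
    moreover have "\<theta> powr (1 / q) = 1 / \<kappa>" unfolding \<kappa>_def by simp
    ultimately show ?thesis using pos \<open>1 < \<kappa>\<close> by (simp add: field_simps)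
  qed
  have "\<kappa> \<le> \<bar>deriv T x\<bar>" if W: "W \<in> \<xi>" and x: "x \<in> interior W" for W x
  proof -
    obtain r where r: "0 < r" "ball x r \<subseteq> interior W"
      using x open_contains_ball[of "interior W"] by auto
    have "((\<lambda>h. (T (x + h) - T x) / h) \<longlongrightarrow> deriv T x) (at 0)"
      using T_C1(1)[OF W x] by (simp add: DERIV_def)
    then have "((\<lambda>h. (T (x + h) - T x) / h) \<longlongrightarrow> deriv T x) (at_right 0)"
      by (rule filterlim_mono[OF _ order_refl at_le]) simp
    then have lim: "((\<lambda>h. \<bar>(T (x + h) - T x) / h\<bar>) \<longlongrightarrow> \<bar>deriv T x\<bar>) (at_right 0)"
      by (rule tendsto_rabs)
    have "0 < min \<delta> r" using r \<delta> by simp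
    then have "eventually (\<lambda>h. h \<in> {0<..<min \<delta> r}) (at_right 0)" by (rule eventually_at_right_real)
    then have "eventually (\<lambda>h. \<kappa> \<le> \<bar>(T (x + h) - T x) / h\<bar>) (at_right 0)"
    proof eventually_elim
      case (elim h)
      have "{x..x+h} \<subseteq> ball x r" using elim by (auto simp: dist_real_def)
      then have "\<kappa> * (x + h - x) \<le> \<bar>T (x + h) - T x\<bar>" using elim r by (intro step[OF W]) auto
      then show ?case using elim by (simp add: field_simps abs_divide)
    qed
    then show ?thesis by (intro tendsto_lowerbound[OF lim]) auto
  qed
  then show ?thesis using that \<open>1 < \<kappa>\<close> by blast
qed

text \<open>
  Points that are never separated would move apart exponentially fast inside the unit interval.
\<close>

lemma ex_separated:
  assumes "H1 T \<xi>" and xy: "x \<in> generic" "y \<in> generic" "x \<noteq> y"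
  shows "\<exists>n\<ge>1. \<not> same_cylinder n x y"
proof (rule ccontr)
  assume "\<not> ?thesis"
  then have same: "same_cylinder (Suc n) x y" for n by auto
  obtain \<kappa> where \<kappa>: "1 < \<kappa>" "\<And>W x. \<lbrakk>W \<in> \<xi>; x \<in> interior W\<rbrakk> \<Longrightarrow> \<kappa> \<le> \<bar>deriv T x\<bar>"
    using H1_expanding[OF assms(1)] by blast
  have expand: "\<kappa> * \<bar>a - b\<bar> \<le> \<bar>T a - T b\<bar>"
    if W: "W \<in> \<xi>" and a: "a \<in> interior W" and b: "b \<in> interior W" and "a < b" for W a b
  proof -
    have sub: "{a..b} \<subseteq> interior W"
    proof -
      have "is_interval (interior W)"
        using is_interval_piece[OF W] by (simp add: is_interval_convex_1 convex_interior)
      then show ?thesis using mem_is_interval_1_I[OF _ a b] by auto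
    qed
    obtain c where c: "a < c" "c < b" "T b - T a = (b - a) * deriv T c"
      using MVT2[OF \<open>a < b\<close>, of T "deriv T"] T_C1(1)[OF W] sub by (metis atLeastAtMost_iff subsetD)
    have "\<kappa> \<le> \<bar>deriv T c\<bar>" 
    proof (rule \<kappa>(2)[OF W])
      show "c \<in> interior W" using sub c by (intro subsetD[OF sub]) simp
    qed
    then have "(b - a) * \<kappa> \<le> (b - a) * \<bar>deriv T c\<bar>" using \<open>a < b\<close> by (intro mult_left_mono) auto
    also have "\<dots> = \<bar>T b - T a\<bar>" using c \<open>a < b\<close> by (simp add: abs_mult)
    finally show ?thesis using \<open>a < b\<close> by (simp add: abs_minus_commute mult.commute)
  qed
  have "(T ^^ n) x \<in> generic \<and> (T ^^ n) y \<in> generic \<and> \<kappa> ^ n * \<bar>x - y\<bar> \<le> \<bar>(T ^^ n) x - (T ^^ n) y\<bar>" for n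
  proof (induction n)
    case (Suc n)
    define a b where "a = (T ^^ n) x" and "b = (T ^^ n) y"
    have ab: "a \<in> generic" "b \<in> generic" "\<kappa> ^ n * \<bar>x - y\<bar> \<le> \<bar>a - b\<bar>" using Suc by (auto simp: a_def b_def)
    obtain W where W: "W \<in> \<xi>" "a \<in> W" "b \<in> W"
      using same[of n] unfolding same_cylinder_def a_def b_def by blast
    have int: "a \<in> interior W" "b \<in> interior W" using generic_interior ab W by auto
    have "0 < \<kappa> ^ n * \<bar>x - y\<bar>" using \<kappa> xy by simp
    then have "a \<noteq> b" using ab(3) by auto
    then have "\<kappa> * \<bar>a - b\<bar> \<le> \<bar>T a - T b\<bar>"
    proof (cases "a < b")
      case True then show ?thesis by (rule expand[OF W(1) int])
    next
      case False
      then show ?thesis using expand[OF W(1) int(2,1)] \<open>a \<noteq> b\<close> by (simp add: abs_minus_commute)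
    qed
    moreover have "\<kappa> * (\<kappa> ^ n * \<bar>x - y\<bar>) \<le> \<kappa> * \<bar>a - b\<bar>" using ab \<kappa> by (intro mult_left_mono) auto
    ultimately have "\<kappa> ^ Suc n * \<bar>x - y\<bar> \<le> \<bar>T a - T b\<bar>" by simp
    moreover have "T a \<in> generic" "T b \<in> generic" using generic_T_iff int W ab by auto
    ultimately show ?case by (simp add: a_def b_def)
  qed (use xy in simp)
  moreover have "\<bar>u - v\<bar> \<le> 1" if "u \<in> generic" "v \<in> generic" for u v
  proof -
    have "u \<in> unit_M" "v \<in> unit_M" using that generic_subset by blast+
    then show ?thesis by (auto simp: abs_le_iff)
  qed
  ultimately have bound: "\<kappa> ^ n * \<bar>x - y\<bar> \<le> 1" for n by (meson order_trans)
  obtain n where "1 / \<bar>x - y\<bar> < \<kappa> ^ n" using real_arch_pow[OF \<kappa>(1)] by blast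
  then show False using bound[of n] xy by (simp add: field_simps)
qed

end

text \<open>
  The map is expanding and has bounded distortion with constants \<open>CJ\<close> and \<open>\<gamma>J\<close>; the weaker
  rate \<open>\<gamma>\<close> is the one used for densities.
\<close>

locale expanding_interval_map = interval_map +
  fixes CJ \<gamma>J \<gamma> :: real
  assumes H1: "H1 T \<xi>" and H2: "H2 T \<xi> CJ \<gamma>J" and gamma: "\<gamma>J \<le> \<gamma>" "\<gamma> < 1"
begin

lemma gamma_pos: "0 < \<gamma>" and CJ_pos: "0 < CJ"
  using H2 gamma unfolding H2_def by auto

text \<open>
  The separation metric. It is a metric on the generic points only, where distinct points have a finite separation time.
\<close>

definition sep_dist :: "real \<Rightarrow> real \<Rightarrow> real" where
  "sep_dist x y = (if x = y then 0 else \<gamma> ^ sep_time T \<xi> x y)"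

lemma sep_dist_refl [simp]: "sep_dist x x = 0"
  unfolding sep_dist_def by simp

lemma sep_dist_nonneg: "0 \<le> sep_dist x y"
  unfolding sep_dist_def using gamma_pos by simp

lemma sep_dist_le_1: "sep_dist x y \<le> 1"
  unfolding sep_dist_def using gamma_pos gamma by (simp add: power_le_one)

lemma sep_time_props:
  assumes "x \<in> generic" "y \<in> generic" "x \<noteq> y"
  shows "1 \<le> sep_time T \<xi> x y" "\<not> same_cylinder (sep_time T \<xi> x y) x y"
    "\<And>n. n < sep_time T \<xi> x y \<longleftrightarrow> same_cylinder n x y"
proof -
  have eq: "sep_time T \<xi> x y = (LEAST n. 1 \<le> n \<and> \<not> same_cylinder n x y)"
    using sep_time_eq assms generic_subset by blast
  obtain k where "1 \<le> k \<and> \<not> same_cylinder k x y" using ex_separated[OF H1 assms] by blast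
  then have "1 \<le> sep_time T \<xi> x y \<and> \<not> same_cylinder (sep_time T \<xi> x y) x y"
    unfolding eq by (rule LeastI)
  then show 1: "1 \<le> sep_time T \<xi> x y" "\<not> same_cylinder (sep_time T \<xi> x y) x y" by auto
  show "n < sep_time T \<xi> x y \<longleftrightarrow> same_cylinder n x y" for n
  proof
    assume "n < sep_time T \<xi> x y"
    then have "\<not> (1 \<le> n \<and> \<not> same_cylinder n x y)" unfolding eq by (rule not_less_Least)
    moreover have "same_cylinder 0 x y" unfolding same_cylinder_def by simp
    ultimately show "same_cylinder n x y" by (cases n) auto
  next
    assume "same_cylinder n x y"
    then show "n < sep_time T \<xi> x y" using 1(2) same_cylinder_mono by (meson not_less)
  qed
qed

lemma sep_dist_triangle:
  assumes "x \<in> generic" "y \<in> generic" "z \<in> generic"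
  shows "sep_dist x z \<le> sep_dist x y + sep_dist y z"
proof (cases "x = y \<or> y = z \<or> x = z")
  case True then show ?thesis using sep_dist_nonneg[of x y] sep_dist_nonneg[of y z] by (auto)
next
  case False
  define n where "n = sep_time T \<xi> x z"
  have "\<not> (same_cylinder n x y \<and> same_cylinder n y z)"
    using sep_time_props(2)[of x z] False assms same_cylinder_trans unfolding n_def by blast
  then have "sep_time T \<xi> x y \<le> n \<or> sep_time T \<xi> y z \<le> n"
    using sep_time_props(3)[of x y n] sep_time_props(3)[of y z n] False assms by (auto simp: not_less)
  then have "\<gamma> ^ n \<le> \<gamma> ^ sep_time T \<xi> x y \<or> \<gamma> ^ n \<le> \<gamma> ^ sep_time T \<xi> y z"
    using gamma gamma_pos by (auto intro: power_decreasing)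
  then have "\<gamma> ^ n \<le> \<gamma> ^ sep_time T \<xi> x y + \<gamma> ^ sep_time T \<xi> y z"
    using gamma_pos by (auto intro: order_trans)
  then show ?thesis using False by (simp add: sep_dist_def n_def)
qed

lemma sep_dist_le_if_same_cylinder:
  assumes "x \<in> generic" "y \<in> generic" "same_cylinder n x y"
  shows "sep_dist x y \<le> \<gamma> ^ n"
proof (cases "x = y")
  case False
  then have "n < sep_time T \<xi> x y" using sep_time_props(3) assms by blast
  then show ?thesis using False gamma gamma_pos by (simp add: sep_dist_def power_decreasing)
qed (use gamma_pos in simp)

text \<open>
  Points of one element of the partition need one step more to separate than their images do.
\<close>

lemma sep_dist_contract:
  assumes "W \<in> \<xi>" "x \<in> interior W" "y \<in> interior W" "x \<in> generic" "y \<in> generic"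
  shows "sep_dist x y \<le> \<gamma> * sep_dist (T x) (T y)"
proof (cases "x = y")
  case False
  then have ne: "T x \<noteq> T y" using inj_on_piece[OF assms(1)] assms by (auto dest: inj_onD)
  have g: "T x \<in> generic" "T y \<in> generic" using generic_T_iff assms by auto
  obtain n where n: "sep_time T \<xi> x y = Suc n" using sep_time_props(1)[of x y] False assms by (cases "sep_time T \<xi> x y") auto
  have "\<exists>W\<in>\<xi>. x \<in> W \<and> y \<in> W" using assms interior_subset by blast
  then have "\<not> same_cylinder n (T x) (T y)"
    using sep_time_props(2)[of x y] False assms same_cylinder_Suc n by simp
  then have "sep_time T \<xi> (T x) (T y) \<le> n" using sep_time_props(3)[OF g ne, of n] by simp
  then have "\<gamma> ^ n \<le> \<gamma> ^ sep_time T \<xi> (T x) (T y)" using gamma gamma_pos by (intro power_decreasing) auto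
  then show ?thesis using False ne gamma_pos by (simp add: sep_dist_def n)
qed (simp add: gamma_pos sep_dist_nonneg less_imp_le)

lemma deriv_nonzero: "\<lbrakk>W \<in> \<xi>; x \<in> interior W\<rbrakk> \<Longrightarrow> deriv T x \<noteq> 0"
  using H2 unfolding H2_def by blast

lemma log_deriv_distortion:
  assumes W: "W \<in> \<xi>" and x: "x \<in> interior W" "x \<in> generic" and y: "y \<in> interior W" "y \<in> generic"
  shows "\<bar>ln \<bar>deriv T x\<bar> - ln \<bar>deriv T y\<bar>\<bar> \<le> CJ * sep_dist x y"
proof (cases "x = y")
  case False
  have xW: "x \<in> W" "y \<in> W" using x y interior_subset by blast+
  define f where "f = (\<lambda>x. indicator W x * ln \<bar>deriv T x\<bar>)"
  have "0 < \<gamma>J" using H2 unfolding H2_def by blast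
  define s where "s = sep_time T \<xi> x y"
  have "ennreal (\<bar>f x - f y\<bar> / \<gamma>J ^ s) \<le> dyn_seminorm T \<xi> W \<gamma>J f"
    unfolding dyn_seminorm_def s_def using x y xW False
    by (intro SUP_upper2[of "(x, y)"]) (auto simp: generic_def)
  also have "\<dots> \<le> ennreal CJ" using H2 W unfolding H2_def f_def by blast
  finally have "\<bar>f x - f y\<bar> / \<gamma>J ^ s \<le> CJ" using CJ_pos by simp
  then have "\<bar>f x - f y\<bar> \<le> CJ * \<gamma>J ^ s" using \<open>0 < \<gamma>J\<close> by (simp add: field_simps)
  also have "\<dots> \<le> CJ * \<gamma> ^ s" using \<open>0 < \<gamma>J\<close> gamma CJ_pos by (intro mult_left_mono power_mono) auto
  finally show ?thesis using False xW by (simp add: f_def sep_dist_def s_def)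
qed simp

text \<open>
  One point from each cylinder that meets \<open>E\<close> gives a countable dense subset.
\<close>

lemma sep_dist_separable:
  assumes "E \<subseteq> generic"
  obtains Y where "countable Y" "Y \<subseteq> E" "\<And>x e. x \<in> E \<Longrightarrow> 0 < e \<Longrightarrow> \<exists>y\<in>Y. sep_dist x y < e"
proof
  define J where "J = (\<Union>n. join_partition T \<xi> n)"
  define Y where "Y = (\<lambda>A. SOME y. y \<in> A \<inter> E) ` {A \<in> J. A \<inter> E \<noteq> {}}"
  have sel: "(SOME y. y \<in> A \<inter> E) \<in> A \<inter> E" if "A \<inter> E \<noteq> {}" for A
    using that by (meson ex_in_conv someI_ex)
  have "countable J" unfolding J_def using countable_join_partition by auto
  then have "countable {A \<in> J. A \<inter> E \<noteq> {}}" by (rule countable_subset[rotated]) blast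
  then show "countable Y" unfolding Y_def by (rule countable_image)
  show "Y \<subseteq> E" unfolding Y_def using sel by blast
  show "\<exists>y\<in>Y. sep_dist x y < e" if x: "x \<in> E" and e: "0 < e" for x e
  proof -
    obtain n where n: "\<gamma> ^ n < e" using real_arch_pow_inv[OF e gamma(2)] by blast
    obtain A where A: "A \<in> join_partition T \<xi> n" "x \<in> A"
      using ex_cylinder x assms generic_subset by blast
    define y where "y = (SOME y. y \<in> A \<inter> E)"
    have y: "y \<in> A" "y \<in> E" using sel[of A] A(2) x unfolding y_def by auto
    have "y \<in> Y" unfolding Y_def y_def using A x by (intro imageI) (auto simp: J_def)
    moreover have "same_cylinder n x y"
      using same_cylinder_iff[OF A, of y] y assms generic_subset by blast
    ultimately show ?thesis
    proof (intro bexI)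
      have "sep_dist x y \<le> \<gamma> ^ n"
        using x y(2) assms \<open>same_cylinder n x y\<close> by (intro sep_dist_le_if_same_cylinder) auto
      then show "sep_dist x y < e" using n by simp
    qed
  qed
qed

end

section \<open>Geometry and Borel sets of the tower\<close>

lemma interior_nonempty_iff_len_pos:
  fixes D :: "real set"
  assumes "is_interval D" "bounded D"
  shows "interior D \<noteq> {} \<longleftrightarrow> 0 < len D"
proof
  have [measurable]: "D \<in> sets borel" using assms(1) by (rule real_interval_borel_measurable)
  have fin: "emeasure lborel D < \<infinity>" using assms(2) by (rule emeasure_bounded_finite)
  show "0 < len D" if "interior D \<noteq> {}"
  proof -
    obtain x e where e: "0 < e" "ball x e \<subseteq> D" using \<open>interior D \<noteq> {}\<close> mem_interior by blast
    then have "{x..x + e / 2} \<subseteq> D" by (auto simp: subset_iff dist_real_def)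
    then have "len {x..x + e / 2} \<le> len D"
      using fin by (intro measure_mono_fmeasurable) (auto intro: fmeasurableI)
    then show ?thesis using e by simp
  qed
  show "interior D \<noteq> {}" if "0 < len D"
  proof
    assume "interior D = {}"
    then have "D \<subseteq> frontier D" using closure_subset by (auto simp: frontier_def)
    then have "finite D" using finite_frontier_real_interval[OF assms] finite_subset by blast
    then have "len D = 0" by (simp add: measure_def emeasure_lborel_countable countable_finite)
    then show False using that by simp
  qed
qed

lemma (in interval_map) sep_time_commute: "sep_time T \<xi> x y = sep_time T \<xi> y x"
proof -
  have "(\<exists>A\<in>J. \<exists>B\<in>J. A \<noteq> B \<and> x \<in> A \<and> y \<in> B) \<longleftrightarrow> (\<exists>A\<in>J. \<exists>B\<in>J. A \<noteq> B \<and> y \<in> A \<and> x \<in> B)"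
    for J :: "real set set" by metis
  then show ?thesis unfolding sep_time_def by simp
qed

lemma (in expanding_interval_map) sep_dist_commute: "sep_dist x y = sep_dist y x"
  unfolding sep_dist_def using sep_time_commute by simp

text \<open>
  All levels of the tower are intervals.
\<close>

locale hofbauer_tower = expanding_interval_map +
  assumes tower_intervals: "\<forall>D\<in>tower_sets T \<xi>. is_interval D"
begin

lemma is_interval_tower_set: "D \<in> tower_sets T \<xi> \<Longrightarrow> is_interval D"
  using tower_intervals by blast

lemma tower_level_Suc_iff:
  "D' \<in> tower_level T \<xi> (Suc n) \<longleftrightarrow>
     (\<exists>D\<in>tower_level T \<xi> n. \<exists>W\<in>\<xi>. subinterval (D \<inter> W) \<and> D' = T ` (D \<inter> W))"
proof -
  have "D' \<in> tower_level T \<xi> (Suc n) \<longleftrightarrow>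
      (\<exists>W D. D' = T ` (W \<inter> D) \<and> W \<in> \<xi> \<and> D \<in> tower_level T \<xi> n \<and> subinterval (W \<inter> D))" by simp
  also have "\<dots> \<longleftrightarrow> (\<exists>W D. D' = T ` (D \<inter> W) \<and> W \<in> \<xi> \<and> D \<in> tower_level T \<xi> n \<and> subinterval (D \<inter> W))"
    by (subst (1 2) Int_commute) (rule refl)
  finally show ?thesis by blast
qed

lemma tower_level_subset: "D \<in> tower_level T \<xi> n \<Longrightarrow> D \<subseteq> unit_M"
proof (induction n)
  case (Suc n)
  then obtain W V where "D = T ` (W \<inter> V)" "W \<in> \<xi>" by auto
  then show ?case using T_in piece_subset by (auto 0 0 simp: subset_iff simp del: atLeastAtMost_iff)
qed simp

lemma unit_in_tower_sets: "unit_M \<in> tower_sets T \<xi>"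
  unfolding tower_sets_def by (intro UN_I[of 0]) auto

lemma countable_tower_sets: "countable (tower_sets T \<xi>)"
proof -
  have "countable (tower_level T \<xi> n)" for n
  proof (induction n)
    case (Suc n)
    have "tower_level T \<xi> (Suc n) \<subseteq> (\<lambda>(W, V). T ` (W \<inter> V)) ` (\<xi> \<times> tower_level T \<xi> n)" by auto
    then show ?case using Suc countable_pieces by (meson countable_SIGMA countable_image countable_subset)
  qed simp
  then show ?thesis unfolding tower_sets_def by auto
qed

lemma tower_set_subset: "D \<in> tower_sets T \<xi> \<Longrightarrow> D \<subseteq> unit_M"
  unfolding tower_sets_def using tower_level_subset by blast

lemma closure_tower_set_subset: "D \<in> tower_sets T \<xi> \<Longrightarrow> closure D \<subseteq> unit_M"
  using tower_set_subset by (simp add: closure_minimal)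

lemma bounded_tower_set: "D \<in> tower_sets T \<xi> \<Longrightarrow> bounded D"
  using tower_set_subset bounded_subset[of unit_M D] by simp

lemma Int_piece_interval:
  assumes "D \<subseteq> unit_M" "is_interval D" "W \<in> \<xi>"
  shows "is_interval (D \<inter> W)" "bounded (D \<inter> W)" "subinterval (D \<inter> W) \<longleftrightarrow> interior D \<inter> interior W \<noteq> {}"
proof -
  show 1: "is_interval (D \<inter> W)" using assms is_interval_piece by (intro is_interval_Int)
  show 2: "bounded (D \<inter> W)" using assms(1) by (intro bounded_subset[of unit_M "D \<inter> W"]) auto
  show "subinterval (D \<inter> W) \<longleftrightarrow> interior D \<inter> interior W \<noteq> {}"
    using interior_nonempty_iff_len_pos[OF 1 2] 1 assms(1) unfolding subinterval_def by auto
qed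

text \<open>
  On the interior of \<open>D \<inter> W\<close> the map is a homeomorphism onto an open interval; the remaining
  points, on which the map is not controlled, are finite in number. Hence the interior of a level is the image of interior points.
\<close>

lemma interior_image_Int_piece:
  assumes D: "D \<in> tower_sets T \<xi>" and W: "W \<in> \<xi>" and ne: "interior D \<inter> interior W \<noteq> {}"
  shows "T ` (D \<inter> W) \<in> tower_sets T \<xi>" "interior (T ` (D \<inter> W)) = T ` (interior D \<inter> interior W)"
proof -
  note int = Int_piece_interval[OF tower_set_subset[OF D] is_interval_tower_set[OF D] W]
  obtain n where n: "D \<in> tower_level T \<xi> n" using D unfolding tower_sets_def by blast
  have "subinterval (D \<inter> W)" using int(3) ne by simp
  then have "T ` (D \<inter> W) \<in> tower_level T \<xi> (Suc n)"
    using n W unfolding tower_level_Suc_iff by blast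
  then show D': "T ` (D \<inter> W) \<in> tower_sets T \<xi>" unfolding tower_sets_def by blast
  define O' where "O' = interior D \<inter> interior W"
  have O_int: "O' = interior (D \<inter> W)" by (simp add: O'_def)
  have "is_interval O'" 
    unfolding O_int using int(1) unfolding is_interval_convex_1 by (rule convex_interior)
  have "O' \<subseteq> interior W" by (simp add: O'_def)
  have "open (T ` O')" using W by (rule open_image_piece) (auto simp: O'_def)
  moreover have "is_interval (T ` O')"
    using \<open>is_interval O'\<close> \<open>O' \<subseteq> interior W\<close> T_C1(3)[OF W]
    unfolding is_interval_connected_1
    by (intro connected_continuous_image continuous_on_subset[OF T_C1(3)[OF W]])
  moreover have "O' \<subseteq> D \<inter> W" unfolding O_int by (rule interior_subset)
  then have "T ` O' \<subseteq> T ` (D \<inter> W)" by blast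
  moreover have "finite (T ` (D \<inter> W) - T ` O')"
  proof (rule finite_subset)
    have "D \<inter> W - O' \<subseteq> frontier (D \<inter> W)"
      unfolding O_int frontier_def by (intro Diff_mono closure_subset order_refl)
    then have "T ` (D \<inter> W - O') \<subseteq> T ` frontier (D \<inter> W)" by (rule image_mono)
    then show "T ` (D \<inter> W) - T ` O' \<subseteq> T ` frontier (D \<inter> W)"
      using image_diff_subset by (rule order_trans[rotated])
    show "finite (T ` frontier (D \<inter> W))" using finite_frontier_real_interval[OF int(1,2)] by simp
  qed
  ultimately show "interior (T ` (D \<inter> W)) = T ` (interior D \<inter> interior W)"
    unfolding O'_def[symmetric] by (rule interior_eq_of_finite_Diff)
qed

lemma interior_tower_set_nonempty:
  assumes "D \<in> tower_sets T \<xi>" shows "interior D \<noteq> {}"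
proof -
  obtain n where "D \<in> tower_level T \<xi> n" using assms unfolding tower_sets_def by blast
  then show ?thesis
  proof (cases n)
    case (Suc m)
    then obtain W V where WV: "D = T ` (V \<inter> W)" "W \<in> \<xi>" "V \<in> tower_level T \<xi> m" "subinterval (V \<inter> W)"
      using \<open>D \<in> tower_level T \<xi> n\<close> unfolding Suc tower_level_Suc_iff by blast
    have V: "V \<in> tower_sets T \<xi>" using WV(3) unfolding tower_sets_def by blast
    have "interior V \<inter> interior W \<noteq> {}"
      using Int_piece_interval(3)[OF tower_set_subset[OF V] is_interval_tower_set[OF V] WV(2)] WV(4) by simp
    then show ?thesis using interior_image_Int_piece(2)[OF V WV(2)] unfolding WV(1) by simp
  qed simp
qed

lemma subinterval_tower_set: "D \<in> tower_sets T \<xi> \<Longrightarrow> subinterval D"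
  unfolding subinterval_def using tower_set_subset is_interval_tower_set interior_tower_set_nonempty
    interior_nonempty_iff_len_pos bounded_tower_set by blast

lemma topspace_tower: "topspace (tower_topology T \<xi>) = tower T \<xi>"
  unfolding tower_topology_def tower_def by auto

lemma space_tower_borel: "space (tower_borel T \<xi>) = tower T \<xi>"
  and sets_tower_borel: "sets (tower_borel T \<xi>) = sigma_sets (tower T \<xi>) {U. openin (tower_topology T \<xi>) U}"
proof -
  have "{U. openin (tower_topology T \<xi>) U} \<subseteq> Pow (tower T \<xi>)"
    using openin_subset topspace_tower by blast
  then show "space (tower_borel T \<xi>) = tower T \<xi>"
    "sets (tower_borel T \<xi>) = sigma_sets (tower T \<xi>) {U. openin (tower_topology T \<xi>) U}"
    unfolding tower_borel_def by auto
qed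

lemma closure_borel: "closure (D :: real set) \<in> sets borel"
  by (simp add: borel_closed)

lemma slice_in_tower_borel:
  assumes D: "D \<in> tower_sets T \<xi>" and B: "B \<in> sets borel"
  shows "{D} \<times> (closure D \<inter> B) \<in> sets (tower_borel T \<xi>)"
proof -
  have op: "{D} \<times> (closure D \<inter> S) \<in> sets (tower_borel T \<xi>)" if "open S" for S
  proof -
    have "{x. (D', x) \<in> {D} \<times> (closure D \<inter> S)} = (if D' = D then closure D \<inter> S else {})" for D'
      by auto
    then have "openin (tower_topology T \<xi>) ({D} \<times> (closure D \<inter> S))"
      unfolding tower_topology_def openin_sum_topology using D that by auto
    then show ?thesis unfolding sets_tower_borel by (intro sigma_sets.Basic) simp
  qed
  have "B \<in> sigma_sets UNIV {S. open S}" using B by (simp add: borel_def)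
  then show ?thesis
  proof induction
    case (Compl B)
    have "{D} \<times> (closure D \<inter> (UNIV - B)) = {D} \<times> (closure D \<inter> UNIV) - {D} \<times> (closure D \<inter> B)" by blast
    then show ?case using op[OF open_UNIV] Compl.IH by (simp only: sets.Diff)
  next
    case (Union B)
    have "{D} \<times> (closure D \<inter> (\<Union>i. B i)) = (\<Union>i. {D} \<times> (closure D \<inter> B i))" by blast
    then show ?case using Union.IH by auto
  qed (use op in auto)
qed

lemma tower_copy_in_tower_borel: "D \<in> tower_sets T \<xi> \<Longrightarrow> tower_copy D \<in> sets (tower_borel T \<xi>)"
  using slice_in_tower_borel[of D UNIV] by (simp add: tower_copy_def)

text \<open>
  There are countably many levels, so Borel sets of the tower are described level by level.
\<close>

lemma sets_tower_borel_iff: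
  "A \<in> sets (tower_borel T \<xi>) \<longleftrightarrow>
     A \<subseteq> tower T \<xi> \<and> (\<forall>D\<in>tower_sets T \<xi>. {x. (D, x) \<in> A} \<in> sets borel)"
proof (intro iffI conjI ballI)
  assume A: "A \<in> sets (tower_borel T \<xi>)"
  show "A \<subseteq> tower T \<xi>" using sets.sets_into_space[OF A] space_tower_borel by simp
  fix D assume D: "D \<in> tower_sets T \<xi>"
  have "A \<in> sigma_sets (tower T \<xi>) {U. openin (tower_topology T \<xi>) U}" using A sets_tower_borel by simp
  then show "{x. (D, x) \<in> A} \<in> sets borel"
  proof induction
    case (Basic U)
    then have "openin (top_of_set (closure D)) {x. (D, x) \<in> U}"
      unfolding tower_topology_def openin_sum_topology using D by auto
    then obtain S where "open S" "{x. (D, x) \<in> U} = closure D \<inter> S" by (auto simp: openin_open)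
    then show ?case using closure_borel by auto
  next
    case (Compl A)
    have "{x. (D, x) \<in> tower T \<xi> - A} = closure D - {x. (D, x) \<in> A}" using D by (auto simp: tower_def)
    then show ?case using Compl.IH closure_borel by (simp only: sets.Diff)
  next
    case (Union A)
    have "{x. (D, x) \<in> (\<Union>i. A i)} = (\<Union>i. {x. (D, x) \<in> A i})" by blast
    then show ?case using Union.IH by auto
  qed simp
next
  assume A: "A \<subseteq> tower T \<xi> \<and> (\<forall>D\<in>tower_sets T \<xi>. {x. (D, x) \<in> A} \<in> sets borel)"
  then have "A = (\<Union>D\<in>tower_sets T \<xi>. {D} \<times> (closure D \<inter> {x. (D, x) \<in> A}))"
    by (auto simp: tower_def)
  also have "\<dots> \<in> sets (tower_borel T \<xi>)"
    using A slice_in_tower_borel by (intro sets.countable_UN'' countable_tower_sets) auto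
  finally show "A \<in> sets (tower_borel T \<xi>)" .
qed

lemma slice_borel: "A \<in> sets (tower_borel T \<xi>) \<Longrightarrow> {x. (D, x) \<in> A} \<in> sets borel"
proof (cases "D \<in> tower_sets T \<xi>")
  case False
  assume "A \<in> sets (tower_borel T \<xi>)"
  then have "{x. (D, x) \<in> A} = {}" using False sets_tower_borel_iff by (auto simp: tower_def)
  then show ?thesis by simp
qed (use sets_tower_borel_iff in blast)

lemma measurable_slice_indicator [measurable]:
  assumes "A \<in> sets (tower_borel T \<xi>)"
  shows "(\<lambda>x. indicator A (D, x) :: ennreal) \<in> borel_measurable borel"
proof -
  have "(\<lambda>x. indicator A (D, x) :: ennreal) = indicator {x. (D, x) \<in> A}" by (auto simp: indicator_def)
  then show ?thesis using slice_borel[OF assms] by simp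
qed

text \<open>
  The preimage is taken in the closure of \<open>D\<close>, while the level of the image point is determined by the
  intersection of \<open>D\<close> itself with the element of the partition.
\<close>

lemma tower_vimage_slice:
  assumes "D \<in> tower_sets T \<xi>"
  shows "(D, x) \<in> tower_vimage T \<xi> A \<longleftrightarrow>
    x \<in> closure D \<and> (\<exists>W\<in>\<xi>. x \<in> interior W \<and> (T ` (D \<inter> W), T x) \<in> A)"
proof
  assume "(D, x) \<in> tower_vimage T \<xi> A"
  then have x: "x \<in> closure D" "x \<notin> endpoints T \<xi> 1" "(T ` (D \<inter> elem_of \<xi> x), T x) \<in> A"
    by (auto simp: tower_vimage_def tower_def tower_map_def)
  then have "x \<in> unit_M" using closure_tower_set_subset[OF assms] by blast
  then obtain W where W: "W \<in> \<xi>" "x \<in> W" using ex_piece by blast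
  then show "x \<in> closure D \<and> (\<exists>W\<in>\<xi>. x \<in> interior W \<and> (T ` (D \<inter> W), T x) \<in> A)"
    using x interior_if_not_endpoint[OF W x(2)] elem_of_eq[OF W] by auto
next
  assume "x \<in> closure D \<and> (\<exists>W\<in>\<xi>. x \<in> interior W \<and> (T ` (D \<inter> W), T x) \<in> A)"
  then obtain W where W: "x \<in> closure D" "W \<in> \<xi>" "x \<in> interior W" "(T ` (D \<inter> W), T x) \<in> A" by blast
  have "x \<in> W" using W(3) interior_subset by blast
  then show "(D, x) \<in> tower_vimage T \<xi> A"
    using W assms interior_not_endpoint[OF W(2,3)] elem_of_eq[OF W(2)]
    by (simp add: tower_vimage_def tower_def tower_map_def)
qed

lemma tower_vimage_measurable:
  assumes A: "A \<in> sets (tower_borel T \<xi>)"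
  shows "tower_vimage T \<xi> A \<in> sets (tower_borel T \<xi>)"
  unfolding sets_tower_borel_iff
proof (intro conjI ballI)
  show "tower_vimage T \<xi> A \<subseteq> tower T \<xi>" by (auto simp: tower_vimage_def)
  fix D assume D: "D \<in> tower_sets T \<xi>"
  define P where "P W = {x \<in> interior W. (T ` (D \<inter> W), T x) \<in> A}" for W
  have P: "P W \<in> sets borel" if W: "W \<in> \<xi>" for W
  proof -
    define G where "G = (\<lambda>x. if x \<in> interior W then T x else 0)"
    have "G \<in> borel_measurable borel"
      unfolding G_def by (rule borel_measurable_continuous_on_if) (use T_C1(3)[OF W] in auto)
    then have "G -` {y. (T ` (D \<inter> W), y) \<in> A} \<inter> space borel \<in> sets borel"
      using slice_borel[OF A] by (rule measurable_sets)
    then have "interior W \<inter> G -` {y. (T ` (D \<inter> W), y) \<in> A} \<in> sets borel"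
      by (intro sets.Int) auto
    moreover have "P W = interior W \<inter> G -` {y. (T ` (D \<inter> W), y) \<in> A}"
      by (auto simp: P_def G_def)
    ultimately show ?thesis by simp
  qed
  have "{x. (D, x) \<in> tower_vimage T \<xi> A} = closure D \<inter> (\<Union>W\<in>\<xi>. P W)"
    unfolding tower_vimage_slice[OF D] P_def by blast
  also have "\<dots> \<in> sets borel"
    using P countable_pieces by (intro sets.Int sets.countable_UN'') (auto simp: closure_borel)
  finally show "{x. (D, x) \<in> tower_vimage T \<xi> A} \<in> sets borel" .
qed

lemma mbar_n_0:
  assumes "A \<in> sets (tower_borel T \<xi>)"
  shows "mbar_n T \<xi> 0 A = emeasure lborel {x. (unit_M, x) \<in> A}"
proof -
  have sub: "A \<subseteq> tower T \<xi>" using assms sets_tower_borel_iff by blast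
  define X where "X D = emeasure lborel (snd ` (A \<inter> tower_copy unit_M \<inter> tower_copy D))" for D
  have "snd ` (A \<inter> tower_copy unit_M \<inter> tower_copy unit_M) = {x. (unit_M, x) \<in> A}"
  proof -
    have "x \<in> unit_M" if "(unit_M, x) \<in> A" for x using that sub by (auto simp: tower_def)
    then show ?thesis unfolding tower_copy_def by (force simp del: atLeastAtMost_iff)
  qed
  then have XM: "X unit_M = emeasure lborel {x. (unit_M, x) \<in> A}" by (simp only: X_def)
  have "X D = 0" if "D \<noteq> unit_M" for D
  proof -
    have "tower_copy unit_M \<inter> tower_copy D = {}" using that by (auto simp: tower_copy_def)
    then have "A \<inter> tower_copy unit_M \<inter> tower_copy D = {}" by blast
    then show ?thesis by (simp add: X_def)
  qed
  then have "(\<Sum>\<^sub>\<infinity>D\<in>tower_sets T \<xi>. X D) = (\<Sum>\<^sub>\<infinity>D\<in>{unit_M}. X D)"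
    using unit_in_tower_sets by (intro infsum_cong_neutral) auto
  also have "\<dots> = X unit_M" by simp
  finally show ?thesis unfolding mbar_n_def mbar_def X_def[symmetric] XM[symmetric] by (simp add: X_def)
qed

lemma mbar_n_Suc: "mbar_n T \<xi> (Suc k) A = mbar_n T \<xi> k (tower_vimage T \<xi> A)"
  unfolding mbar_n_def funpow_Suc_right by simp

end

section \<open>Densities of the iterated Lebesgue measures\<close>

lemma nn_integral_count_space_single:
  assumes "a \<in> A" "\<And>x. x \<in> A \<Longrightarrow> x \<noteq> a \<Longrightarrow> f x = (0::ennreal)"
  shows "(\<integral>\<^sup>+x. f x \<partial>count_space A) = f a"
  using nn_integral_count_space'[of "{a}" A f] assms by simp

lemma borel_measurable_nn_integral_count_space:
  fixes f :: "'i \<Rightarrow> 'a \<Rightarrow> ennreal"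
  assumes "countable I" "\<And>i. i \<in> I \<Longrightarrow> f i \<in> borel_measurable M"
  shows "(\<lambda>x. \<integral>\<^sup>+i. f i x \<partial>count_space I) \<in> borel_measurable M"
proof -
  interpret sigma_finite_measure "count_space I" using assms(1) by (rule sigma_finite_measure_count_space_countable)
  have "(\<lambda>(i, x). f i x) \<in> borel_measurable (count_space I \<Otimes>\<^sub>M M)"
    using assms by (intro measurable_pair_measure_countable1) auto
  then have "(\<lambda>(x, i). f i x) \<in> borel_measurable (M \<Otimes>\<^sub>M count_space I)"
    using measurable_pair_swap by fastforce
  then show ?thesis by (rule borel_measurable_nn_integral)
qed

lemma log_regular_nn_integral_count_space:
  assumes "\<And>i. i \<in> I \<Longrightarrow> log_regular d L E (f i)"
  shows "log_regular d L E (\<lambda>x. \<integral>\<^sup>+i. f i x \<partial>count_space I)"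
  unfolding log_regular_def
proof (intro ballI)
  fix x y assume "x \<in> E" "y \<in> E"
  then have "(\<integral>\<^sup>+i. f i x \<partial>count_space I) \<le> (\<integral>\<^sup>+i. ennreal (exp (L * d x y)) * f i y \<partial>count_space I)"
    using assms unfolding log_regular_def by (intro nn_integral_mono) simp
  also have "\<dots> = ennreal (exp (L * d x y)) * (\<integral>\<^sup>+i. f i y \<partial>count_space I)"
    by (rule nn_integral_cmult) simp
  finally show "(\<integral>\<^sup>+i. f i x \<partial>count_space I) \<le> ennreal (exp (L * d x y)) * (\<integral>\<^sup>+i. f i y \<partial>count_space I)" .
qed

lemma log_regular_sum:
  assumes "\<And>i. i \<in> I \<Longrightarrow> log_regular d L E (f i)"
  shows "log_regular d L E (\<lambda>x. \<Sum>i\<in>I. f i x)"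
  using assms unfolding log_regular_def by (auto simp: sum_distrib_left intro!: sum_mono)

lemma log_regular_mult_const:
  assumes "log_regular d L E f"
  shows "log_regular d L E (\<lambda>x. f x * c)"
  using assms unfolding log_regular_def by (auto simp flip: mult.assoc intro!: mult_right_mono)

context expanding_interval_map
begin

text \<open>
  The inverse of the branch of \<open>T\<close> on the interior of \<open>W\<close>, set to \<open>0\<close> off the image of this interior to make it
  Borel measurable on the whole line.
\<close>

definition piece_inv :: "real set \<Rightarrow> real \<Rightarrow> real" where
  "piece_inv W y = (if y \<in> T ` interior W then the_inv_into (interior W) T y else 0)"

text \<open>
  The derivative of \<open>T\<close> at the preimage of \<open>y\<close> in the interior of \<open>W\<close>, with the same default value.
\<close>

definition piece_deriv :: "real set \<Rightarrow> real \<Rightarrow> real" where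
  "piece_deriv W y = (if y \<in> T ` interior W then deriv T (the_inv_into (interior W) T y) else 0)"

lemma piece_inv_T:
  assumes "W \<in> \<xi>" "x \<in> interior W"
  shows "piece_inv W (T x) = x" "piece_deriv W (T x) = deriv T x"
  using assms inj_on_piece[OF assms(1)] by (auto simp: piece_inv_def piece_deriv_def the_inv_into_f_f)

lemma measurable_piece_inv:
  assumes W: "W \<in> \<xi>"
  shows "piece_inv W \<in> borel_measurable borel" "piece_deriv W \<in> borel_measurable borel"
proof -
  have op: "open (T ` interior W)" using open_image_piece[OF W open_interior order_refl] .
  have cont: "continuous_on (T ` interior W) (the_inv_into (interior W) T)"
  proof (rule continuous_on_inverse_open_map[OF T_C1(3)[OF W] refl])
    show "the_inv_into (interior W) T (T x) = x" if "x \<in> interior W" for x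
      using inj_on_piece[OF W] that by (rule the_inv_into_f_f)
    fix U assume "openin (top_of_set (interior W)) U"
    then have U: "open U" "U \<subseteq> interior W" using openin_open_eq[OF open_interior] by auto
    then have "open (T ` U)" using open_image_piece[OF W] by blast
    then show "openin (top_of_set (T ` interior W)) (T ` U)"
      using U openin_open_eq[OF op] by blast
  qed
  have "the_inv_into (interior W) T ` T ` interior W = interior W"
    using the_inv_into_onto[OF inj_on_piece[OF W]] .
  then have "continuous_on (T ` interior W) (\<lambda>y. deriv T (the_inv_into (interior W) T y))"
    using T_C1(2)[OF W] by (intro continuous_on_compose2[OF T_C1(2)[OF W] cont]) auto
  then show "piece_deriv W \<in> borel_measurable borel"
    unfolding piece_deriv_def[abs_def] using op by (intro borel_measurable_continuous_on_if) auto
  show "piece_inv W \<in> borel_measurable borel"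
    unfolding piece_inv_def[abs_def] using op cont by (intro borel_measurable_continuous_on_if) auto
qed

text \<open>
  The constant of regularity \<open>CJ / (1 / \<gamma> - 1)\<close>, the fixed point of the map \<open>L \<mapsto> (L + CJ) * \<gamma>\<close>.
\<close>

definition dist_const :: real where "dist_const = CJ * \<gamma> / (1 - \<gamma>)"

lemma dist_const_nonneg: "0 \<le> dist_const"
  unfolding dist_const_def using CJ_pos gamma_pos gamma by simp

lemma dist_const_step: "(dist_const + CJ) * \<gamma> = dist_const"
  unfolding dist_const_def using gamma by (simp add: field_simps)

text \<open>
  The contribution of the element \<open>W\<close> to the transfer operator applied to a density \<open>f\<close> on the interior of \<open>D\<close>.
\<close>

definition branch_density :: "(real \<Rightarrow> ennreal) \<Rightarrow> real set \<Rightarrow> real set \<Rightarrow> real \<Rightarrow> ennreal" where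
  "branch_density f D W y =
     f (piece_inv W y) * ennreal (1 / \<bar>piece_deriv W y\<bar>) * indicator (T ` (interior D \<inter> interior W)) y"

lemma measurable_branch_density:
  assumes W: "W \<in> \<xi>" and f[measurable]: "f \<in> borel_measurable borel"
  shows "branch_density f D W \<in> borel_measurable borel"
proof -
  note [measurable] = measurable_piece_inv[OF W]
  have "open (T ` (interior D \<inter> interior W))" by (rule open_image_piece[OF W]) auto
  then have [measurable]: "T ` (interior D \<inter> interior W) \<in> sets borel" by simp
  show ?thesis unfolding branch_density_def[abs_def] by measurable
qed

text \<open>
  The branch density is the density of the image under \<open>T\<close> of the measure with density \<open>f\<close>
  on the interior of \<open>D \<inter> W\<close>.
\<close>

lemma nn_integral_branch_density:
  assumes W: "W \<in> \<xi>" and f[measurable]: "f \<in> borel_measurable borel" and g[measurable]: "g \<in> borel_measurable borel"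
  shows "(\<integral>\<^sup>+y. branch_density f D W y * g y \<partial>lborel)
       = (\<integral>\<^sup>+x. f x * indicator (interior D \<inter> interior W) x * g (T x) \<partial>lborel)"
proof -
  note [measurable] = measurable_piece_inv[OF W]
  define U where "U = interior D \<inter> interior W"
  have U: "open U" "U \<subseteq> interior W" by (auto simp: U_def)
  have "(\<integral>\<^sup>+y. branch_density f D W y * g y \<partial>lborel)
     = (\<integral>\<^sup>+y. (f (piece_inv W y) * ennreal (1 / \<bar>piece_deriv W y\<bar>) * g y) * indicator (T ` U) y \<partial>lborel)"
    by (intro nn_integral_cong) (simp add: branch_density_def U_def mult_ac)
  also have "\<dots> = (\<integral>\<^sup>+x. f (piece_inv W (T x)) * ennreal (1 / \<bar>piece_deriv W (T x)\<bar>) * g (T x)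
      * ennreal \<bar>deriv T x\<bar> * indicator U x \<partial>lborel)"
  proof (rule nn_integral_change_of_variables_1[OF U(1)])
    show "(T has_real_derivative deriv T x) (at x)" if "x \<in> U" for x using T_C1(1)[OF W] U that by blast
    show "continuous_on U (deriv T)" using T_C1(2)[OF W] U(2) by (rule continuous_on_subset)
    show "inj_on T U" using inj_on_piece[OF W] U(2) by (rule inj_on_subset)
    have "U \<subseteq> unit_M" using U(2) interior_subset piece_subset[OF W] by blast
    then have "T ` U \<subseteq> unit_M" using T_in by blast
    then show "bounded (T ` U)" by (rule bounded_subset[rotated]) simp
  qed measurable
  also have "\<dots> = (\<integral>\<^sup>+x. f x * indicator U x * g (T x) \<partial>lborel)"
  proof (intro nn_integral_cong)
    fix x
    show "f (piece_inv W (T x)) * ennreal (1 / \<bar>piece_deriv W (T x)\<bar>) * g (T x) * ennreal \<bar>deriv T x\<bar> * indicator U x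
        = f x * indicator U x * g (T x)"
    proof (cases "x \<in> U")
      case True
      then have x: "x \<in> interior W" using U by blast
      have "ennreal (1 / \<bar>deriv T x\<bar>) * ennreal \<bar>deriv T x\<bar> = 1"
        using deriv_nonzero[OF W x] by (simp flip: ennreal_mult)
      then have "f x * g (T x) * (ennreal (1 / \<bar>deriv T x\<bar>) * ennreal \<bar>deriv T x\<bar>) = f x * g (T x)" by simp
      then show ?thesis using True by (simp add: piece_inv_T[OF W x] mult_ac)
    qed simp
  qed
  finally show ?thesis unfolding U_def .
qed

end

context hofbauer_tower
begin

text \<open>
  The points of a level at which regularity of densities is controlled. Interior points only: an
  endpoint of \<open>T ` (D \<inter> W)\<close> need not be the image of an interior point of \<open>D \<inter> W\<close>.
\<close>

definition regular_part :: "real set \<Rightarrow> real set" where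
  "regular_part D = interior D \<inter> generic"

text \<open>
  The gain of a factor \<open>\<gamma>\<close> in the separation metric absorbs the distortion of the derivative.
\<close>

lemma log_regular_branch_density:
  assumes D: "D \<in> tower_sets T \<xi>" and W: "W \<in> \<xi>"
    and f: "log_regular sep_dist dist_const (regular_part D) f"
  shows "log_regular sep_dist dist_const (regular_part (T ` (D \<inter> W))) (branch_density f D W)"
  unfolding log_regular_def
proof (intro ballI)
  fix u v assume uv: "u \<in> regular_part (T ` (D \<inter> W))" "v \<in> regular_part (T ` (D \<inter> W))"
  show "branch_density f D W u \<le> ennreal (exp (dist_const * sep_dist u v)) * branch_density f D W v"
  proof (cases "u \<in> T ` (interior D \<inter> interior W)")
    case True
    then obtain x where x: "u = T x" "x \<in> interior D" "x \<in> interior W" by blast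
    then have "interior (T ` (D \<inter> W)) = T ` (interior D \<inter> interior W)"
      using interior_image_Int_piece(2)[OF D W] by blast
    then obtain y where y: "v = T y" "y \<in> interior D" "y \<in> interior W"
      using uv(2) unfolding regular_part_def by blast
    have g: "x \<in> generic" "y \<in> generic"
      using uv generic_T_iff[OF W x(3)] generic_T_iff[OF W y(3)] x(1) y(1) by (auto simp: regular_part_def)
    have "x \<in> regular_part D" "y \<in> regular_part D" using x y g by (auto simp: regular_part_def)
    then have fle: "f x \<le> ennreal (exp (dist_const * sep_dist x y)) * f y"
      using f unfolding log_regular_def by blast
    have nz: "0 < \<bar>deriv T x\<bar>" "0 < \<bar>deriv T y\<bar>" using deriv_nonzero[OF W] x y by auto
    have "ln \<bar>deriv T y\<bar> - ln \<bar>deriv T x\<bar> \<le> CJ * sep_dist x y"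
      using log_deriv_distortion[OF W x(3) g(1) y(3) g(2)] by linarith
    then have "ln (1 / \<bar>deriv T x\<bar>) \<le> ln (exp (CJ * sep_dist x y) * (1 / \<bar>deriv T y\<bar>))"
      using nz by (simp add: ln_mult ln_div)
    then have dle: "1 / \<bar>deriv T x\<bar> \<le> exp (CJ * sep_dist x y) * (1 / \<bar>deriv T y\<bar>)"
      using nz by (subst (asm) ln_le_cancel_iff) auto
    have "(dist_const + CJ) * sep_dist x y \<le> (dist_const + CJ) * (\<gamma> * sep_dist u v)"
      using sep_dist_contract[OF W x(3) y(3) g] dist_const_nonneg CJ_pos
      unfolding x(1) y(1) by (intro mult_left_mono) auto
    also have "\<dots> = dist_const * sep_dist u v" using dist_const_step by (simp add: mult.assoc[symmetric])
    finally have ex: "exp (dist_const * sep_dist x y) * exp (CJ * sep_dist x y) \<le> exp (dist_const * sep_dist u v)"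
      by (simp add: exp_add[symmetric] distrib_right)
    have "branch_density f D W u = f x * ennreal (1 / \<bar>deriv T x\<bar>)"
      using x by (simp add: branch_density_def piece_inv_T[OF W])
    also have "\<dots> \<le> (ennreal (exp (dist_const * sep_dist x y)) * f y)
        * (ennreal (exp (CJ * sep_dist x y)) * ennreal (1 / \<bar>deriv T y\<bar>))"
      using dle by (intro mult_mono fle) (auto simp flip: ennreal_mult' intro!: ennreal_leI)
    also have "\<dots> = ennreal (exp (dist_const * sep_dist x y) * exp (CJ * sep_dist x y))
        * (f y * ennreal (1 / \<bar>deriv T y\<bar>))" by (simp add: ennreal_mult mult_ac)
    also have "\<dots> \<le> ennreal (exp (dist_const * sep_dist u v)) * (f y * ennreal (1 / \<bar>deriv T y\<bar>))"
      by (intro mult_right_mono ennreal_leI ex) simp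
    also have "f y * ennreal (1 / \<bar>deriv T y\<bar>) = branch_density f D W v"
      using y by (simp add: branch_density_def piece_inv_T[OF W])
    finally show ?thesis .
  qed (simp add: branch_density_def)
qed

text \<open>
  The measure of \<open>A\<close> when the level \<open>D\<close> carries the density \<open>h D\<close> on its interior. The second
  argument of \<open>indicator A (D, x)\<close> is the point and the first its level.
\<close>

definition tower_density :: "(real set \<Rightarrow> real \<Rightarrow> ennreal) \<Rightarrow> (real set \<times> real) set \<Rightarrow> ennreal" where
  "tower_density h A = (\<integral>\<^sup>+D. (\<integral>\<^sup>+x. h D x * indicator (interior D) x * indicator A (D, x) \<partial>lborel)
      \<partial>count_space (tower_sets T \<xi>))"

text \<open>
  The transfer operator of the tower map: the level \<open>D'\<close> receives a contribution from every pair of a level \<open>D\<close>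
  and an element \<open>W\<close> with \<open>T ` (D \<inter> W) = D'\<close>.
\<close>

definition tower_transfer :: "(real set \<Rightarrow> real \<Rightarrow> ennreal) \<Rightarrow> real set \<Rightarrow> real \<Rightarrow> ennreal" where
  "tower_transfer h D' y = (\<integral>\<^sup>+D. \<integral>\<^sup>+W.
      (if T ` (D \<inter> W) = D' then branch_density (h D) D W y else 0) \<partial>count_space \<xi> \<partial>count_space (tower_sets T \<xi>))"

text \<open>
  A Borel measurable density on each level, regular on its regular part with constant \<open>dist_const\<close>.
\<close>

definition regular_family :: "(real set \<Rightarrow> real \<Rightarrow> ennreal) \<Rightarrow> bool" where
  "regular_family h \<longleftrightarrow> (\<forall>D\<in>tower_sets T \<xi>. h D \<in> borel_measurable borel \<and>
      log_regular sep_dist dist_const (regular_part D) (h D))"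

lemma regular_family_transfer:
  assumes h: "regular_family h"
  shows "regular_family (tower_transfer h)"
  unfolding regular_family_def
proof (intro ballI conjI)
  fix D' assume "D' \<in> tower_sets T \<xi>"
  show "tower_transfer h D' \<in> borel_measurable borel"
    unfolding tower_transfer_def[abs_def]
    by (intro borel_measurable_nn_integral_count_space countable_tower_sets countable_pieces)
      (use h in \<open>auto simp: regular_family_def intro!: measurable_branch_density measurable_If\<close>)
  show "log_regular sep_dist dist_const (regular_part D') (tower_transfer h D')"
    unfolding tower_transfer_def[abs_def]
  proof (intro log_regular_nn_integral_count_space)
    fix D W assume DW: "D \<in> tower_sets T \<xi>" "W \<in> \<xi>"
    show "log_regular sep_dist dist_const (regular_part D')
       (\<lambda>x. if T ` (D \<inter> W) = D' then branch_density (h D) D W x else 0)"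
    proof (cases "T ` (D \<inter> W) = D'")
      case True
      then show ?thesis using log_regular_branch_density[OF DW, of "h D"] h DW by (simp add: regular_family_def)
    qed (simp add: log_regular_def)
  qed
qed

text \<open>
  The transfer operator describes the image measure under the tower map. All sums are over countable
  sets with nonnegative terms, so they may be interchanged with the integrals.
\<close>

lemma tower_density_transfer:
  assumes h: "regular_family h" and A: "A \<in> sets (tower_borel T \<xi>)"
  shows "tower_density (tower_transfer h) A = tower_density h (tower_vimage T \<xi> A)"
proof -
  let ?TS = "tower_sets T \<xi>"
  have hm: "h D \<in> borel_measurable borel" if "D \<in> ?TS" for D using h that by (simp add: regular_family_def)
  note cnt = countable_tower_sets countable_pieces
  define G where "G D' y = indicator (interior D') y * (indicator A (D', y) :: ennreal)" for D' y
  have G[measurable]: "G D' \<in> borel_measurable borel" for D'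
    unfolding G_def[abs_def] using A by measurable
  define b where "b D' D W y = (if T ` (D \<inter> W) = D' then branch_density (h D) D W y * G D' y else 0)" for D' D W y
  have b: "b D' D W \<in> borel_measurable borel" if "D \<in> ?TS" "W \<in> \<xi>" for D' D W
    unfolding b_def[abs_def] using measurable_branch_density[OF that(2) hm[OF that(1)]] by auto
  have "tower_density (tower_transfer h) A
      = (\<integral>\<^sup>+D'. \<integral>\<^sup>+y. tower_transfer h D' y * G D' y \<partial>lborel \<partial>count_space ?TS)"
    unfolding tower_density_def G_def by (simp add: mult.assoc)
  also have "\<dots> = (\<integral>\<^sup>+D'. \<integral>\<^sup>+y. \<integral>\<^sup>+D. \<integral>\<^sup>+W. b D' D W y \<partial>count_space \<xi> \<partial>count_space ?TS \<partial>lborel \<partial>count_space ?TS)"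
    unfolding tower_transfer_def b_def
    by (intro nn_integral_cong) (auto simp: nn_integral_multc[symmetric] intro!: nn_integral_cong)
  also have "\<dots> = (\<integral>\<^sup>+D'. \<integral>\<^sup>+D. \<integral>\<^sup>+W. \<integral>\<^sup>+y. b D' D W y \<partial>lborel \<partial>count_space \<xi> \<partial>count_space ?TS \<partial>count_space ?TS)"
  proof (intro nn_integral_cong)
    fix D'
    have "(\<integral>\<^sup>+y. \<integral>\<^sup>+D. \<integral>\<^sup>+W. b D' D W y \<partial>count_space \<xi> \<partial>count_space ?TS \<partial>lborel)
        = (\<integral>\<^sup>+D. \<integral>\<^sup>+y. \<integral>\<^sup>+W. b D' D W y \<partial>count_space \<xi> \<partial>lborel \<partial>count_space ?TS)"
      by (intro nn_integral_count_space_nn_integral cnt) (auto intro!: borel_measurable_nn_integral_count_space cnt b)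
    also have "\<dots> = (\<integral>\<^sup>+D. \<integral>\<^sup>+W. \<integral>\<^sup>+y. b D' D W y \<partial>lborel \<partial>count_space \<xi> \<partial>count_space ?TS)"
      by (intro nn_integral_cong nn_integral_count_space_nn_integral cnt) (auto intro!: b)
    finally show "(\<integral>\<^sup>+y. \<integral>\<^sup>+D. \<integral>\<^sup>+W. b D' D W y \<partial>count_space \<xi> \<partial>count_space ?TS \<partial>lborel) = \<dots>" .
  qed
  also have "\<dots> = (\<integral>\<^sup>+D. \<integral>\<^sup>+D'. \<integral>\<^sup>+W. \<integral>\<^sup>+y. b D' D W y \<partial>lborel \<partial>count_space \<xi> \<partial>count_space ?TS \<partial>count_space ?TS)"
    by (intro nn_integral_count_space_nn_integral cnt) simp
  also have "\<dots> = (\<integral>\<^sup>+D. \<integral>\<^sup>+W. \<integral>\<^sup>+D'. \<integral>\<^sup>+y. b D' D W y \<partial>lborel \<partial>count_space ?TS \<partial>count_space \<xi> \<partial>count_space ?TS)"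
    by (intro nn_integral_cong nn_integral_count_space_nn_integral cnt) simp
  also have "\<dots> = (\<integral>\<^sup>+D. \<integral>\<^sup>+W. \<integral>\<^sup>+x. h D x * indicator (interior D \<inter> interior W) x * indicator A (T ` (D \<inter> W), T x)
      \<partial>lborel \<partial>count_space \<xi> \<partial>count_space ?TS)"
  proof (intro nn_integral_cong)
    fix D W assume "D \<in> space (count_space ?TS)" "W \<in> space (count_space \<xi>)"
    then have D: "D \<in> ?TS" and W: "W \<in> \<xi>" by auto
    \<comment> \<open>For fixed \<open>D\<close> and \<open>W\<close> only the level \<open>T ` (D \<inter> W)\<close> contributes.\<close>
    show "(\<integral>\<^sup>+D'. \<integral>\<^sup>+y. b D' D W y \<partial>lborel \<partial>count_space ?TS)
       = (\<integral>\<^sup>+x. h D x * indicator (interior D \<inter> interior W) x * indicator A (T ` (D \<inter> W), T x) \<partial>lborel)"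
    proof (cases "interior D \<inter> interior W = {}")
      case True
      have "b D' D W y = 0" for D' y by (simp add: b_def branch_density_def True)
      then show ?thesis by (simp add: True)
    next
      case False
      note D' = interior_image_Int_piece[OF D W False]
      have "(\<integral>\<^sup>+D'. \<integral>\<^sup>+y. b D' D W y \<partial>lborel \<partial>count_space ?TS) = (\<integral>\<^sup>+y. b (T ` (D \<inter> W)) D W y \<partial>lborel)"
      proof (rule nn_integral_count_space_single[OF D'(1)])
        fix D' assume "D' \<noteq> T ` (D \<inter> W)"
        then have "b D' D W y = 0" for y unfolding b_def by (metis)
        then show "(\<integral>\<^sup>+y. b D' D W y \<partial>lborel) = 0" by simp
      qed
      also have "\<dots> = (\<integral>\<^sup>+y. branch_density (h D) D W y * G (T ` (D \<inter> W)) y \<partial>lborel)"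
        by (simp add: b_def)
      also have "\<dots> = (\<integral>\<^sup>+x. h D x * indicator (interior D \<inter> interior W) x * G (T ` (D \<inter> W)) (T x) \<partial>lborel)"
        by (rule nn_integral_branch_density[OF W hm[OF D] G])
      also have "\<dots> = (\<integral>\<^sup>+x. h D x * indicator (interior D \<inter> interior W) x * indicator A (T ` (D \<inter> W), T x) \<partial>lborel)"
        by (intro nn_integral_cong) (auto simp: G_def D'(2) split: split_indicator)
      finally show ?thesis .
    qed
  qed
  also have "\<dots> = (\<integral>\<^sup>+D. \<integral>\<^sup>+x. h D x * indicator (interior D) x * indicator (tower_vimage T \<xi> A) (D, x)
      \<partial>lborel \<partial>count_space ?TS)"
  proof (intro nn_integral_cong)
    fix D assume "D \<in> space (count_space ?TS)"
    then have D: "D \<in> ?TS" by simp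
    define c where "c W x = h D x * indicator (interior D \<inter> interior W) x * indicator A (T ` (D \<inter> W), T x)" for W x
    have c: "c W \<in> borel_measurable borel" if W: "W \<in> \<xi>" for W
    proof -
      note [measurable] = hm[OF D] measurable_slice_indicator[OF A]
      define T0 where "T0 x = (if x \<in> interior W then T x else 0)" for x
      have [measurable]: "T0 \<in> borel_measurable borel" unfolding T0_def[abs_def]
        by (rule borel_measurable_continuous_on_if) (use T_C1(3)[OF W] in auto)
      have c_eq: "c W = (\<lambda>x. h D x * indicator (interior D \<inter> interior W) x * indicator A (T ` (D \<inter> W), T0 x))"
        by (auto simp: c_def T0_def split: split_indicator)
      have ind: "(\<lambda>x. indicator A (T ` (D \<inter> W), T0 x) :: ennreal) \<in> borel_measurable borel"
        by (rule measurable_compose[OF _ measurable_slice_indicator[OF A]]) measurable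
      have "(\<lambda>x. h D x * indicator (interior D \<inter> interior W) x * indicator A (T ` (D \<inter> W), T0 x))
          \<in> borel_measurable borel"
        by (intro borel_measurable_times_ennreal borel_measurable_indicator hm[OF D] ind) auto
      then show ?thesis unfolding c_eq .
    qed
    have "(\<integral>\<^sup>+W. \<integral>\<^sup>+x. c W x \<partial>lborel \<partial>count_space \<xi>) = (\<integral>\<^sup>+x. \<integral>\<^sup>+W. c W x \<partial>count_space \<xi> \<partial>lborel)"
      by (rule nn_integral_count_space_nn_integral[symmetric]) (auto intro: cnt c)
    also have "\<dots> = (\<integral>\<^sup>+x. h D x * indicator (interior D) x * indicator (tower_vimage T \<xi> A) (D, x) \<partial>lborel)"
    proof (intro nn_integral_cong)
      fix x
      show "(\<integral>\<^sup>+W. c W x \<partial>count_space \<xi>) = h D x * indicator (interior D) x * indicator (tower_vimage T \<xi> A) (D, x)"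
      proof (cases "x \<in> interior D \<and> (\<exists>W\<in>\<xi>. x \<in> interior W)")
        case True
        then obtain W where W: "W \<in> \<xi>" "x \<in> interior W" and xD: "x \<in> interior D" by blast
        have uni: "x \<notin> interior W'" if "W' \<in> \<xi>" "W' \<noteq> W" for W'
          using piece_unique[OF W(1) that(1)] that(2) W(2) interior_subset by blast
        have "(\<integral>\<^sup>+W. c W x \<partial>count_space \<xi>) = c W x"
          by (rule nn_integral_count_space_single[OF W(1)]) (simp add: c_def uni)
        moreover have "x \<in> closure D" using xD interior_subset closure_subset by blast
        then have "(D, x) \<in> tower_vimage T \<xi> A \<longleftrightarrow> (T ` (D \<inter> W), T x) \<in> A"
          unfolding tower_vimage_slice[OF D] using W uni by blast
        ultimately show ?thesis using W xD by (simp add: c_def indicator_def)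
      next
        case False
        have "c W x = 0" if "W \<in> \<xi>" for W using False that by (auto simp: c_def split: split_indicator)
        then have "(\<integral>\<^sup>+W. c W x \<partial>count_space \<xi>) = (\<integral>\<^sup>+W. 0 \<partial>count_space \<xi>)" by (intro nn_integral_cong) simp
        moreover have "indicator (interior D) x * indicator (tower_vimage T \<xi> A) (D, x) = (0::ennreal)"
          using False tower_vimage_slice[OF D, of x A] by (auto split: split_indicator)
        ultimately show ?thesis by (simp add: mult.assoc)
      qed
    qed
    finally show "(\<integral>\<^sup>+W. \<integral>\<^sup>+x. h D x * indicator (interior D \<inter> interior W) x * indicator A (T ` (D \<inter> W), T x)
      \<partial>lborel \<partial>count_space \<xi>) = \<dots>" unfolding c_def .
  qed
  finally show ?thesis unfolding tower_density_def .
qed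

text \<open>
  Initially only the base carries mass, with the constant density \<open>1\<close>.
\<close>

lemma mbar_n_density:
  "\<exists>h. regular_family h \<and> (\<forall>A\<in>sets (tower_borel T \<xi>). mbar_n T \<xi> k A = tower_density h A)"
proof (induction k)
  case 0
  define h where "h D x = (if D = unit_M then 1 else 0 :: ennreal)" for D :: "real set" and x :: real
  have "regular_family h"
    unfolding regular_family_def
  proof (intro ballI conjI)
    fix D
    show "h D \<in> borel_measurable borel" by (simp add: h_def[abs_def])
    have "(1::ennreal) \<le> ennreal (exp (dist_const * sep_dist x y))" for x y
      using dist_const_nonneg sep_dist_nonneg[of x y] by simp
    then show "log_regular sep_dist dist_const (regular_part D) (h D)"
      unfolding log_regular_def by (auto simp: h_def)
  qed
  moreover have "mbar_n T \<xi> 0 A = tower_density h A" if A: "A \<in> sets (tower_borel T \<xi>)" for A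
  proof -
    have [measurable]: "{x. (unit_M, x) \<in> A} \<in> sets borel" by (rule slice_borel[OF A])
    have "tower_density h A = (\<integral>\<^sup>+x. h unit_M x * indicator (interior unit_M) x * indicator A (unit_M, x) \<partial>lborel)"
      unfolding tower_density_def
      by (rule nn_integral_count_space_single[OF unit_in_tower_sets]) (simp add: h_def)
    also have "\<dots> = (\<integral>\<^sup>+x. indicator {x. (unit_M, x) \<in> A} x \<partial>lborel)"
    proof (rule nn_integral_cong_AE)
      have "AE x in lborel. x \<noteq> 0 \<and> x \<noteq> (1::real)" using AE_lborel_singleton[of "0::real"] AE_lborel_singleton[of "1::real"] by auto
      then show "AE x in lborel. h unit_M x * indicator (interior unit_M) x * indicator A (unit_M, x)
          = indicator {x. (unit_M, x) \<in> A} x"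
      proof eventually_elim
        case (elim x)
        have "x \<in> unit_M" if "(unit_M, x) \<in> A"
          using that A sets_tower_borel_iff[of A] by (auto simp: tower_def)
        then show ?case using elim by (auto simp: h_def split: split_indicator)
      qed
    qed
    also have "\<dots> = emeasure lborel {x. (unit_M, x) \<in> A}" by simp
    finally show ?thesis using mbar_n_0[OF A] by simp
  qed
  ultimately show ?case by blast
next
  case (Suc k)
  then obtain h where h: "regular_family h" "\<And>A. A \<in> sets (tower_borel T \<xi>) \<Longrightarrow> mbar_n T \<xi> k A = tower_density h A"
    by blast
  have "mbar_n T \<xi> (Suc k) A = tower_density (tower_transfer h) A" if A: "A \<in> sets (tower_borel T \<xi>)" for A
    unfolding mbar_n_Suc tower_density_transfer[OF h(1) A] by (rule h(2)[OF tower_vimage_measurable[OF A]])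
  then show ?case using regular_family_transfer[OF h(1)] by blast
qed

end

section \<open>Averages and their restrictions to the levels\<close>

lemma has_sum_measure_UN:
  assumes "finite_measure M" and I: "countable I" and X: "\<And>i. i \<in> I \<Longrightarrow> X i \<in> sets M"
    and disj: "disjoint_family_on X I"
  shows "((\<lambda>i. measure M (X i)) has_sum measure M (\<Union>i\<in>I. X i)) I"
proof -
  interpret finite_measure M by fact
  define f where "f i = measure M (X i)" for i
  have "(\<integral>\<^sup>+i. ennreal (f i) \<partial>count_space I) = ennreal (measure M (\<Union>i\<in>I. X i))"
    using emeasure_UN_countable[OF X I disj] by (simp add: f_def emeasure_eq_measure)
  then have hb: "has_bochner_integral (count_space I) f (measure M (\<Union>i\<in>I. X i))"
    by (intro has_bochner_integral_nn_integral) (auto simp: f_def)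
  then have abs: "Infinite_Set_Sum.abs_summable_on f I"
    unfolding Infinite_Set_Sum.abs_summable_on_def by (rule integrable.intros)
  then have "infsum f I = infsetsum f I" by (rule infsetsum_infsum[symmetric])
  also have "\<dots> = measure M (\<Union>i\<in>I. X i)"
    unfolding infsetsum_def using hb by (rule has_bochner_integral_integral_eq)
  finally have "infsum f I = measure M (\<Union>i\<in>I. X i)" .
  moreover have "f summable_on I" using abs abs_summable_equivalent[of f I] abs_summable_summable by blast
  ultimately show ?thesis using has_sum_infsum unfolding f_def[abs_def] by fastforce
qed

context hofbauer_tower
begin

lemma measurable_snd_tower: "snd \<in> borel_measurable (tower_borel T \<xi>)"
proof (rule measurableI)
  fix B :: "real set" assume B: "B \<in> sets borel"
  have "{x. (D, x) \<in> snd -` B \<inter> tower T \<xi>} = closure D \<inter> B" if "D \<in> tower_sets T \<xi>" for D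
    using that by (auto simp: tower_def)
  then show "snd -` B \<inter> space (tower_borel T \<xi>) \<in> sets (tower_borel T \<xi>)"
    unfolding sets_tower_borel_iff space_tower_borel using B closure_borel by auto
qed simp

lemma mbar_n_le_1: "A \<in> sets (tower_borel T \<xi>) \<Longrightarrow> mbar_n T \<xi> k A \<le> 1"
proof (induction k arbitrary: A)
  case 0
  have "{x. (unit_M, x) \<in> A} \<subseteq> unit_M"
    using 0 sets_tower_borel_iff[of A] by (auto simp: tower_def)
  then have "emeasure lborel {x. (unit_M, x) \<in> A} \<le> emeasure lborel unit_M" by (intro emeasure_mono) auto
  then show ?case using mbar_n_0[OF 0] by simp
qed (simp add: mbar_n_Suc tower_vimage_measurable)

lemma slice_indicator:
  assumes "D' \<in> tower_sets T \<xi>" "x \<in> interior D'"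
  shows "(indicator ({D} \<times> (closure D \<inter> B)) (D', x) :: ennreal) = (if D' = D then indicator B x else 0)"
proof -
  have "x \<in> closure D'" using assms interior_subset closure_subset by blast
  then show ?thesis by (auto split: split_indicator)
qed

lemma tower_density_slice:
  assumes D: "D \<in> tower_sets T \<xi>"
  shows "tower_density h ({D} \<times> (closure D \<inter> B)) = (\<integral>\<^sup>+x. h D x * indicator (interior D) x * indicator B x \<partial>lborel)"
proof -
  have eq: "h D' x * indicator (interior D') x * indicator ({D} \<times> (closure D \<inter> B)) (D', x)
      = (if D' = D then h D x * indicator (interior D) x * indicator B x else 0)"
    if "D' \<in> tower_sets T \<xi>" for D' x
    using slice_indicator[OF that, of x D B] by (cases "x \<in> interior D'") auto
  have "tower_density h ({D} \<times> (closure D \<inter> B))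
      = (\<integral>\<^sup>+D'. \<integral>\<^sup>+x. (if D' = D then h D x * indicator (interior D) x * indicator B x else 0)
          \<partial>lborel \<partial>count_space (tower_sets T \<xi>))"
    unfolding tower_density_def by (intro nn_integral_cong) (simp add: eq)
  also have "\<dots> = (\<integral>\<^sup>+x. (if D = D then h D x * indicator (interior D) x * indicator B x else 0) \<partial>lborel)"
    by (rule nn_integral_count_space_single[OF D]) simp
  finally show ?thesis by simp
qed

lemma countably_additive_tower_density:
  assumes h: "regular_family h"
  shows "countably_additive (sets (tower_borel T \<xi>)) (tower_density h)"
proof (rule countably_additiveI)
  fix A :: "nat \<Rightarrow> (real set \<times> real) set"
  assume A: "range A \<subseteq> sets (tower_borel T \<xi>)" "disjoint_family A"
  have Ai: "A i \<in> sets (tower_borel T \<xi>)" for i using A(1) by blast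
  have m: "(\<lambda>x. h D x * indicator (interior D) x * indicator (A i) (D, x)) \<in> borel_measurable lborel"
    if "D \<in> tower_sets T \<xi>" for D i
  proof -
    have "h D \<in> borel_measurable borel" using h that by (simp add: regular_family_def)
    then have "(\<lambda>x. h D x * indicator (interior D) x * indicator (A i) (D, x)) \<in> borel_measurable borel"
      by (intro borel_measurable_times_ennreal borel_measurable_indicator measurable_slice_indicator[OF Ai]) auto
    then show ?thesis by simp
  qed
  have "(\<Sum>i. tower_density h (A i)) = (\<integral>\<^sup>+D. (\<Sum>i. \<integral>\<^sup>+x. h D x * indicator (interior D) x * indicator (A i) (D, x) \<partial>lborel)
      \<partial>count_space (tower_sets T \<xi>))"
    unfolding tower_density_def by (rule nn_integral_suminf[symmetric]) simp
  also have "\<dots> = (\<integral>\<^sup>+D. \<integral>\<^sup>+x. (\<Sum>i. h D x * indicator (interior D) x * indicator (A i) (D, x)) \<partial>lborel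
      \<partial>count_space (tower_sets T \<xi>))"
    by (intro nn_integral_cong nn_integral_suminf[symmetric] m) simp
  also have "\<dots> = tower_density h (\<Union>i. A i)"
    unfolding tower_density_def
    by (intro nn_integral_cong) (simp add: ennreal_suminf_cmult suminf_indicator[OF A(2)])
  finally show "(\<Sum>i. tower_density h (A i)) = tower_density h (\<Union>i. A i)" .
qed

lemma sets_mhat: "sets (mhat T \<xi> n) = sets (tower_borel T \<xi>)"
proof -
  have "sets (tower_borel T \<xi>) \<subseteq> Pow (tower T \<xi>)" using sets.space_closed[of "tower_borel T \<xi>"] space_tower_borel by simp
  then show ?thesis
    unfolding mhat_def using sets.sigma_sets_eq[of "tower_borel T \<xi>"] space_tower_borel by auto
qed

text \<open>
  The set function that defines the averages is given by densities, so it is countably additive and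
  coincides with the measure constructed from it.
\<close>

lemma mhat_density:
  assumes "1 \<le> n"
  obtains h where "regular_family h" "\<And>A. A \<in> sets (tower_borel T \<xi>) \<Longrightarrow> emeasure (mhat T \<xi> n) A = tower_density h A"
    "\<And>D. D \<in> tower_sets T \<xi> \<Longrightarrow> (\<integral>\<^sup>+x. h D x * indicator (interior D) x \<partial>lborel) < \<infinity>"
proof -
  have "\<exists>h. \<forall>k. regular_family (h k) \<and> (\<forall>A\<in>sets (tower_borel T \<xi>). mbar_n T \<xi> k A = tower_density (h k) A)"
    by (rule choice) (use mbar_n_density in blast)
  then obtain h where h: "\<And>k. regular_family (h k)"
    "\<And>k A. A \<in> sets (tower_borel T \<xi>) \<Longrightarrow> mbar_n T \<xi> k A = tower_density (h k) A" by blast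
  define c :: ennreal where "c = inverse (of_nat n)"
  define H where "H D x = (\<Sum>k<n. h k D x) * c" for D x
  have hm: "h k D \<in> borel_measurable borel" if "D \<in> tower_sets T \<xi>" for k D
    using h(1)[of k] that by (simp add: regular_family_def)
  have H: "regular_family H"
    unfolding regular_family_def
  proof (intro ballI conjI)
    fix D assume D: "D \<in> tower_sets T \<xi>"
    show "H D \<in> borel_measurable borel"
      unfolding H_def[abs_def] using hm[OF D] by (intro borel_measurable_times_ennreal borel_measurable_sum) auto
    show "log_regular sep_dist dist_const (regular_part D) (H D)"
      unfolding H_def[abs_def] using h(1) D
      by (intro log_regular_mult_const log_regular_sum) (simp add: regular_family_def)
  qed
  define F where "F A = (\<Sum>k<n. mbar_n T \<xi> k A) / of_nat n" for A
  have F: "F A = tower_density H A" if A: "A \<in> sets (tower_borel T \<xi>)" for A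
  proof -
    have m: "(\<lambda>x. h k D x * indicator (interior D) x * indicator A (D, x)) \<in> borel_measurable borel"
      if "D \<in> tower_sets T \<xi>" for k D
      using hm[OF that] by (intro borel_measurable_times_ennreal borel_measurable_indicator measurable_slice_indicator[OF A]) auto
    have "F A = (\<Sum>k<n. tower_density (h k) A) * c"
      by (simp add: F_def c_def divide_ennreal_def h(2)[OF A])
    also have "\<dots> = (\<integral>\<^sup>+D. (\<Sum>k<n. \<integral>\<^sup>+x. h k D x * indicator (interior D) x * indicator A (D, x) \<partial>lborel) * c
        \<partial>count_space (tower_sets T \<xi>))"
      unfolding tower_density_def by (simp add: nn_integral_multc nn_integral_sum)
    also have "\<dots> = (\<integral>\<^sup>+D. \<integral>\<^sup>+x. (\<Sum>k<n. h k D x * indicator (interior D) x * indicator A (D, x)) * c \<partial>lborel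
        \<partial>count_space (tower_sets T \<xi>))"
    proof (intro nn_integral_cong)
      fix D assume "D \<in> space (count_space (tower_sets T \<xi>))"
      then have D: "D \<in> tower_sets T \<xi>" by simp
      have m': "(\<lambda>x. h k D x * indicator (interior D) x * indicator A (D, x)) \<in> borel_measurable lborel" for k
        using m[OF D] by simp
      show "(\<Sum>k<n. \<integral>\<^sup>+x. h k D x * indicator (interior D) x * indicator A (D, x) \<partial>lborel) * c
          = (\<integral>\<^sup>+x. (\<Sum>k<n. h k D x * indicator (interior D) x * indicator A (D, x)) * c \<partial>lborel)"
        by (simp only: nn_integral_multc[OF borel_measurable_sum[OF m']] nn_integral_sum[OF m'])
    qed
    also have "\<dots> = tower_density H A"
      unfolding tower_density_def H_def
      by (intro nn_integral_cong) (simp only: sum_distrib_right[symmetric], simp only: mult_ac)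
    finally show ?thesis .
  qed
  have em: "emeasure (mhat T \<xi> n) A = tower_density H A" if A: "A \<in> sets (tower_borel T \<xi>)" for A
  proof -
    have "emeasure (mhat T \<xi> n) A = F A"
    proof (rule emeasure_measure_of[OF mhat_def[of T \<xi> n, folded F_def]])
      show "sets (tower_borel T \<xi>) \<subseteq> Pow (tower T \<xi>)"
        using sets.space_closed[of "tower_borel T \<xi>"] space_tower_borel by simp
      show "A \<in> sets (mhat T \<xi> n)" using A sets_mhat by simp
      have "F {} = 0" using F[of "{}"] by (simp add: tower_density_def)
      then show "positive (sets (mhat T \<xi> n)) F" by (simp add: positive_def)
      have "countably_additive (sets (tower_borel T \<xi>)) F"
      proof (rule countably_additiveI)
        fix B :: "nat \<Rightarrow> (real set \<times> real) set"
        assume B: "range B \<subseteq> sets (tower_borel T \<xi>)" "disjoint_family B" "(\<Union>i. B i) \<in> sets (tower_borel T \<xi>)"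
        then have "F (B i) = tower_density H (B i)" for i using F by blast
        then show "(\<Sum>i. F (B i)) = F (\<Union>i. B i)"
          using countably_additive_tower_density[OF H] B F[OF B(3)] by (simp add: countably_additive_def)
      qed
      then show "countably_additive (sets (mhat T \<xi> n)) F" by (simp add: sets_mhat)
    qed
    then show ?thesis using F[OF A] by simp
  qed
  have fin: "(\<integral>\<^sup>+x. H D x * indicator (interior D) x \<partial>lborel) < \<infinity>" if D: "D \<in> tower_sets T \<xi>" for D
  proof -
    have s: "{D} \<times> (closure D \<inter> UNIV) \<in> sets (tower_borel T \<xi>)" by (rule slice_in_tower_borel[OF D]) simp
    have "(\<integral>\<^sup>+x. H D x * indicator (interior D) x \<partial>lborel) = F ({D} \<times> (closure D \<inter> UNIV))"
      unfolding F[OF s] tower_density_slice[OF D] by simp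
    also have "\<dots> \<le> (\<Sum>k<n. 1) / of_nat n"
      unfolding F_def by (intro divide_right_mono_ennreal sum_mono mbar_n_le_1[OF s])
    also have "\<dots> < \<infinity>" using assms by (simp add: ennreal_divide_eq_top_iff less_top[symmetric] of_nat_less_top)
    finally show ?thesis .
  qed
  show ?thesis by (rule that[OF H em fin])
qed

text \<open>
  The restriction of a measure on the tower to the level \<open>D\<close>, projected to the line.
\<close>

definition slice_measure :: "(real set \<times> real) measure \<Rightarrow> real set \<Rightarrow> real measure" where
  "slice_measure N D = distr (density N (indicator (tower_copy D))) borel snd"

lemma
  assumes N: "sets N = sets (tower_borel T \<xi>)" and D: "D \<in> tower_sets T \<xi>"
  shows emeasure_slice_measure: "\<And>B. B \<in> sets borel \<Longrightarrow>
      emeasure (slice_measure N D) B = emeasure N ({D} \<times> (closure D \<inter> B))"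
    and integral_slice_measure: "\<And>g :: real \<Rightarrow> real. g \<in> borel_measurable borel \<Longrightarrow>
      integral\<^sup>L (slice_measure N D) g = (\<integral>p. indicator (tower_copy D) p * g (snd p) \<partial>N)"
    and sets_slice_measure: "sets (slice_measure N D) = sets borel"
proof -
  have sp: "space N = tower T \<xi>" using sets_eq_imp_space_eq[OF N] space_tower_borel by simp
  have snd[measurable]: "snd \<in> borel_measurable N"
    using measurable_snd_tower measurable_cong_sets[OF N refl] by blast
  have c[measurable]: "tower_copy D \<in> sets N" using tower_copy_in_tower_borel[OF D] N by simp
  show "sets (slice_measure N D) = sets borel" by (simp add: slice_measure_def)
  show "emeasure (slice_measure N D) B = emeasure N ({D} \<times> (closure D \<inter> B))" if B[measurable]: "B \<in> sets borel" for B
  proof -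
    have s: "snd -` B \<inter> space N \<in> sets N" by measurable
    have "emeasure (slice_measure N D) B = emeasure (density N (indicator (tower_copy D))) (snd -` B \<inter> space N)"
      unfolding slice_measure_def by (subst emeasure_distr) auto
    also have "\<dots> = emeasure N (tower_copy D \<inter> (snd -` B \<inter> space N))"
      using s by (simp add: emeasure_density indicator_inter_arith[symmetric])
    also have "tower_copy D \<inter> (snd -` B \<inter> space N) = {D} \<times> (closure D \<inter> B)"
      unfolding sp using D by (auto simp: tower_copy_def tower_def)
    finally show ?thesis .
  qed
  show "integral\<^sup>L (slice_measure N D) g = (\<integral>p. indicator (tower_copy D) p * g (snd p) \<partial>N)"
    if g[measurable]: "g \<in> borel_measurable borel" for g :: "real \<Rightarrow> real"
  proof -
    have "integral\<^sup>L (slice_measure N D) g = (\<integral>p. g (snd p) \<partial>density N (indicator (tower_copy D)))"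
      unfolding slice_measure_def by (rule integral_distr) auto
    also have "density N (indicator (tower_copy D)) = density N (\<lambda>p. ennreal (indicator (tower_copy D) p))"
      by (simp add: ennreal_indicator)
    also have "(\<integral>p. g (snd p) \<partial>density N (\<lambda>p. ennreal (indicator (tower_copy D) p)))
        = (\<integral>p. indicator (tower_copy D) p * g (snd p) \<partial>N)"
      by (rule integral_real_density) auto
    finally show ?thesis .
  qed
qed

lemma regular_part_borel: "regular_part D \<in> sets borel"
proof -
  have "endpoints_inf T \<xi> \<in> sets borel"
    by (rule sets.countable[OF _ countable_endpoints_inf]) simp
  then show ?thesis unfolding regular_part_def generic_def by (intro sets.Int sets.Diff) auto
qed

lemma countable_Diff_regular_part:
  assumes D: "D \<in> tower_sets T \<xi>" shows "countable (D - regular_part D)"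
proof (rule countable_subset)
  show "D - regular_part D \<subseteq> frontier D \<union> endpoints_inf T \<xi>"
    using closure_subset tower_set_subset[OF D] unfolding regular_part_def frontier_def generic_def by blast
  show "countable (frontier D \<union> endpoints_inf T \<xi>)"
    using countable_endpoints_inf finite_frontier_real_interval[OF is_interval_tower_set[OF D] bounded_tower_set[OF D]]
    by (simp add: countable_finite)
qed

lemma AE_regular_part:
  assumes D: "D \<in> tower_sets T \<xi>" shows "AE x in lborel. x \<in> D \<longrightarrow> x \<in> regular_part D"
proof -
  have "D - regular_part D \<in> null_sets lborel" using countable_Diff_regular_part[OF D] by (rule countable_imp_null_set_lborel)
  then have "AE x in lborel. x \<notin> D - regular_part D" by (rule AE_not_in)
  then show ?thesis by eventually_elim blast
qed

lemma slice_mhat: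
  assumes h: "regular_family h" "\<And>A. A \<in> sets (tower_borel T \<xi>) \<Longrightarrow> emeasure (mhat T \<xi> n) A = tower_density h A"
    and D: "D \<in> tower_sets T \<xi>"
  shows "slice_measure (mhat T \<xi> n) D = density lborel (\<lambda>x. h D x * indicator (regular_part D) x)"
proof (rule measure_eqI)
  note s = sets_slice_measure[OF sets_mhat D]
  show "sets (slice_measure (mhat T \<xi> n) D) = sets (density lborel (\<lambda>x. h D x * indicator (regular_part D) x))"
    by (simp add: s)
  fix B assume "B \<in> sets (slice_measure (mhat T \<xi> n) D)"
  then have B: "B \<in> sets borel" by (simp add: s)
  have m: "(\<lambda>x. h D x * indicator (regular_part D) x) \<in> borel_measurable lborel"
    using h(1) D regular_part_borel by (auto simp: regular_family_def intro!: borel_measurable_times_ennreal)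
  have "emeasure (slice_measure (mhat T \<xi> n) D) B = tower_density h ({D} \<times> (closure D \<inter> B))"
    using emeasure_slice_measure[OF sets_mhat D B] h(2)[OF slice_in_tower_borel[OF D B]] by simp
  also have "\<dots> = (\<integral>\<^sup>+x. h D x * indicator (interior D) x * indicator B x \<partial>lborel)"
    by (rule tower_density_slice[OF D])
  also have "\<dots> = (\<integral>\<^sup>+x. h D x * indicator (regular_part D) x * indicator B x \<partial>lborel)"
  proof (rule nn_integral_cong_AE)
    show "AE x in lborel. h D x * indicator (interior D) x * indicator B x = h D x * indicator (regular_part D) x * indicator B x"
      using AE_regular_part[OF D]
    proof eventually_elim
      case (elim x)
      have "x \<in> interior D \<longleftrightarrow> x \<in> regular_part D"
        using elim interior_subset unfolding regular_part_def by blast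
      then show ?case by (simp add: indicator_def)
    qed
  qed
  also have "\<dots> = emeasure (density lborel (\<lambda>x. h D x * indicator (regular_part D) x)) B"
    using m B by (simp add: emeasure_density)
  finally show "emeasure (slice_measure (mhat T \<xi> n) D) B = \<dots>" .
qed

text \<open>
  Each level is open and closed in the disjoint union, so a continuous function on it extends by \<open>0\<close>.
\<close>

lemma continuous_slice_function:
  assumes D: "D \<in> tower_sets T \<xi>" and g: "continuous_on UNIV (g :: real \<Rightarrow> real)"
  shows "continuous_map (tower_topology T \<xi>) euclideanreal (\<lambda>p. indicator (tower_copy D) p * g (snd p))"
proof -
  have "openin (tower_topology T \<xi>) {p \<in> tower T \<xi>. indicator (tower_copy D) p * g (snd p) \<in> U}" if U: "open U" for U
    unfolding tower_topology_def openin_sum_topology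
  proof (intro conjI ballI)
    show "{p \<in> tower T \<xi>. indicator (tower_copy D) p * g (snd p) \<in> U}
        \<subseteq> Sigma (tower_sets T \<xi>) (topspace \<circ> (\<lambda>D. top_of_set (closure D)))" by (auto simp: tower_def)
    fix D' assume D': "D' \<in> tower_sets T \<xi>"
    have "{x. (D', x) \<in> {p \<in> tower T \<xi>. indicator (tower_copy D) p * g (snd p) \<in> U}}
        = closure D' \<inter> (if D' = D then g -` U else if 0 \<in> U then UNIV else {})"
      using D' by (auto simp: tower_def tower_copy_def split: split_indicator)
    moreover have "open (g -` U)" using g U by (simp add: continuous_on_open_vimage)
    then have "open (if D' = D then g -` U else if 0 \<in> U then UNIV else {})" by simp
    ultimately show "openin (top_of_set (closure D'))
        {x. (D', x) \<in> {p \<in> tower T \<xi>. indicator (tower_copy D) p * g (snd p) \<in> U}}"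
      by (simp only: openin_open_Int)
  qed
  then show ?thesis unfolding continuous_map_def topspace_tower by auto
qed

lemma slice_integrals_converge:
  assumes weak: "weak_star_conv (tower_topology T \<xi>) (\<lambda>k. mhat T \<xi> (r k)) N"
    and N: "sets N = sets (tower_borel T \<xi>)" and D: "D \<in> tower_sets T \<xi>"
    and g: "continuous_on UNIV (g :: real \<Rightarrow> real)" "\<And>x. \<bar>g x\<bar> \<le> 1"
  shows "(\<lambda>k. integral\<^sup>L (slice_measure (mhat T \<xi> (r k)) D) g) \<longlonglongrightarrow> integral\<^sup>L (slice_measure N D) g"
proof -
  let ?f = "\<lambda>p. indicator (tower_copy D) p * g (snd p)"
  have gm: "g \<in> borel_measurable borel" using g(1) by (rule borel_measurable_continuous_onI)
  have "bounded (?f ` topspace (tower_topology T \<xi>))"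
  proof (rule boundedI)
    fix y assume "y \<in> ?f ` topspace (tower_topology T \<xi>)"
    then obtain p where "y = ?f p" by blast
    then show "norm y \<le> 1" using g(2)[of "snd p"] by (auto split: split_indicator)
  qed
  then have "(\<lambda>k. integral\<^sup>L (mhat T \<xi> (r k)) ?f) \<longlonglongrightarrow> integral\<^sup>L N ?f"
    using weak continuous_slice_function[OF D g(1)] unfolding weak_star_conv_def by blast
  then show ?thesis
    unfolding integral_slice_measure[OF N D gm] integral_slice_measure[OF sets_mhat D gm] .
qed

end

section \<open>Decomposition of the limit\<close>

context hofbauer_tower
begin

text \<open>
  The density of the limit on one level of positive mass, not yet normalised and defined only up to the endpoints
  of the level.
\<close>

lemma limit_slice_density:
  assumes weak: "weak_star_conv (tower_topology T \<xi>) (\<lambda>k. mhat T \<xi> (r k)) N" and r: "\<And>k. 1 \<le> r k"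
    and N: "sets N = sets (tower_borel T \<xi>)" "finite_measure N" and D: "D \<in> tower_sets T \<xi>"
    and pos: "0 < measure (slice_measure N D) UNIV"
  obtains \<rho> :: "real \<Rightarrow> real" where "\<rho> \<in> borel_measurable borel" "\<And>x. x \<in> regular_part D \<Longrightarrow> 0 < \<rho> x"
    "\<And>x. x \<notin> regular_part D \<Longrightarrow> \<rho> x = 0"
    "\<And>x y. x \<in> regular_part D \<Longrightarrow> y \<in> regular_part D \<Longrightarrow> \<bar>ln (\<rho> x) - ln (\<rho> y)\<bar> \<le> dist_const * sep_dist x y"
    "slice_measure N D = density lborel (\<lambda>x. ennreal (\<rho> x))"
proof -
  have "\<exists>h. \<forall>k. regular_family (h k) \<and> (\<forall>A\<in>sets (tower_borel T \<xi>). emeasure (mhat T \<xi> (r k)) A = tower_density (h k) A)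
      \<and> (\<forall>D\<in>tower_sets T \<xi>. (\<integral>\<^sup>+x. h k D x * indicator (interior D) x \<partial>lborel) < \<infinity>)"
  proof (rule choice, rule allI)
    fix k
    obtain h where "regular_family h" "\<And>A. A \<in> sets (tower_borel T \<xi>) \<Longrightarrow> emeasure (mhat T \<xi> (r k)) A = tower_density h A"
      "\<And>D. D \<in> tower_sets T \<xi> \<Longrightarrow> (\<integral>\<^sup>+x. h D x * indicator (interior D) x \<partial>lborel) < \<infinity>"
      by (rule mhat_density[OF r[of k]]) iprover
    then show "\<exists>h. regular_family h \<and> (\<forall>A\<in>sets (tower_borel T \<xi>). emeasure (mhat T \<xi> (r k)) A = tower_density h A)
      \<and> (\<forall>D\<in>tower_sets T \<xi>. (\<integral>\<^sup>+x. h D x * indicator (interior D) x \<partial>lborel) < \<infinity>)" by blast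
  qed
  then obtain h where h: "\<And>k. regular_family (h k)"
    "\<And>k A. A \<in> sets (tower_borel T \<xi>) \<Longrightarrow> emeasure (mhat T \<xi> (r k)) A = tower_density (h k) A"
    "\<And>k. (\<integral>\<^sup>+x. h k D x * indicator (interior D) x \<partial>lborel) < \<infinity>" using D by blast
  have slice: "slice_measure (mhat T \<xi> (r k)) D = density lborel (\<lambda>x. h k D x * indicator (regular_part D) x)" for k
    by (rule slice_mhat[OF h(1) h(2) D])
  have sub: "regular_part D \<subseteq> D" "regular_part D \<subseteq> generic"
    using interior_subset by (auto simp: regular_part_def)
  obtain Y where Y: "countable Y" "Y \<subseteq> regular_part D"
    "\<And>x e. x \<in> regular_part D \<Longrightarrow> 0 < e \<Longrightarrow> \<exists>y\<in>Y. sep_dist x y < e"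
    by (rule sep_dist_separable[OF sub(2)]) iprover
  have Dm: "D \<in> sets lborel" using real_interval_borel_measurable[OF is_interval_tower_set[OF D]] by simp
  have "0 < len D" using subinterval_tower_set[OF D] by (simp add: subinterval_def)
  then have "0 < emeasure lborel D" by (simp add: measure_def enn2real_positive_iff)
  moreover have "emeasure lborel (regular_part D) = emeasure lborel D"
    by (rule emeasure_eq_AE[OF _ _ Dm]) (use AE_regular_part[OF D] sub regular_part_borel in auto)
  ultimately have Epos: "0 < emeasure lborel (regular_part D)" by simp
  have "bounded (regular_part D)" using bounded_tower_set[OF D] sub(1) by (rule bounded_subset)
  then have Efin: "emeasure lborel (regular_part D) < \<infinity>" by (rule emeasure_bounded_finite)
  interpret N: finite_measure N by fact
  have fm: "finite_measure (slice_measure N D)"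
  proof
    have "space (slice_measure N D) = UNIV" by (simp add: slice_measure_def)
    then show "emeasure (slice_measure N D) (space (slice_measure N D)) \<noteq> \<infinity>"
      using emeasure_slice_measure[OF N(1) D, of UNIV] by simp
  qed
  have fin: "(\<integral>\<^sup>+x. h k D x * indicator (regular_part D) x \<partial>lborel) < \<infinity>" for k
  proof -
    have "(\<integral>\<^sup>+x. h k D x * indicator (regular_part D) x \<partial>lborel) \<le> (\<integral>\<^sup>+x. h k D x * indicator (interior D) x \<partial>lborel)"
      by (intro nn_integral_mono) (auto simp: regular_part_def split: split_indicator)
    then show ?thesis using h(3) by (rule order_le_less_trans)
  qed
  have reg: "log_regular sep_dist dist_const (regular_part D) (h k D)"
    and hm: "h k D \<in> borel_measurable borel" for k
    using h(1)[of k] D by (auto simp: regular_family_def)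
  have conv: "(\<lambda>k. integral\<^sup>L (density lborel (\<lambda>x. h k D x * indicator (regular_part D) x)) g)
      \<longlonglongrightarrow> integral\<^sup>L (slice_measure N D) g"
    if "continuous_on UNIV g" "\<And>x. \<bar>g x\<bar> \<le> 1" for g :: "real \<Rightarrow> real"
    using slice_integrals_converge[OF weak N(1) D that] unfolding slice .
  show ?thesis
    by (rule weak_limit_log_regular_density[OF regular_part_borel Epos Efin sep_dist_le_1 sep_dist_commute
          Y dist_const_nonneg reg hm fin fm sets_slice_measure[OF N(1) D] pos conv])
      (assumption | rule that)+
qed

text \<open>
  The density of a standard pair on \<open>D\<close>, extended by \<open>0\<close>. Regularity is required at all generic points
  of \<open>D\<close>, including its endpoints.
\<close>

definition standard_density :: "real set \<Rightarrow> (real \<Rightarrow> real) \<Rightarrow> bool" where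
  "standard_density D \<rho> \<longleftrightarrow> \<rho> \<in> borel_measurable borel \<and> (\<forall>x\<in>D. 0 < \<rho> x) \<and> (\<forall>x. x \<notin> D \<longrightarrow> \<rho> x = 0) \<and>
     (\<forall>x\<in>D \<inter> generic. \<forall>y\<in>D \<inter> generic. \<bar>ln (\<rho> x) - ln (\<rho> y)\<bar> \<le> dist_const * sep_dist x y) \<and>
     (\<integral>\<^sup>+x. ennreal (\<rho> x) \<partial>lborel) = 1"

lemma standard_density_uniform:
  assumes D: "D \<in> tower_sets T \<xi>"
  shows "standard_density D (\<lambda>x. indicator D x / len D)"
proof -
  have Dm[measurable]: "D \<in> sets borel" using real_interval_borel_measurable[OF is_interval_tower_set[OF D]] .
  have pos: "0 < len D" using subinterval_tower_set[OF D] by (simp add: subinterval_def)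
  have fin: "emeasure lborel D < \<infinity>" by (rule emeasure_bounded_finite[OF bounded_tower_set[OF D]])
  have "(\<integral>\<^sup>+x. ennreal (indicator D x / len D) \<partial>lborel) = (\<integral>\<^sup>+x. ennreal (1 / len D) * indicator D x \<partial>lborel)"
    by (intro nn_integral_cong) (auto split: split_indicator)
  also have "\<dots> = ennreal (1 / len D) * emeasure lborel D" by (simp add: nn_integral_cmult_indicator)
  also have "emeasure lborel D = ennreal (len D)" using fin by (simp add: emeasure_eq_ennreal_measure less_top)
  also have "ennreal (1 / len D) * ennreal (len D) = 1" using pos by (simp flip: ennreal_mult)
  finally show ?thesis
    unfolding standard_density_def using pos dist_const_nonneg sep_dist_nonneg by simp
qed

text \<open>
  The logarithm of \<open>\<sigma>\<close> is extended from the interior to all generic points of \<open>D\<close>; the value \<open>1\<close> at the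
  countably many other points of \<open>D\<close> is arbitrary.
\<close>

lemma standard_density_extend:
  assumes D: "D \<in> tower_sets T \<xi>" and \<sigma>: "\<sigma> \<in> borel_measurable borel" "\<And>x. x \<in> regular_part D \<Longrightarrow> 0 < \<sigma> x"
    "\<And>x. x \<notin> regular_part D \<Longrightarrow> \<sigma> x = 0"
    "\<And>x y. x \<in> regular_part D \<Longrightarrow> y \<in> regular_part D \<Longrightarrow> \<bar>ln (\<sigma> x) - ln (\<sigma> y)\<bar> \<le> dist_const * sep_dist x y"
    and int: "(\<integral>\<^sup>+x. ennreal (\<sigma> x) \<partial>lborel) = 1"
  obtains \<rho> where "standard_density D \<rho>" "AE x in lborel. \<rho> x = \<sigma> x"
proof -
  have sub: "regular_part D \<subseteq> D \<inter> generic" using interior_subset by (auto simp: regular_part_def)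
  have ne: "regular_part D \<noteq> {}"
  proof
    assume "regular_part D = {}"
    then have "\<sigma> x = 0" for x using \<sigma>(3) by simp
    then show False using int by simp
  qed
  obtain g where g: "\<And>x. x \<in> regular_part D \<Longrightarrow> g x = ln (\<sigma> x)"
    "\<And>x y. x \<in> D \<inter> generic \<Longrightarrow> y \<in> D \<inter> generic \<Longrightarrow> g x \<le> g y + dist_const * sep_dist x y"
  proof (rule Lipschitz_extension[OF ne sub dist_const_nonneg, of sep_dist "\<lambda>x. ln (\<sigma> x)"])
    show "ln (\<sigma> x) \<le> ln (\<sigma> y) + dist_const * sep_dist x y"
      if "x \<in> regular_part D" "y \<in> regular_part D" for x y using \<sigma>(4)[OF that] by linarith
  qed (auto intro: sep_dist_nonneg sep_dist_triangle)
  define \<rho> where "\<rho> x = (if x \<in> D then if x \<in> generic then exp (g x) else 1 else 0)" for x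
  have eq: "\<sigma> x = \<rho> x" if "x \<notin> D - regular_part D" for x
  proof (cases "x \<in> regular_part D")
    case True
    then show ?thesis using sub g(1)[OF True] \<sigma>(2)[OF True] by (auto simp: \<rho>_def)
  next
    case False
    then show ?thesis using that \<sigma>(3) by (simp add: \<rho>_def)
  qed
  have m: "\<rho> \<in> borel_measurable borel"
    by (rule measurable_discrete_difference[OF \<sigma>(1) countable_Diff_regular_part[OF D]]) (auto intro: eq)
  have ae: "AE x in lborel. \<rho> x = \<sigma> x"
    using AE_regular_part[OF D] by eventually_elim (rule eq[symmetric], blast)
  have "(\<integral>\<^sup>+x. ennreal (\<rho> x) \<partial>lborel) = (\<integral>\<^sup>+x. ennreal (\<sigma> x) \<partial>lborel)"
    by (rule nn_integral_cong_AE) (use ae in \<open>eventually_elim, simp\<close>)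
  moreover have "\<bar>ln (\<rho> x) - ln (\<rho> y)\<bar> \<le> dist_const * sep_dist x y"
    if xy: "x \<in> D \<inter> generic" "y \<in> D \<inter> generic" for x y
    using g(2)[OF xy] g(2)[OF xy(2,1)] xy sep_dist_commute[of x y] by (simp add: \<rho>_def abs_le_iff)
  ultimately have "standard_density D \<rho>"
    unfolding standard_density_def using m int by (auto simp: \<rho>_def)
  then show ?thesis using ae by (rule that)
qed

text \<open>
  The restriction of the limit to a level is its mass times a standard density. On a level of mass zero
  any standard density will do.
\<close>

lemma limit_slice_standard_density:
  assumes weak: "weak_star_conv (tower_topology T \<xi>) (\<lambda>k. mhat T \<xi> (r k)) N" and r: "\<And>k. 1 \<le> r k"
    and N: "sets N = sets (tower_borel T \<xi>)" "finite_measure N" and D: "D \<in> tower_sets T \<xi>"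
  obtains \<rho> where "standard_density D \<rho>"
    "\<And>B. B \<in> sets borel \<Longrightarrow> emeasure N ({D} \<times> (closure D \<inter> B))
        = emeasure N (tower_copy D) * (\<integral>\<^sup>+x. ennreal (\<rho> x) * indicator B x \<partial>lborel)"
proof -
  interpret N: finite_measure N by fact
  have copy: "tower_copy D = {D} \<times> (closure D \<inter> UNIV)" by (simp add: tower_copy_def)
  have mass: "emeasure (slice_measure N D) UNIV = emeasure N (tower_copy D)"
    unfolding copy by (rule emeasure_slice_measure[OF N(1) D]) simp
  show ?thesis
  proof (cases "measure N (tower_copy D) = 0")
    case True
    then have z: "emeasure N (tower_copy D) = 0" by (simp add: N.emeasure_eq_measure)
    have "emeasure N ({D} \<times> (closure D \<inter> B)) = 0" for B
    proof -
      have "emeasure N ({D} \<times> (closure D \<inter> B)) \<le> emeasure N (tower_copy D)"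
        using tower_copy_in_tower_borel[OF D] N(1) by (intro emeasure_mono) (auto simp: tower_copy_def)
      then show ?thesis using z by simp
    qed
    then show ?thesis using that[OF standard_density_uniform[OF D]] z by simp
  next
    case False
    define a where "a = measure N (tower_copy D)"
    have a: "0 < a" "emeasure N (tower_copy D) = ennreal a"
      using False by (auto simp: a_def N.emeasure_eq_measure zero_less_measure_iff)
    have "measure (slice_measure N D) UNIV = a" using mass by (simp add: a_def measure_def)
    then have "0 < measure (slice_measure N D) UNIV" using a by simp
    from limit_slice_density[OF weak r N D this] obtain \<sigma> where \<sigma>: "\<sigma> \<in> borel_measurable borel"
      "\<And>x. x \<in> regular_part D \<Longrightarrow> 0 < \<sigma> x" "\<And>x. x \<notin> regular_part D \<Longrightarrow> \<sigma> x = 0"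
      "\<And>x y. x \<in> regular_part D \<Longrightarrow> y \<in> regular_part D \<Longrightarrow> \<bar>ln (\<sigma> x) - ln (\<sigma> y)\<bar> \<le> dist_const * sep_dist x y"
      "slice_measure N D = density lborel (\<lambda>x. ennreal (\<sigma> x))" by blast
    note [measurable] = \<sigma>(1)
    have \<sigma>0: "0 \<le> \<sigma> x" for x using \<sigma>(2)[of x] \<sigma>(3)[of x] by (cases "x \<in> regular_part D") auto
    have scale: "ennreal (\<sigma> x) = ennreal a * ennreal (\<sigma> x / a)" for x using a \<sigma>0 by (simp flip: ennreal_mult)
    have "ennreal a = (\<integral>\<^sup>+x. ennreal (\<sigma> x) \<partial>lborel)"
      using mass a(2) \<sigma>(5) by (simp add: emeasure_density)
    also have "\<dots> = ennreal a * (\<integral>\<^sup>+x. ennreal (\<sigma> x / a) \<partial>lborel)"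
      by (subst scale) (rule nn_integral_cmult, measurable)
    finally have "ennreal a * 1 = ennreal a * (\<integral>\<^sup>+x. ennreal (\<sigma> x / a) \<partial>lborel)" by simp
    then have one: "(\<integral>\<^sup>+x. ennreal (\<sigma> x / a) \<partial>lborel) = 1"
      using a by (subst (asm) ennreal_mult_cancel_left) auto
    obtain \<rho> where \<rho>: "standard_density D \<rho>" "AE x in lborel. \<rho> x = \<sigma> x / a"
    proof (rule standard_density_extend[OF D, of "\<lambda>x. \<sigma> x / a"])
      show "\<bar>ln (\<sigma> x / a) - ln (\<sigma> y / a)\<bar> \<le> dist_const * sep_dist x y"
        if "x \<in> regular_part D" "y \<in> regular_part D" for x y
        using \<sigma>(4)[OF that] \<sigma>(2)[OF that(1)] \<sigma>(2)[OF that(2)] a by (simp add: ln_div)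
    qed (use \<sigma> a one in auto)
    have [measurable]: "\<rho> \<in> borel_measurable borel" using \<rho>(1) by (simp add: standard_density_def)
    show ?thesis
    proof (rule that[OF \<rho>(1)])
      fix B :: "real set" assume B[measurable]: "B \<in> sets borel"
      have "emeasure N ({D} \<times> (closure D \<inter> B)) = emeasure (slice_measure N D) B"
        using emeasure_slice_measure[OF N(1) D B] by simp
      also have "\<dots> = (\<integral>\<^sup>+x. ennreal (\<sigma> x) * indicator B x \<partial>lborel)"
        unfolding \<sigma>(5) by (simp add: emeasure_density)
      also have "\<dots> = (\<integral>\<^sup>+x. ennreal a * (ennreal (\<rho> x) * indicator B x) \<partial>lborel)"
        by (rule nn_integral_cong_AE) (use \<rho>(2) in \<open>eventually_elim, simp add: scale mult.assoc\<close>)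
      also have "\<dots> = ennreal a * (\<integral>\<^sup>+x. ennreal (\<rho> x) * indicator B x \<partial>lborel)"
        by (rule nn_integral_cmult) measurable
      finally show "emeasure N ({D} \<times> (closure D \<inter> B))
          = emeasure N (tower_copy D) * (\<integral>\<^sup>+x. ennreal (\<rho> x) * indicator B x \<partial>lborel)" using a by simp
    qed
  qed
qed

text \<open>
  The measure on the tower that lives on the level \<open>D\<close> and has density \<open>\<rho>\<close>. The points outside the closure of
  \<open>D\<close>, which have measure zero for the densities in use, are sent to an arbitrary point of the level to
  obtain a map into the tower.
\<close>

definition lift_density :: "real set \<Rightarrow> (real \<Rightarrow> real) \<Rightarrow> (real set \<times> real) measure" where
  "lift_density D \<rho> = distr (density lborel (\<lambda>x. ennreal (\<rho> x))) (tower_borel T \<xi>)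
     (\<lambda>x. (D, if x \<in> closure D then x else SOME c. c \<in> D))"

lemma
  assumes D: "D \<in> tower_sets T \<xi>" and \<rho>: "standard_density D \<rho>"
  shows sets_lift_density: "sets (lift_density D \<rho>) = sets (tower_borel T \<xi>)"
    and emeasure_lift_density: "\<And>A. A \<in> sets (tower_borel T \<xi>) \<Longrightarrow>
       emeasure (lift_density D \<rho>) A = (\<integral>\<^sup>+x. ennreal (\<rho> x) * indicator {x. (D, x) \<in> A} x \<partial>lborel)"
proof -
  show "sets (lift_density D \<rho>) = sets (tower_borel T \<xi>)" by (simp add: lift_density_def)
  have [measurable]: "\<rho> \<in> borel_measurable borel" and \<rho>0: "\<And>x. x \<notin> D \<Longrightarrow> \<rho> x = 0"
    using \<rho> by (auto simp: standard_density_def)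
  define c where "c = (SOME c. c \<in> D)"
  define e where "e x = (if x \<in> closure D then x else c)" for x
  have "D \<noteq> {}" using interior_tower_set_nonempty[OF D] by auto
  then have "c \<in> D" unfolding c_def by (rule some_in_eq[THEN iffD2])
  then have ecl: "e x \<in> closure D" for x using closure_subset by (auto simp: e_def)
  have [measurable]: "closure D \<in> sets borel" by (rule closure_borel)
  have e[measurable]: "e \<in> borel_measurable borel" unfolding e_def[abs_def] by measurable
  have emb: "(\<lambda>x. (D, e x)) \<in> measurable borel (tower_borel T \<xi>)"
  proof (rule measurableI)
    show "(D, e x) \<in> space (tower_borel T \<xi>)" for x using D ecl by (simp add: space_tower_borel tower_def)
    fix A assume "A \<in> sets (tower_borel T \<xi>)"
    then have "{x. (D, x) \<in> A} \<in> sets borel" by (rule slice_borel)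
    then have "e -` {x. (D, x) \<in> A} \<inter> space borel \<in> sets borel" by (rule measurable_sets[OF e])
    moreover have "(\<lambda>x. (D, e x)) -` A \<inter> space borel = e -` {x. (D, x) \<in> A} \<inter> space borel" by auto
    ultimately show "(\<lambda>x. (D, e x)) -` A \<inter> space borel \<in> sets borel" by simp
  qed
  show "emeasure (lift_density D \<rho>) A = (\<integral>\<^sup>+x. ennreal (\<rho> x) * indicator {x. (D, x) \<in> A} x \<partial>lborel)"
    if A: "A \<in> sets (tower_borel T \<xi>)" for A
  proof -
    have pre: "(\<lambda>x. (D, e x)) -` A \<in> sets borel" using measurable_sets[OF emb A] by simp
    have "emeasure (lift_density D \<rho>) A = emeasure (density lborel (\<lambda>x. ennreal (\<rho> x))) ((\<lambda>x. (D, e x)) -` A)"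
      unfolding lift_density_def e_def[symmetric] c_def[symmetric] using emb A
      by (subst emeasure_distr) (auto simp: e_def c_def)
    also have "\<dots> = (\<integral>\<^sup>+x. ennreal (\<rho> x) * indicator ((\<lambda>x. (D, e x)) -` A) x \<partial>lborel)"
      using pre by (simp add: emeasure_density)
    also have "\<dots> = (\<integral>\<^sup>+x. ennreal (\<rho> x) * indicator {x. (D, x) \<in> A} x \<partial>lborel)"
    proof (intro nn_integral_cong)
      fix x
      have "e x = x" if "x \<in> D" using that closure_subset by (auto simp: e_def)
      then show "ennreal (\<rho> x) * indicator ((\<lambda>x. (D, e x)) -` A) x = ennreal (\<rho> x) * indicator {x. (D, x) \<in> A} x"
        using \<rho>0[of x] by (cases "x \<in> D") (auto simp: indicator_def)
    qed
    finally show ?thesis .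
  qed
qed

lemma measurable_snd_leb_M: "snd \<in> measurable (tower_borel T \<xi>) leb_M"
  unfolding leb_M_def
proof (rule measurable_restrict_space2)
  show "snd \<in> space (tower_borel T \<xi>) \<rightarrow> unit_M"
    unfolding space_tower_borel tower_def by (intro funcsetI) (use closure_tower_set_subset in fastforce)
  show "snd \<in> measurable (tower_borel T \<xi>) lborel" using measurable_snd_tower by simp
qed

lemma lift_density_standard_pair:
  assumes D: "D \<in> tower_sets T \<xi>" and \<rho>: "standard_density D \<rho>" and Cr: "dist_const \<le> Cr"
  shows "prob_space (lift_density D \<rho>)" "measure (lift_density D \<rho>) (tower_copy D) = 1"
    "standard_pair T \<xi> \<gamma> Cr D (distr (lift_density D \<rho>) leb_M snd)"
proof -
  let ?L = "lift_density D \<rho>"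
  note sets_L = sets_lift_density[OF D \<rho>] and em_L = emeasure_lift_density[OF D \<rho>]
  have sp: "space ?L = tower T \<xi>" using sets_eq_imp_space_eq[OF sets_L] space_tower_borel by simp
  have [measurable]: "\<rho> \<in> borel_measurable borel" and \<rho>0: "\<And>x. x \<notin> D \<Longrightarrow> \<rho> x = 0"
    and \<rho>pos: "\<And>x. x \<in> D \<Longrightarrow> 0 < \<rho> x" and one: "(\<integral>\<^sup>+x. ennreal (\<rho> x) \<partial>lborel) = 1"
    and lip: "\<And>x y. x \<in> D \<inter> generic \<Longrightarrow> y \<in> D \<inter> generic \<Longrightarrow> \<bar>ln (\<rho> x) - ln (\<rho> y)\<bar> \<le> dist_const * sep_dist x y"
    using \<rho> by (auto simp: standard_density_def)
  have full: "(\<integral>\<^sup>+x. ennreal (\<rho> x) * indicator B x \<partial>lborel) = 1" if "D \<subseteq> B" for B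
  proof -
    have "ennreal (\<rho> x) * indicator B x = ennreal (\<rho> x)" for x
      using that \<rho>0[of x] by (cases "x \<in> D") (auto simp: indicator_def)
    then show ?thesis using one by simp
  qed
  have "D \<subseteq> {x. (D, x) \<in> tower T \<xi>}" "D \<subseteq> {x. (D, x) \<in> tower_copy D}"
    using D closure_subset by (auto simp: tower_def tower_copy_def)
  then have e1: "emeasure ?L (tower T \<xi>) = 1" "emeasure ?L (tower_copy D) = 1"
    using em_L[of "tower T \<xi>"] em_L[OF tower_copy_in_tower_borel[OF D]] full
      sets.top[of "tower_borel T \<xi>"] space_tower_borel by auto
  show prob: "prob_space ?L" using e1(1) sp by (intro prob_spaceI) simp
  show "measure ?L (tower_copy D) = 1" using e1(2) by (simp add: measure_def)
  define \<nu> where "\<nu> = distr ?L leb_M snd"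
  have snd: "snd \<in> measurable ?L leb_M" using measurable_snd_leb_M measurable_cong_sets[OF sets_L refl] by blast
  have leb: "B \<in> sets leb_M \<longleftrightarrow> B \<subseteq> unit_M \<and> B \<in> sets borel" for B
    unfolding leb_M_def by (subst sets_restrict_space_iff) auto
  have \<rho>M: "\<rho> \<in> borel_measurable leb_M" unfolding leb_M_def by (rule measurable_restrict_space1) simp
  have \<nu>: "\<nu> = density leb_M (\<lambda>x. ennreal (\<rho> x))"
  proof (rule measure_eqI)
    show "sets \<nu> = sets (density leb_M (\<lambda>x. ennreal (\<rho> x)))" by (simp add: \<nu>_def)
    fix B assume "B \<in> sets \<nu>"
    then have B: "B \<in> sets leb_M" by (simp add: \<nu>_def)
    have s: "snd -` B \<inter> tower T \<xi> \<in> sets (tower_borel T \<xi>)"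
      using measurable_sets[OF measurable_snd_leb_M B] space_tower_borel by simp
    have "emeasure \<nu> B = emeasure ?L (snd -` B \<inter> tower T \<xi>)"
      unfolding \<nu>_def using emeasure_distr[OF snd B] sp by simp
    also have "\<dots> = (\<integral>\<^sup>+x. ennreal (\<rho> x) * indicator {x. (D, x) \<in> snd -` B \<inter> tower T \<xi>} x \<partial>lborel)" by (rule em_L[OF s])
    also have "\<dots> = (\<integral>\<^sup>+x. ennreal (\<rho> x) * indicator B x * indicator unit_M x \<partial>lborel)"
    proof (intro nn_integral_cong)
      fix x
      have "x \<in> closure D" "x \<in> unit_M" if "x \<in> D" using that closure_subset tower_set_subset[OF D] by blast+
      then show "ennreal (\<rho> x) * indicator {x. (D, x) \<in> snd -` B \<inter> tower T \<xi>} x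
          = ennreal (\<rho> x) * indicator B x * indicator unit_M x"
        using D \<rho>0[of x] by (cases "x \<in> D") (auto simp: indicator_def tower_def)
    qed
    also have "\<dots> = (\<integral>\<^sup>+x. ennreal (\<rho> x) * indicator B x \<partial>leb_M)"
      unfolding leb_M_def by (subst nn_integral_restrict_space) auto
    also have "\<dots> = emeasure (density leb_M (\<lambda>x. ennreal (\<rho> x))) B"
      using \<rho>M B by (simp add: emeasure_density)
    finally show "emeasure \<nu> B = emeasure (density leb_M (\<lambda>x. ennreal (\<rho> x))) B" .
  qed
  have Dleb: "D \<in> sets leb_M"
    using leb tower_set_subset[OF D] real_interval_borel_measurable[OF is_interval_tower_set[OF D]] by blast
  have \<nu>D: "measure \<nu> D = 1"
  proof -
    have "snd -` D \<inter> tower T \<xi> \<in> sets (tower_borel T \<xi>)"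
      using measurable_sets[OF measurable_snd_leb_M Dleb] space_tower_borel by simp
    then have "emeasure ?L (snd -` D \<inter> tower T \<xi>) = 1"
      using em_L full[of "{x. (D, x) \<in> snd -` D \<inter> tower T \<xi>}"] D closure_subset by (auto simp: tower_def)
    then have "emeasure \<nu> D = 1" unfolding \<nu>_def using emeasure_distr[OF snd Dleb] sp by simp
    then show ?thesis by (simp add: measure_def)
  qed
  define f where "f = (\<lambda>x. indicator D x * ln (\<rho> x))"
  have semi: "dyn_seminorm T \<xi> D \<gamma> f \<le> ennreal Cr"
    unfolding dyn_seminorm_def
  proof (rule SUP_least, clarify)
    fix x y assume xy: "x \<in> D" "x \<notin> endpoints_inf T \<xi>" "y \<in> D" "y \<notin> endpoints_inf T \<xi>" "x \<noteq> y"
    then have g: "x \<in> D \<inter> generic" "y \<in> D \<inter> generic" using tower_set_subset[OF D] by (auto simp: generic_def)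
    define q where "q = \<gamma> ^ sep_time T \<xi> x y"
    have "0 < q" using gamma_pos by (simp add: q_def)
    have "\<bar>f x - f y\<bar> \<le> dist_const * q" using lip[OF g] xy by (simp add: f_def sep_dist_def q_def)
    then have "\<bar>f x - f y\<bar> / q \<le> dist_const" using \<open>0 < q\<close> by (simp add: field_simps)
    then show "ennreal (\<bar>f x - f y\<bar> / \<gamma> ^ sep_time T \<xi> x y) \<le> ennreal Cr"
      unfolding q_def using Cr by (intro ennreal_leI) simp
  qed
  have "f \<in> dyn_space T \<xi> D \<gamma>"
    unfolding dyn_space_def using semi by (auto simp: f_def order_le_less_trans[OF semi[unfolded f_def]])
  moreover have "prob_space \<nu>" unfolding \<nu>_def using prob_space.prob_space_distr[OF prob snd] .
  moreover have "absolutely_continuous leb_M \<nu>" unfolding \<nu> using \<rho>M by (intro absolutely_continuousI_density) simp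
  moreover have "0 \<le> \<rho> x" for x using \<rho>0[of x] \<rho>pos[of x] by (cases "x \<in> D") auto
  ultimately have "standard_pair T \<xi> \<gamma> Cr D \<nu>"
    unfolding standard_pair_def using subinterval_tower_set[OF D] \<nu>D \<rho>M \<rho>pos semi \<nu> unfolding f_def
    by (intro conjI exI[of _ \<rho>]) (auto simp: \<nu>_def)
  then show "standard_pair T \<xi> \<gamma> Cr D (distr ?L leb_M snd)" unfolding \<nu>_def .
qed

lemma pesin_sinai_weak_limit:
  assumes weak: "weak_star_conv (tower_topology T \<xi>) (\<lambda>k. mhat T \<xi> (r k)) N" and r: "\<And>k. 1 \<le> r k"
    and N: "sets N = sets (tower_borel T \<xi>)" "prob_space N" and Cr: "dist_const \<le> Cr"
  shows "pesin_sinai T \<xi> \<gamma> Cr N"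
proof -
  interpret N: prob_space N by fact
  have spN: "space N = tower T \<xi>" using sets_eq_imp_space_eq[OF N(1)] space_tower_borel by simp
  have "\<exists>\<rho>. \<forall>D\<in>tower_sets T \<xi>. standard_density D (\<rho> D) \<and>
      (\<forall>B\<in>sets borel. emeasure N ({D} \<times> (closure D \<inter> B))
        = emeasure N (tower_copy D) * (\<integral>\<^sup>+x. ennreal (\<rho> D x) * indicator B x \<partial>lborel))"
  proof (rule bchoice, rule ballI)
    fix D assume D: "D \<in> tower_sets T \<xi>"
    obtain \<rho> where "standard_density D \<rho>"
      "\<And>B. B \<in> sets borel \<Longrightarrow> emeasure N ({D} \<times> (closure D \<inter> B))
        = emeasure N (tower_copy D) * (\<integral>\<^sup>+x. ennreal (\<rho> x) * indicator B x \<partial>lborel)"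
      by (rule limit_slice_standard_density[OF weak r N(1) N.finite_measure_axioms D]) iprover
    then show "\<exists>\<rho>. standard_density D \<rho> \<and> (\<forall>B\<in>sets borel. emeasure N ({D} \<times> (closure D \<inter> B))
        = emeasure N (tower_copy D) * (\<integral>\<^sup>+x. ennreal (\<rho> x) * indicator B x \<partial>lborel))" by blast
  qed
  then obtain \<rho> where \<rho>: "\<And>D. D \<in> tower_sets T \<xi> \<Longrightarrow> standard_density D (\<rho> D)"
    "\<And>D B. D \<in> tower_sets T \<xi> \<Longrightarrow> B \<in> sets borel \<Longrightarrow> emeasure N ({D} \<times> (closure D \<inter> B))
        = emeasure N (tower_copy D) * (\<integral>\<^sup>+x. ennreal (\<rho> D x) * indicator B x \<partial>lborel)" by blast
  define wt where "wt D = measure N (tower_copy D)" for D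
  define L where "L D = lift_density D (\<rho> D)" for D
  have part: "wt D * measure (L D) A = measure N (A \<inter> tower_copy D)"
    if D: "D \<in> tower_sets T \<xi>" and A: "A \<in> sets (tower_borel T \<xi>)" for D A
  proof -
    have eq: "A \<inter> tower_copy D = {D} \<times> (closure D \<inter> {x. (D, x) \<in> A})" by (auto simp: tower_copy_def)
    have "emeasure N (A \<inter> tower_copy D) = emeasure N (tower_copy D) * emeasure (L D) A"
      unfolding eq \<rho>(2)[OF D slice_borel[OF A]] L_def emeasure_lift_density[OF D \<rho>(1)[OF D] A] ..
    then show ?thesis by (simp add: measure_def wt_def enn2real_mult)
  qed
  have sum: "((\<lambda>D. wt D * measure (L D) A) has_sum measure N A) (tower_sets T \<xi>)"
    if A: "A \<in> sets (tower_borel T \<xi>)" for A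
  proof -
    have "((\<lambda>D. measure N (A \<inter> tower_copy D)) has_sum measure N (\<Union>D\<in>tower_sets T \<xi>. A \<inter> tower_copy D)) (tower_sets T \<xi>)"
    proof (rule has_sum_measure_UN[OF N.finite_measure_axioms countable_tower_sets])
      show "A \<inter> tower_copy D \<in> sets N" if "D \<in> tower_sets T \<xi>" for D
        using A tower_copy_in_tower_borel[OF that] N(1) by auto
      show "disjoint_family_on (\<lambda>D. A \<inter> tower_copy D) (tower_sets T \<xi>)"
        by (auto simp: disjoint_family_on_def tower_copy_def)
    qed
    moreover have "(\<Union>D\<in>tower_sets T \<xi>. A \<inter> tower_copy D) = A"
      using A sets_tower_borel_iff[of A] by (auto simp: tower_def tower_copy_def)
    ultimately have "((\<lambda>D. measure N (A \<inter> tower_copy D)) has_sum measure N A) (tower_sets T \<xi>)" by simp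
    then show ?thesis by (rule has_sum_cong[THEN iffD1, rotated]) (simp add: part[OF _ A])
  qed
  have "(wt has_sum 1) (tower_sets T \<xi>)"
  proof -
    have top: "tower T \<xi> \<in> sets (tower_borel T \<xi>)" using sets.top[of "tower_borel T \<xi>"] space_tower_borel by simp
    have "wt D = wt D * measure (L D) (tower T \<xi>)" if D: "D \<in> tower_sets T \<xi>" for D
    proof -
      have "tower T \<xi> \<inter> tower_copy D = tower_copy D" using D by (auto simp: tower_def tower_copy_def)
      then show ?thesis using part[OF D top] by (simp add: wt_def)
    qed
    moreover have "measure N (tower T \<xi>) = 1" using N.prob_space spN by simp
    ultimately show ?thesis
      using sum[OF top] has_sum_cong[of "tower_sets T \<xi>" wt "\<lambda>D. wt D * measure (L D) (tower T \<xi>)"] by simp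
  qed
  moreover have "0 \<le> wt D \<and> wt D \<le> 1" for D by (simp add: wt_def)
  moreover have "sets (L D) = sets (tower_borel T \<xi>) \<and> prob_space (L D) \<and> measure (L D) (tower_copy D) = 1 \<and>
      standard_pair T \<xi> \<gamma> Cr D (distr (L D) leb_M snd)" if D: "D \<in> tower_sets T \<xi>" for D
    using sets_lift_density[OF D \<rho>(1)[OF D]] lift_density_standard_pair[OF D \<rho>(1)[OF D] Cr] by (simp add: L_def)
  ultimately show ?thesis
    unfolding pesin_sinai_def using sum by (intro exI[of _ wt] exI[of _ L]) blast
qed

end

theorem lemma5p5:
  fixes T :: "real \<Rightarrow> real" and \<xi> :: "real set set"
    and CJ \<gamma>J \<gamma> Cr :: real
    and \<mu> :: "real measure" and \<mu>hat :: "(real set \<times> real) measure"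
  assumes map: "piecewise_monotone_map T \<xi>"
    and tower_intervals: "\<forall>D\<in>tower_sets T \<xi>. is_interval D"
    and H1: "H1 T \<xi>" and H2: "H2 T \<xi> CJ \<gamma>J" and H3: "H3 T \<xi>"
    and gamma: "\<gamma>J \<le> \<gamma>" "\<gamma> < 1"
    and Cr: "Cr \<ge> max 1 (2 * CJ / (inverse \<gamma> - 1))"
    and mu: "limit_acip T \<mu>"
    and muhat_prob: "sets \<mu>hat = sets (tower_borel T \<xi>)" "prob_space \<mu>hat"
    and muhat_limit: "\<exists>r. strict_mono r \<and> (\<forall>k. 1 \<le> r k) \<and>
          weak_star_conv (tower_topology T \<xi>) (\<lambda>k. mhat T \<xi> (r k)) \<mu>hat"
    and muhat_proj: "distr \<mu>hat leb_M snd = \<mu>"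
  shows "pesin_sinai T \<xi> \<gamma> Cr \<mu>hat"
proof -
  interpret hofbauer_tower T \<xi> CJ \<gamma>J \<gamma>
    by unfold_locales (fact map H1 H2 gamma tower_intervals)+
  obtain r where r: "\<And>k. 1 \<le> r k" "weak_star_conv (tower_topology T \<xi>) (\<lambda>k. mhat T \<xi> (r k)) \<mu>hat"
    using muhat_limit by blast
  have "0 < inverse \<gamma> - 1" using gamma_pos gamma by (simp add: field_simps)
  have "dist_const = CJ / (inverse \<gamma> - 1)"
    unfolding dist_const_def using gamma_pos gamma by (simp add: field_simps)
  also have "\<dots> \<le> 2 * CJ / (inverse \<gamma> - 1)"
    using CJ_pos \<open>0 < inverse \<gamma> - 1\<close> by (intro divide_right_mono) auto
  also have "\<dots> \<le> Cr" using Cr by simp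
  finally have "dist_const \<le> Cr" .
  then show ?thesis using pesin_sinai_weak_limit[OF r(2,1) muhat_prob] by blast
qed

end
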